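(* Let $F, D\in B^a(H_{\mathcal A})$. Then $$\sigma_{le}^{\mathcal A}(F)\cup\bigl(\sigma_{le}^{\mathcal A}(D)\cap L'(F,D)\bigr)\subseteq\bigcap_{C\in B^a(H_{\mathcal A})}\sigma_{le}^{\mathcal A}(\mathbf M_C^{\mathcal A})\subseteq\sigma_{le}^{\mathcal A}(F)\cup\bigl(\sigma_{le}^{\mathcal A}(D)\cap L(F,D)\bigr),$$ where $\mathbf M_C^{\mathcal A} = \begin{pmatrix} F & C \\ 0 & D\end{pmatrix}$ acts on $H_{\mathcal A}\oplus H_{\mathcal A}$.
   Context: $\mathcal A$ is a unital $C^*$-algebra with center $Z(\mathcal A)$, and $H_{\mathcal A} = \ell^2(\mathcal A)$ is the standard Hilbert $\mathcal A$-module. For Hilbert $\mathcal A$-modules $H,K$, $B^a(H,K)$ denotes the bounded adjointable $\mathcal A$-linear operators $H\to K$, and $B^a(H) = B^a(H,H)$. For $\alpha\in Z(\mathcal A)$, $\alpha I$ (also written $\alpha 1$) is the operator of multiplication by $\alpha$ (coordinatewise) on $H_{\mathcal A}$ or on $H_{\mathcal A}\oplus H_{\mathcal A}$. $\oplus$ is the orthogonal direct sum; $\tilde\oplus$ denotes a direct sum of closed submodules that need not be orthogonal. A Hilbert module is finitely generated if it equals the linear span (over $\mathbb C$ and $\mathcal A$) of a finite subset. An isomorphism is a bounded $\mathcal A$-linear bijection with bounded inverse, and $\cong$ means existence of an isomorphism. For a decomposition $H = M_1\tilde\oplus N_1 \stackrel{T}{\longrightarrow} M_2\tilde\oplus N_2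 = H$ into closed submodules, saying $T$ has matrix $\begin{pmatrix} T_1 & 0\\ 0& T_4\end{pmatrix}$ means $T(M_1)\subseteq M_2$, $T(N_1)\subseteq N_2$, $T_1 = T|_{M_1}: M_1\to M_2$, $T_4 = T|_{N_1}:N_1\to N_2$. For $H = H_{\mathcal A}$ or $H_{\mathcal A}\oplus H_{\mathcal A}$, $T\in\mathcal M\Phi_+(H)$ (upper semi-$\mathcal A$-Fredholm) means $T\in B^a(H)$ and there is such a decomposition with diagonal matrix, $T_1$ an isomorphism and $N_1$ finitely generated. For $T\in B^a(H)$, $\sigma_{le}^{\mathcal A}(T) = \{\alpha\in Z(\mathcal A) : T-\alpha I\notin\mathcal M\Phi_+(H)\}$. $L'(F,D)$ is the set of all $\alpha\in Z(\mathcal A)$ such that there exist no decompositions $$H_{\mathcal A}\oplus H_{\mathcal A} = M_1\tilde\oplus N_1 \stackrel{F'_\alpha}{\longrightarrow} M_2\tilde\oplus N_2 = H_{\mathcal A}\oplus H_{\mathcal A},\qquad H_{\mathcal A}\oplus H_{\mathcal A} = M_1'\tilde\oplus N_1' \stackrel{D'_\alpha}{\longrightarrow} M_2'\tilde\oplus N_2' = H_{\mathcal A}\oplus H_{\mathcal A},$$ where $F'_\alpha = \begin{pmatrix} F-\alpha 1 & 0\\ 0 & 1\end{pmatrix}$ and $D'_\alpha = \begin{pmatrix} 1 & 0\\ 0 & D-\alpha 1\end{pmatrix}$, with respect to which $F'_\alpha, D'_\alpha$ have diagonal matrices with $(F'_\alpha)_1$, $(D'_\alpha)_1$ isomorphisms,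 $M_2\cong M_1'$, $N_2\cong N_1'$, $N_1$ is finitely generated, and $N_2, N_1'$ are closed but not finitely generated. $L(F,D)$ is the set of all $\alpha\in Z(\mathcal A)$ such that there exist no decompositions $$H_{\mathcal A} = M_1 \tilde\oplus N_1 \stackrel{F-\alpha 1}{\longrightarrow} N_2^\perp \oplus N_2 = H_{\mathcal A}, \qquad H_{\mathcal A} = {N_1'}^\perp \oplus N_1' \stackrel{D-\alpha 1}{\longrightarrow} M_2' \tilde\oplus N_2' = H_{\mathcal A}$$ with respect to which $F-\alpha 1$, $D-\alpha 1$ have diagonal matrices with $(F-\alpha 1)_1$, $(D-\alpha 1)_1$ isomorphisms, $N_1$ is finitely generated, and there is $\iota\in B^a(N_1',N_2)$ that is an isomorphism onto its image. *)

theory Defs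
  imports "HOL-Analysis.Analysis" "HOL-Library.Function_Algebras"
begin

section \<open>Unital C*-algebras\<close>

text \<open>
  The underlying real Banach algebra is taken from the library (in particular the norm of \<open>1\<close>
  is \<open>1\<close>, so the algebra is nonzero); complex scalars and the involution are added.
\<close>

class cstar_algebra = real_normed_algebra_1 + banach +
  fixes scaleC :: "complex \<Rightarrow> 'a \<Rightarrow> 'a"
    and star :: "'a \<Rightarrow> 'a"
  assumes scaleC_add_right: "scaleC c (a + b) = scaleC c a + scaleC c b"
    and scaleC_add_left: "scaleC (c + d) a = scaleC c a + scaleC d a"
    and scaleC_scaleC: "scaleC c (scaleC d a) = scaleC (c * d) a"
    and scaleC_of_real: "scaleC (complex_of_real r) a = scaleR r a"
    and mult_scaleC_left: "scaleC c a * b = scaleC c (a * b)"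
    and mult_scaleC_right: "a * scaleC c b = scaleC c (a * b)"
    and norm_scaleC: "norm (scaleC c a) = cmod c * norm a"
    and star_star: "star (star a) = a"
    and star_add: "star (a + b) = star a + star b"
    and star_scaleC: "star (scaleC c a) = scaleC (cnj c) (star a)"
    and star_mult: "star (a * b) = star b * star a"
    and cstar_identity: "norm (star a * a) = (norm a)\<^sup>2"

instantiation complex :: cstar_algebra
begin

definition scaleC_complex :: "complex \<Rightarrow> complex \<Rightarrow> complex" where
  "scaleC_complex c a = c * a"

definition star_complex :: "complex \<Rightarrow> complex" where
  "star_complex a = cnj a"

instance
  by standard
    (auto simp: scaleC_complex_def star_complex_def algebra_simps norm_mult power2_eq_square
      scaleR_conv_of_real)

end

definition center :: "'a::cstar_algebra set" where
  "center = {\<alpha>. \<forall>a. \<alpha> * a = a * \<alpha>}"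


section \<open>Inner product modules over a C*-algebra\<close>

text \<open>
  Modules are right modules, with inner products conjugate linear in the first variable. The
  module lives on a subset \<open>car\<close> of an abelian group, so that submodules are obtained by
  shrinking \<open>car\<close>. Complex scalars need no separate operation: since the algebra is unital,
  \<open>c\<close> acts as the algebra element \<open>scaleC c 1\<close>, and so \<open>\<A>\<close>-linear maps, submodules and
  \<open>\<A>\<close>-spans are automatically complex linear.
\<close>

record ('m, 'a) hmod =
  car :: "'m set"
  ip :: "'m \<Rightarrow> 'm \<Rightarrow> 'a"
  act :: "'m \<Rightarrow> 'a \<Rightarrow> 'm"

text \<open>The standard Hilbert module \<open>H\<^sub>\<A>\<close> of norm-convergent \<open>\<Sum>n. x\<^sub>n\<^sup>* x\<^sub>n\<close>.\<close>

definition ell2 :: "(nat \<Rightarrow> 'a::cstar_algebra, 'a) hmod" where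
  "ell2 = \<lparr>car = {x. summable (\<lambda>n. star (x n) * x n)},
           ip = (\<lambda>x y. \<Sum>n. star (x n) * y n),
           act = (\<lambda>x a n. x n * a)\<rparr>"

definition osum :: "('m, 'a::cstar_algebra) hmod \<Rightarrow> ('n, 'a) hmod \<Rightarrow> ('m \<times> 'n, 'a) hmod"
    (infixr "\<oplus>\<^sub>H" 65) where
  "H \<oplus>\<^sub>H K = \<lparr>car = car H \<times> car K,
             ip = (\<lambda>u v. ip H (fst u) (fst v) + ip K (snd u) (snd v)),
             act = (\<lambda>u a. (act H (fst u) a, act K (snd u) a))\<rparr>"

definition restr :: "('m, 'a::cstar_algebra) hmod \<Rightarrow> 'm set \<Rightarrow> ('m, 'a) hmod" where
  "restr H M = H\<lparr>car := M\<rparr>"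

definition hnorm :: "('m, 'a::cstar_algebra) hmod \<Rightarrow> 'm \<Rightarrow> real" where
  "hnorm H x = sqrt (norm (ip H x x))"

definition closed_submodule :: "('m::ab_group_add, 'a::cstar_algebra) hmod \<Rightarrow> 'm set \<Rightarrow> bool" where
  "closed_submodule H M \<longleftrightarrow>
     M \<subseteq> car H \<and> 0 \<in> M \<and> (\<forall>x\<in>M. \<forall>y\<in>M. x + y \<in> M) \<and> (\<forall>x\<in>M. \<forall>a. act H x a \<in> M) \<and>
     (\<forall>X l. (\<forall>n::nat. X n \<in> M) \<longrightarrow> l \<in> car H \<longrightarrow> (\<lambda>n. hnorm H (X n - l)) \<longlonglongrightarrow> 0 \<longrightarrow> l \<in> M)"

definition direct_sum ::
    "('m::ab_group_add, 'a::cstar_algebra) hmod \<Rightarrow> 'm set \<Rightarrow> 'm set \<Rightarrow> bool" where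
  "direct_sum H M N \<longleftrightarrow>
     closed_submodule H M \<and> closed_submodule H N \<and>
     M \<inter> N = {0} \<and> {x + y | x y. x \<in> M \<and> y \<in> N} = car H"

definition perp :: "('m, 'a::cstar_algebra) hmod \<Rightarrow> 'm set \<Rightarrow> 'm set" where
  "perp H N = {x \<in> car H. \<forall>y\<in>N. ip H x y = 0}"

definition finitely_generated :: "('m::ab_group_add, 'a::cstar_algebra) hmod \<Rightarrow> bool" where
  "finitely_generated H \<longleftrightarrow>
     (\<exists>S. finite S \<and> S \<subseteq> car H \<and> car H = {(\<Sum>s\<in>S. act H s (a s)) | a. True})"


section \<open>Operators\<close>

text \<open>Operators are total functions of which only the values on the carrier matter.\<close>

definition bounded_between ::
    "('m, 'a::cstar_algebra) hmod \<Rightarrow> ('n, 'a) hmod \<Rightarrow> ('m \<Rightarrow> 'n) \<Rightarrow> bool" where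
  "bounded_between H K T \<longleftrightarrow> (\<exists>B. \<forall>x\<in>car H. hnorm K (T x) \<le> B * hnorm H x)"

definition bounded_module_map ::
    "('m::ab_group_add, 'a::cstar_algebra) hmod \<Rightarrow> ('n::ab_group_add, 'a) hmod
      \<Rightarrow> ('m \<Rightarrow> 'n) \<Rightarrow> bool" where
  "bounded_module_map H K T \<longleftrightarrow>
     T \<in> car H \<rightarrow> car K \<and>
     (\<forall>x\<in>car H. \<forall>y\<in>car H. T (x + y) = T x + T y) \<and>
     (\<forall>x\<in>car H. \<forall>a. T (act H x a) = act K (T x) a) \<and>
     bounded_between H K T"

definition adjointable ::
    "('m::ab_group_add, 'a::cstar_algebra) hmod \<Rightarrow> ('n::ab_group_add, 'a) hmod
      \<Rightarrow> ('m \<Rightarrow> 'n) set" ("B\<^sup>a") where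
  "B\<^sup>a H K = {T. bounded_module_map H K T \<and>
     (\<exists>S \<in> car K \<rightarrow> car H. \<forall>x\<in>car H. \<forall>y\<in>car K. ip K (T x) y = ip H x (S y))}"

definition isomorphism ::
    "('m::ab_group_add, 'a::cstar_algebra) hmod \<Rightarrow> ('n::ab_group_add, 'a) hmod
      \<Rightarrow> ('m \<Rightarrow> 'n) \<Rightarrow> bool" where
  "isomorphism H K T \<longleftrightarrow>
     bounded_module_map H K T \<and> bij_betw T (car H) (car K) \<and>
     bounded_between K H (inv_into (car H) T)"

definition isomorphic ::
    "('m::ab_group_add, 'a::cstar_algebra) hmod \<Rightarrow> ('n::ab_group_add, 'a) hmod \<Rightarrow> bool" where
  "isomorphic H K \<longleftrightarrow> (\<exists>T. isomorphism H K T)"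

text \<open>
  \<open>diagonal_iso H T M1 N1 M2 N2\<close>: with respect to \<open>H = M1 \<oplus> N1 \<longrightarrow> M2 \<oplus> N2 = H\<close> (sums not
  necessarily orthogonal), \<open>T\<close> is diagonal and its first diagonal entry is an isomorphism.
\<close>

definition diagonal_iso ::
    "('m::ab_group_add, 'a::cstar_algebra) hmod \<Rightarrow> ('m \<Rightarrow> 'm)
      \<Rightarrow> 'm set \<Rightarrow> 'm set \<Rightarrow> 'm set \<Rightarrow> 'm set \<Rightarrow> bool" where
  "diagonal_iso H T M1 N1 M2 N2 \<longleftrightarrow>
     direct_sum H M1 N1 \<and> direct_sum H M2 N2 \<and>
     T ` M1 \<subseteq> M2 \<and> T ` N1 \<subseteq> N2 \<and> isomorphism (restr H M1) (restr H M2) T"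

definition upper_semi_Fredholm ::
    "('m::ab_group_add, 'a::cstar_algebra) hmod \<Rightarrow> ('m \<Rightarrow> 'm) set" ("M\<Phi>\<^sub>+") where
  "M\<Phi>\<^sub>+ H = {T \<in> B\<^sup>a H H.
     \<exists>M1 N1 M2 N2. diagonal_iso H T M1 N1 M2 N2 \<and> finitely_generated (restr H N1)}"

text \<open>
  \<open>T - \<alpha>I\<close> for central \<open>\<alpha>\<close>. Centrality makes the right action \<open>x \<mapsto> x\<alpha>\<close> agree with the
  coordinatewise multiplication \<open>x \<mapsto> \<alpha>x\<close> on \<open>ell2\<close> and on \<open>ell2 \<oplus>\<^sub>H ell2\<close>.
\<close>

definition shift ::
    "('m::ab_group_add, 'a::cstar_algebra) hmod \<Rightarrow> ('m \<Rightarrow> 'm) \<Rightarrow> 'a \<Rightarrow> 'm \<Rightarrow> 'm" where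
  "shift H T \<alpha> x = T x - act H x \<alpha>"

definition spec_le ::
    "('m::ab_group_add, 'a::cstar_algebra) hmod \<Rightarrow> ('m \<Rightarrow> 'm) \<Rightarrow> 'a set" ("\<sigma>\<^sub>l\<^sub>e") where
  "\<sigma>\<^sub>l\<^sub>e H T = {\<alpha> \<in> center. shift H T \<alpha> \<notin> M\<Phi>\<^sub>+ H}"

text \<open>The block operator with rows \<open>F C\<close> and \<open>0 D\<close>.\<close>

definition upper_triangular ::
    "('m::ab_group_add \<Rightarrow> 'm) \<Rightarrow> ('n \<Rightarrow> 'm) \<Rightarrow> ('n \<Rightarrow> 'n) \<Rightarrow> 'm \<times> 'n \<Rightarrow> 'm \<times> 'n" where
  "upper_triangular F C D = (\<lambda>(x, y). (F x + C y, D y))"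


section \<open>The exceptional sets\<close>

text \<open>
  In both sets \<open>P1, Q1, P2, Q2\<close> stand for the primed submodules of the second decomposition.
  The operators \<open>map_prod _ id\<close> and \<open>map_prod id _\<close> are block diagonal.
\<close>

definition L' ::
    "((nat \<Rightarrow> 'a) \<Rightarrow> (nat \<Rightarrow> 'a)) \<Rightarrow> ((nat \<Rightarrow> 'a) \<Rightarrow> (nat \<Rightarrow> 'a)) \<Rightarrow> 'a::cstar_algebra set" where
  "L' F D = {\<alpha> \<in> center. \<not> (\<exists>M1 N1 M2 N2 P1 Q1 P2 Q2.
     let H = ell2 \<oplus>\<^sub>H ell2 in
     diagonal_iso H (map_prod (shift ell2 F \<alpha>) id) M1 N1 M2 N2 \<and>
     diagonal_iso H (map_prod id (shift ell2 D \<alpha>)) P1 Q1 P2 Q2 \<and>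
     isomorphic (restr H M2) (restr H P1) \<and> isomorphic (restr H N2) (restr H Q1) \<and>
     finitely_generated (restr H N1) \<and>
     \<not> finitely_generated (restr H N2) \<and> \<not> finitely_generated (restr H Q1))}"

definition L ::
    "((nat \<Rightarrow> 'a) \<Rightarrow> (nat \<Rightarrow> 'a)) \<Rightarrow> ((nat \<Rightarrow> 'a) \<Rightarrow> (nat \<Rightarrow> 'a)) \<Rightarrow> 'a::cstar_algebra set" where
  "L F D = {\<alpha> \<in> center. \<not> (\<exists>M1 N1 N2 Q1 P2 Q2.
     diagonal_iso ell2 (shift ell2 F \<alpha>) M1 N1 (perp ell2 N2) N2 \<and>
     diagonal_iso ell2 (shift ell2 D \<alpha>) (perp ell2 Q1) Q1 P2 Q2 \<and>
     finitely_generated (restr ell2 N1) \<and>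
     (\<exists>\<iota> \<in> B\<^sup>a (restr ell2 Q1) (restr ell2 N2).
        isomorphism (restr ell2 Q1) (restr ell2 (\<iota> ` Q1)) \<iota>))}"

end

theory Submission
  imports Defs
begin

text \<open>
  Write \<open>upper_triangular F C D = D' \<circ> C' \<circ> F'\<close> with \<open>F' = F \<oplus> id\<close>, \<open>D' = id \<oplus> D\<close> and \<open>C'\<close> unipotent. A
  diagonalisation of this product with first entry an isomorphism on \<open>M1\<close> splits through the factors: the middle decompositions are the image of \<open>M1\<close> and the preimage of \<open>N2\<close>. Hence \<open>F'\<close>
  is upper semi-Fredholm, and either \<open>D'\<close> is so too or the exceptional set \<open>L'\<close> is avoided. To pass from
  \<open>F'\<close> to \<open>F\<close>, one uses that a finitely generated submodule is the range of a finite-rank projection,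
  which is small on tails of \<open>ell2\<close>; so \<open>F\<close> is left invertible on some tail. Conversely, with \<open>C = \<iota>\<close> after the
  projection onto \<open>Q1\<close>, the operator is left invertible on a submodule with finitely generated complement,
  because the Gram operator of \<open>\<iota>\<close> is invertible.
\<close>

section \<open>Positive elements of a C*-algebra\<close>

text \<open>The decompositions are not orthogonal, and their projections are bounded but not known
  to be adjointable. A splitting is therefore encoded by one bounded map \<open>J\<close> with
  values in \<open>M1\<close> and \<open>J (T x) = x\<close> on \<open>M1\<close>: the complements
  reappear as the kernels of \<open>J \<circ> T\<close> and of \<open>J\<close>, and complementation
  and the inverse of the first entry follow from these identities. Boundedness of \<open>J\<close>
  rests on the open mapping theorem for Hilbert modules. The obstacle in passing from
  \<open>F'\<close> to \<open>F\<close> is that the finitely generated summand \<open>N1\<close> of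
  the double module need not split along the two coordinates. What can be compressed to one
  coordinate is an operator identity \<open>G (T x) = x - \<pi> x\<close>. Here \<open>\<pi>\<close>
  must be built from inner products with finitely many vectors, since a general bounded module map
  into a finitely generated module has no reason to be small on tails; frames provide this.
  Positivity of \<open>star a * a\<close> makes norms of inner products monotone. It is reached
  through square roots and norm estimates alone, without the spectrum.\<close>

lemma star_0 [simp]: "star (0::'a::cstar_algebra) = 0"
  by (metis add_cancel_right_left star_add)

lemma star_minus [simp]: "star (- a) = - star (a::'a::cstar_algebra)"
  by (metis add.right_inverse add_eq_0_iff star_0 star_add)

lemma star_diff: "star (a - b) = star a - star (b::'a::cstar_algebra)"
  using star_add[of a "- b"] by simp

lemma star_scaleR [simp]: "star (r *\<^sub>R a) = r *\<^sub>R star (a::'a::cstar_algebra)"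
  by (metis complex_cnj_complex_of_real scaleC_of_real star_scaleC)

lemma star_1 [simp]: "star (1::'a::cstar_algebra) = 1"
  by (metis mult_1 mult.right_neutral star_mult star_star)

lemma star_of_real [simp]: "star (of_real r) = (of_real r :: 'a::cstar_algebra)"
  by (simp add: of_real_def)

lemma star_sum: "star (\<Sum>i\<in>I. f i) = (\<Sum>i\<in>I. star (f i :: 'a::cstar_algebra))"
  by (induction I rule: infinite_finite_induct) (auto simp: star_add)

lemma norm_star [simp]: "norm (star a) = norm (a::'a::cstar_algebra)"
proof -
  have le: "norm b \<le> norm (star b)" for b :: 'a
  proof (cases "b = 0")
    case False
    have "norm b * norm b \<le> norm (star b) * norm b"
      using cstar_identity[of b] norm_mult_ineq[of "star b" b] by (simp add: power2_eq_square)
    with False show ?thesis by simp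
  qed simp
  show ?thesis using le[of a] le[of "star a"] by (simp add: star_star)
qed

lemma bounded_linear_star: "bounded_linear (star :: 'a::cstar_algebra \<Rightarrow> 'a)"
  by (rule bounded_linear_intro[where K=1]) (auto simp: star_add)

lemmas tendsto_star = bounded_linear.tendsto[OF bounded_linear_star]

lemma norm_self_adjoint_square:
  fixes h :: "'a::cstar_algebra"
  assumes "star h = h"
  shows "norm (h * h) = (norm h)\<^sup>2"
  using cstar_identity[of h] assms by simp

lemma scaleC_minus_one: "scaleC (-1) a = - (a::'a::cstar_algebra)"
  using scaleC_of_real[of "-1" a] by simp

lemma star_scaleC_ii: "star (scaleC \<i> a) = - scaleC \<i> (star (a::'a::cstar_algebra))"
  using scaleC_scaleC[of "-1" \<i> "star a"] by (simp add: star_scaleC scaleC_minus_one)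

lemma scaleC_diff_right: "scaleC c (a - b) = scaleC c a - scaleC c (b::'a::cstar_algebra)"
  by (metis add_diff_cancel diff_add_cancel scaleC_add_right)

lemma scaleC_imaginary_unit_twice [simp]: "scaleC \<i> (scaleC \<i> a) = - (a::'a::cstar_algebra)"
  by (simp add: scaleC_scaleC scaleC_minus_one)

text \<open>Iteration for the fixed-point equation \<open>y + y = x + y * y\<close>, equivalently
  \<open>(1 - y) * (1 - y) = 1 - x\<close>: the limit yields the square root \<open>1 - y\<close> of
  \<open>1 - x\<close>.\<close>

fun sqrt_iter :: "'a::real_normed_algebra_1 \<Rightarrow> nat \<Rightarrow> 'a" where
  "sqrt_iter x 0 = 0"
| "sqrt_iter x (Suc n) = (1/2) *\<^sub>R (x + sqrt_iter x n * sqrt_iter x n)"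

lemma sqrt_iter_commute: "z * x = x * z \<Longrightarrow> z * sqrt_iter x n = sqrt_iter x n * z"
proof (induction n)
  case (Suc n)
  then have "z * (sqrt_iter x n * sqrt_iter x n) = (sqrt_iter x n * sqrt_iter x n) * z"
    by (metis mult.assoc)
  with Suc show ?case by (simp add: algebra_simps)
qed simp

text \<open>The scalar iteration increases and stays below \<open>1\<close>, hence converges. It is
  a majorant for all \<open>x\<close> of norm at most \<open>1\<close>, including norm exactly
  \<open>1\<close>, where no geometric rate is available.\<close>

lemma sqrt_iter_real:
  "0 \<le> sqrt_iter (1::real) n \<and> sqrt_iter (1::real) n \<le> 1 \<and> sqrt_iter (1::real) n \<le> sqrt_iter 1 (Suc n)"
proof (induction n)
  case (Suc n)
  let ?s = "sqrt_iter (1::real) n" and ?t = "sqrt_iter (1::real) (Suc n)"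
  have "?s * ?s \<le> 1 * 1" using Suc by (intro mult_mono) auto
  then have t: "0 \<le> ?t" "?t \<le> 1" using Suc by auto
  have "?s * ?s \<le> ?t * ?t" using Suc by (intro mult_mono) auto
  then have "?t \<le> sqrt_iter 1 (Suc (Suc n))" by simp
  with t show ?case by blast
qed simp

text \<open>All coefficients of the polynomials in the iteration are nonnegative, so it is dominated by the scalar
  iteration at \<open>1\<close>.\<close>

lemma norm_sqrt_iter:
  fixes x :: "'a::real_normed_algebra_1"
  assumes "norm x \<le> 1"
  shows "norm (sqrt_iter x n) \<le> sqrt_iter 1 n"
    and "norm (sqrt_iter x (Suc n) - sqrt_iter x n) \<le> sqrt_iter 1 (Suc n) - sqrt_iter 1 n"
proof -
  show bd: "norm (sqrt_iter x n) \<le> sqrt_iter 1 n" for n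
  proof (induction n)
    case (Suc n)
    have "norm (x + sqrt_iter x n * sqrt_iter x n) \<le> 1 + sqrt_iter 1 n * sqrt_iter 1 n"
      using assms Suc by (intro norm_triangle_mono order_trans[OF norm_mult_ineq] mult_mono)
        (auto simp: sqrt_iter_real)
    then show ?case by simp
  qed simp
  show "norm (sqrt_iter x (Suc n) - sqrt_iter x n) \<le> sqrt_iter 1 (Suc n) - sqrt_iter 1 n"
  proof (induction n)
    case (Suc n)
    let ?y = "sqrt_iter x" and ?s = "sqrt_iter (1::real)"
    \<comment> \<open>Both iterates are polynomials in \<open>x\<close>; that they commute lets the
      difference of squares factor.\<close>
    have comm: "?y n * ?y (Suc n) = ?y (Suc n) * ?y n"
      by (intro sqrt_iter_commute sqrt_iter_commute[symmetric]) simp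
    have "?y (Suc (Suc n)) - ?y (Suc n) = (1/2) *\<^sub>R (?y (Suc n) * ?y (Suc n) - ?y n * ?y n)"
      unfolding sqrt_iter.simps(2)[of x "Suc n"] sqrt_iter.simps(2)[of x n]
      by (simp add: algebra_simps)
    also have "\<dots> = (1/2) *\<^sub>R ((?y (Suc n) - ?y n) * (?y (Suc n) + ?y n))"
      using comm by (simp add: algebra_simps)
    finally have "norm (?y (Suc (Suc n)) - ?y (Suc n))
        = (1/2) * norm ((?y (Suc n) - ?y n) * (?y (Suc n) + ?y n))" by simp
    also have "\<dots> \<le> (1/2) * ((?s (Suc n) - ?s n) * (?s (Suc n) + ?s n))"
      using Suc bd sqrt_iter_real[of n]
      by (intro mult_left_mono order_trans[OF norm_mult_ineq] mult_mono norm_triangle_mono)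
        (auto simp del: sqrt_iter.simps)
    also have "\<dots> = ?s (Suc (Suc n)) - ?s (Suc n)"
      unfolding sqrt_iter.simps(2)[of 1 "Suc n"] sqrt_iter.simps(2)[of "1::real" n]
      by (simp add: algebra_simps)
    finally show ?case .
  qed (use assms in simp)
qed

text \<open>The two extra conclusions serve later: \<open>norm (1 - r) \<le> 1\<close> says that
  \<open>r\<close> is positive with witness \<open>1\<close>, and commuting with everything that
  commutes with \<open>x\<close> allows roots of commuting elements to be multiplied.\<close>

lemma square_root_one_minus:
  fixes x :: "'a::cstar_algebra"
  assumes x: "star x = x" "norm x \<le> 1"
  shows "\<exists>r. star r = r \<and> r * r = 1 - x \<and> norm (1 - r) \<le> 1 \<and> (\<forall>z. z * x = x * z \<longrightarrow> z * r = r * z)"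
proof -
  let ?y = "sqrt_iter x" and ?s = "sqrt_iter (1::real)"
  have "incseq ?s" using sqrt_iter_real by (simp add: incseq_SucI)
  moreover have "\<forall>i. ?s i \<le> 1" using sqrt_iter_real by auto
  ultimately obtain L where L: "?s \<longlonglongrightarrow> L" by (rule incseq_convergent)
  have "Cauchy ?s" using L by (rule LIMSEQ_imp_Cauchy)
  \<comment> \<open>Telescoping bounds the differences by those of the scalar iteration, so its
    Cauchy property is inherited.\<close>
  have le: "norm (?y (m + k) - ?y m) \<le> ?s (m + k) - ?s m" for m k
  proof (induction k)
    case (Suc k)
    have "norm (?y (m + Suc k) - ?y m) \<le> norm (?y (m + k) - ?y m) + norm (?y (Suc (m + k)) - ?y (m + k))"
      using norm_triangle_ineq[of "?y (m + k) - ?y m" "?y (Suc (m + k)) - ?y (m + k)"]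
      by (simp del: sqrt_iter.simps)
    with Suc norm_sqrt_iter(2)[OF x(2), of "m + k"] show ?case by (simp del: sqrt_iter.simps)
  qed simp
  have "Cauchy ?y"
  proof (rule CauchyI')
    fix e :: real assume "e > 0"
    then obtain M where M: "\<And>m n. m \<ge> M \<Longrightarrow> n \<ge> M \<Longrightarrow> norm (?s m - ?s n) < e"
      using CauchyD[OF \<open>Cauchy ?s\<close>] by blast
    have "norm (?y m - ?y n) < e" if "m \<ge> M" "n > m" for m n
    proof -
      have "norm (?y n - ?y m) \<le> ?s n - ?s m" using le[of m "n - m"] that by simp
      also have "\<dots> < e" using M[of n m] that by simp
      finally show ?thesis by (simp add: norm_minus_commute)
    qed
    then show "\<exists>M. \<forall>m\<ge>M. \<forall>n>m. dist (?y m) (?y n) < e" by (auto simp: dist_norm)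
  qed
  then obtain y where y: "?y \<longlonglongrightarrow> y" using Cauchy_convergent convergent_def by blast
  have "(\<lambda>n. ?y (Suc n)) \<longlonglongrightarrow> y" using y by (rule LIMSEQ_Suc)
  moreover have "(\<lambda>n. ?y (Suc n)) \<longlonglongrightarrow> (1/2) *\<^sub>R (x + y * y)"
    unfolding sqrt_iter.simps by (intro tendsto_intros y)
  ultimately have eq: "y = (1/2) *\<^sub>R (x + y * y)" by (rule LIMSEQ_unique)
  then have "y + y = x + y * y"
    by (metis scaleR_half_double scaleR_right_distrib)
  then have sq: "(1 - y) * (1 - y) = 1 - x"
    by (simp add: algebra_simps)
  have "star (?y n) = ?y n" for n
    by (induction n) (auto simp: star_add star_mult x)
  then have sy: "star y = y" using tendsto_star[OF y] y LIMSEQ_unique by simp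
  have ny: "norm y \<le> 1"
    by (rule LIMSEQ_le_const2[OF tendsto_norm[OF y]])
      (use norm_sqrt_iter(1)[OF x(2)] sqrt_iter_real order_trans in blast)
  have comm: "z * y = y * z" if "z * x = x * z" for z
  proof -
    have "(\<lambda>n. z * ?y n) \<longlonglongrightarrow> z * y" "(\<lambda>n. ?y n * z) \<longlonglongrightarrow> y * z"
      by (intro tendsto_intros y)+
    then show ?thesis using sqrt_iter_commute[OF that] LIMSEQ_unique by simp
  qed
  show ?thesis
  proof (intro exI conjI allI impI)
    show "star (1 - y) = 1 - y" by (simp add: star_diff sy)
    show "(1 - y) * (1 - y) = 1 - x" by (fact sq)
    show "norm (1 - (1 - y)) \<le> 1" using ny by simp
    show "z * (1 - y) = (1 - y) * z" if "z * x = x * z" for z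
      using comm[OF that] by (simp add: algebra_simps)
  qed
qed

lemma norm_unitary:
  fixes u :: "'a::cstar_algebra"
  assumes "star u * u = 1"
  shows "norm u = 1"
  using cstar_identity[of u] assms by (simp add: power2_eq_1_iff) (use norm_ge_zero[of u] in linarith)

text \<open>Computes with the normal element \<open>u = h + scaleC \<i> w\<close> that has
  \<open>h\<close> as its real part. The first identity controls \<open>norm u\<close>; the second
  expresses \<open>h * h - w * w\<close> by the squares of \<open>u\<close> and
  \<open>star u\<close>.\<close>

lemma star_mult_cartesian:
  fixes h w :: "'a::cstar_algebra"
  assumes "star h = h" "star w = w" "h * w = w * h"
  shows "star (h + scaleC \<i> w) * (h + scaleC \<i> w) = h * h + w * w"
    and "star (h + scaleC \<i> w) * star (h + scaleC \<i> w) + (h + scaleC \<i> w) * (h + scaleC \<i> w)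
      = 2 *\<^sub>R (h * h - w * w)"
proof -
  have s: "star (h + scaleC \<i> w) = h - scaleC \<i> w"
    by (simp add: star_add star_scaleC_ii assms)
  show "star (h + scaleC \<i> w) * (h + scaleC \<i> w) = h * h + w * w"
    unfolding s
    by (simp add: algebra_simps mult_scaleC_left mult_scaleC_right assms scaleC_diff_right
        scaleC_add_right)
  show "star (h + scaleC \<i> w) * star (h + scaleC \<i> w) + (h + scaleC \<i> w) * (h + scaleC \<i> w)
      = 2 *\<^sub>R (h * h - w * w)"
    unfolding s
    by (simp add: algebra_simps mult_scaleC_left mult_scaleC_right assms scaleC_diff_right
        scaleC_add_right scaleR_2)
qed

text \<open>With \<open>w = sqrt (1 - h\<^sup>2)\<close> the element \<open>u = h + i w\<close> is unitary, and
  \<open>4 (1 - h\<^sup>2) = 2 - u\<^sup>2 - (star u)\<^sup>2\<close>.\<close>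

lemma norm_one_minus_square:
  fixes h :: "'a::cstar_algebra"
  assumes h: "star h = h" "norm h \<le> 1"
  shows "norm (1 - h * h) \<le> 1"
proof -
  have "norm (h * h) \<le> 1"
    using h by (simp add: norm_self_adjoint_square power_le_one)
  moreover have "star (h * h) = h * h" by (simp add: star_mult h)
  ultimately obtain w where w: "star w = w" "w * w = 1 - h * h"
    and comm: "\<And>z. z * (h * h) = h * h * z \<Longrightarrow> z * w = w * z"
    using square_root_one_minus[of "h * h"] by blast
  have hw: "h * w = w * h" by (rule comm) (simp add: mult.assoc)
  define u where "u = h + scaleC \<i> w"
  have u: "star u * u = 1" "star u * star u + u * u = 2 *\<^sub>R (h * h - w * w)"
    using star_mult_cartesian[OF h(1) w(1) hw] w by (auto simp: u_def)
  have nu: "norm u = 1" by (rule norm_unitary) fact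
  have "4 *\<^sub>R (1 - h * h) = 2 *\<^sub>R ((1 - h * h) + (1 - h * h))"
    by (simp flip: scaleR_2)
  also have "\<dots> = 2 *\<^sub>R 1 - (star u * star u + u * u)"
    unfolding u w(2) by (simp add: scaleR_right_diff_distrib scaleR_right_distrib)
  finally have "4 *\<^sub>R (1 - h * h) = 2 *\<^sub>R 1 - (star u * star u + u * u)" .
  then have "norm (4 *\<^sub>R (1 - h * h)) = norm (2 *\<^sub>R 1 - (star u * star u + u * u))" by simp
  also have "\<dots> \<le> norm (2 *\<^sub>R (1::'a)) + (norm (star u * star u) + norm (u * u))"
    using norm_triangle_ineq4 norm_triangle_ineq order_trans add_left_mono by meson
  also have "\<dots> \<le> 2 + (1 + 1)"
    using norm_mult_ineq[of u u] norm_mult_ineq[of "star u" "star u"] nu by (intro add_mono) auto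
  finally show ?thesis by simp
qed

text \<open>Spectrum-free form of positivity: a self-adjoint \<open>h\<close> has nonnegative
  spectrum exactly when it lies in some ball of radius \<open>t\<close> about \<open>t\<close>.
  Closure under sums is then the triangle inequality, whereas limits, commuting products and
  \<open>star a * a\<close> take work.\<close>

definition cpos :: "'a::cstar_algebra set" where
  "cpos = {h. star h = h \<and> (\<exists>t\<ge>0. norm (of_real t - h) \<le> t)}"

lemma cpos_star: "h \<in> cpos \<Longrightarrow> star h = h"
  by (simp add: cpos_def)

lemma cposI: "star h = h \<Longrightarrow> norm (of_real t - h) \<le> t \<Longrightarrow> h \<in> cpos"
  unfolding cpos_def using norm_ge_zero order_trans by blast

lemma cpos_eventually:
  assumes "h \<in> cpos"
  obtains t where "t \<ge> 0" "\<And>s. s \<ge> t \<Longrightarrow> norm (of_real s - h) \<le> s"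
proof -
  obtain t where t: "t \<ge> 0" "norm (of_real t - h) \<le> t" using assms by (auto simp: cpos_def)
  have "norm (of_real s - h) \<le> s" if "s \<ge> t" for s
  proof -
    have "norm (of_real s - h) \<le> norm (of_real (s - t) :: 'a) + norm (of_real t - h)"
      using norm_triangle_ineq[of "of_real (s - t)" "of_real t - h"] by simp
    with t that show ?thesis unfolding norm_of_real by simp
  qed
  with t that show ?thesis by blast
qed

lemma cpos_add: assumes "h \<in> cpos" "k \<in> cpos" shows "h + k \<in> cpos"
proof -
  obtain s t where st: "norm (of_real s - h) \<le> s" "norm (of_real t - k) \<le> t"
    using assms by (auto simp: cpos_def)
  have "norm (of_real (s + t) - (h + k)) \<le> s + t"
    using norm_triangle_ineq[of "of_real s - h" "of_real t - k"] st by (simp add: algebra_simps)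
  with assms show ?thesis by (intro cposI[of _ "s + t"]) (simp_all only: star_add cpos_star)
qed

lemma cpos_scaleR: assumes "h \<in> cpos" "c \<ge> 0" shows "c *\<^sub>R h \<in> cpos"
proof -
  obtain t where t: "norm (of_real t - h) \<le> t" using assms by (auto simp: cpos_def)
  have "norm (of_real (c * t) - c *\<^sub>R h) = c * norm (of_real t - h)"
    using norm_scaleR[of c "of_real t - h"] assms by (simp add: algebra_simps of_real_def)
  with t assms have "norm (of_real (c * t) - c *\<^sub>R h) \<le> c * t" by (simp add: mult_left_mono)
  with assms show ?thesis by (intro cposI[of _ "c * t"]) (simp_all only: star_scaleR cpos_star)
qed

lemma cpos_of_real: "t \<ge> 0 \<Longrightarrow> of_real t \<in> cpos"
  by (rule cposI[of _ t]) auto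

lemma cpos_0 [simp]: "0 \<in> cpos"
  using cpos_of_real[of 0] by simp

lemma cpos_1 [simp]: "1 \<in> cpos"
  using cpos_of_real[of 1] by simp

lemma cpos_sum: "(\<And>i. i \<in> I \<Longrightarrow> f i \<in> cpos) \<Longrightarrow> sum f I \<in> cpos"
  by (induction I rule: infinite_finite_induct) (auto simp: cpos_add)

lemma of_real_minus_cpos:
  assumes "star h = h" "norm h \<le> t"
  shows "of_real t - h \<in> cpos"
  by (rule cposI[of _ t]) (use assms in \<open>auto simp: star_diff\<close>)

lemma cpos_sqrt:
  assumes "h \<in> cpos"
  obtains r where "star r = r" "r * r = h" "r \<in> cpos" "\<And>z. z * h = h * z \<Longrightarrow> z * r = r * z"
proof -
  obtain t0 where t0: "t0 \<ge> 0" "\<And>s. s \<ge> t0 \<Longrightarrow> norm (of_real s - h) \<le> s"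
    using cpos_eventually[OF assms] by metis
  \<comment> \<open>The added \<open>1\<close> makes \<open>t\<close> strictly positive, so that it
    can be divided by; \<open>t0\<close> may be \<open>0\<close> when \<open>h = 0\<close>.\<close>
  define t where "t = t0 + 1"
  have t: "t > 0" "norm (of_real t - h) \<le> t" using t0(1) t0(2)[of t] by (auto simp: t_def)
  define x where "x = (1/t) *\<^sub>R (of_real t - h)"
  have hx: "h = t *\<^sub>R (1 - x)" using t(1)
    by (simp add: x_def scaleR_right_diff_distrib of_real_def)
  have "star x = x" using assms by (simp add: x_def star_diff cpos_star)
  moreover have "norm x \<le> 1" using t by (simp add: x_def divide_simps)
  ultimately obtain r where r: "star r = r" "r * r = 1 - x" "norm (1 - r) \<le> 1"
      "\<And>z. z * x = x * z \<Longrightarrow> z * r = r * z"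
    using square_root_one_minus by blast
  have zx: "z * x = x * z" if "z * h = h * z" for z
    using that by (simp add: x_def algebra_simps of_real_def)
  have "r \<in> cpos" by (rule cposI[of _ 1]) (use r(1,3) in auto)
  show ?thesis
  proof (rule that[of "sqrt t *\<^sub>R r"])
    show "sqrt t *\<^sub>R r * sqrt t *\<^sub>R r = h" using r(2) t by (simp add: hx)
    show "sqrt t *\<^sub>R r \<in> cpos" by (rule cpos_scaleR) (use \<open>r \<in> cpos\<close> t in auto)
    show "z * sqrt t *\<^sub>R r = sqrt t *\<^sub>R r * z" if "z * h = h * z" for z
      using r(4)[OF zx[OF that]] by simp
  qed (use r(1) in auto)
qed

text \<open>After normalising \<open>h\<close> to norm one this is
  \<open>norm_one_minus_square\<close>. The explicit witness is kept because, applied to a square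
  root, it shows that the norm of a positive element is itself a witness.\<close>

lemma cpos_square:
  assumes h: "star h = h"
  shows "h * h \<in> cpos" "norm (of_real ((norm h)\<^sup>2) - h * h) \<le> (norm h)\<^sup>2"
proof -
  show bd: "norm (of_real ((norm h)\<^sup>2) - h * h) \<le> (norm h)\<^sup>2"
  proof (cases "h = 0")
    case False
    define k where "k = (1 / norm h) *\<^sub>R h"
    have k: "h = norm h *\<^sub>R k" using False by (simp add: k_def)
    have "norm (1 - k * k) \<le> 1"
      by (rule norm_one_minus_square) (use False in \<open>auto simp: k_def h\<close>)
    moreover have "of_real ((norm h)\<^sup>2) - h * h = ((norm h)\<^sup>2) *\<^sub>R (1 - k * k)"
      by (subst (2 3) k) (simp add: scaleR_right_diff_distrib of_real_def power2_eq_square)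
    ultimately show ?thesis by (simp add: mult_left_le)
  qed simp
  show "h * h \<in> cpos" by (rule cposI[OF _ bd]) (simp add: star_mult h)
qed

text \<open>Removes the existential from \<open>cpos\<close>: every \<open>t\<close> above the norm
  is a witness. This uniformity is what survives limits.\<close>

lemma cpos_norm: assumes "h \<in> cpos" "norm h \<le> t" shows "norm (of_real t - h) \<le> t"
proof -
  obtain r where r: "star r = r" "r * r = h" using cpos_sqrt[OF assms(1)] by metis
  have n: "norm (of_real (norm h) - h) \<le> norm h"
    using cpos_square(2)[OF r(1)] r norm_self_adjoint_square[OF r(1)] by simp
  have "norm (of_real t - h) \<le> norm (of_real (t - norm h) :: 'a) + norm (of_real (norm h) - h)"
    using norm_triangle_ineq[of "of_real (t - norm h)" "of_real (norm h) - h"] by simp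
  with n assms(2) show ?thesis unfolding norm_of_real by simp
qed

text \<open>The roots \<open>r\<close> and \<open>s\<close> commute with each other, so the product
  is the square of the self-adjoint \<open>r * s\<close>.\<close>

lemma cpos_mult:
  assumes "h \<in> cpos" "k \<in> cpos" "h * k = k * h"
  shows "h * k \<in> cpos"
proof -
  obtain r where r: "star r = r" "r * r = h" and rc: "\<And>z. z * h = h * z \<Longrightarrow> z * r = r * z"
    using cpos_sqrt[OF assms(1)] by metis
  obtain s where s: "star s = s" "s * s = k" and sc: "\<And>z. z * k = k * z \<Longrightarrow> z * s = s * z"
    using cpos_sqrt[OF assms(2)] by metis
  have "r * s = s * r" using rc sc assms(3) by metis
  then have "h * k = (r * s) * (r * s)" "star (r * s) = r * s"
    using r s by (metis mult.assoc, simp add: star_mult)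
  then show ?thesis using cpos_square(1) by metis
qed

text \<open>The product of \<open>s - x\<close> and \<open>s + x\<close> is positive and has a root
  \<open>w\<close> commuting with \<open>x\<close>; then \<open>u = x + scaleC \<i> w\<close>
  satisfies \<open>star u * u = s\<^sup>2\<close>, and \<open>x\<close> is its real part.\<close>

lemma norm_le_cpos:
  assumes "star x = x" "of_real s - x \<in> cpos" "of_real s + x \<in> cpos" "s \<ge> 0"
  shows "norm x \<le> s"
proof -
  have c: "(of_real s - x) * (of_real s + x) = (of_real s + x) * (of_real s - x)"
    by (simp add: algebra_simps of_real_def)
  have e: "(of_real s - x) * (of_real s + x) = of_real (s\<^sup>2) - x * x"
    by (simp add: algebra_simps of_real_def power2_eq_square)
  obtain w where w: "star w = w" "w * w = of_real (s\<^sup>2) - x * x"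
      "\<And>z. z * (of_real (s\<^sup>2) - x * x) = (of_real (s\<^sup>2) - x * x) * z \<Longrightarrow> z * w = w * z"
    using cpos_sqrt[OF cpos_mult[OF assms(2,3) c]] e by metis
  have comm: "x * w = w * x"
    by (rule w(3)) (simp add: algebra_simps of_real_def)
  define u where "u = x + scaleC \<i> w"
  have u: "star u * u = of_real (s\<^sup>2)"
    using star_mult_cartesian(1)[OF assms(1) w(1) comm] w(2) by (simp add: u_def)
  have "(norm u)\<^sup>2 = s\<^sup>2" using cstar_identity[of u] unfolding u by (simp only: norm_of_real) simp
  then have nu: "norm u = s" using assms(4) by (simp add: power2_eq_iff_nonneg)
  have "2 *\<^sub>R x = u + star u"
    by (simp add: u_def star_add star_scaleC_ii assms w scaleR_2)
  then have "norm (2 *\<^sub>R x) \<le> norm u + norm (star u)" using norm_triangle_ineq by metis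
  with nu show ?thesis by simp
qed

text \<open>The order bounds \<open>- norm y \<le> x \<le> norm y\<close> reduce this to
  \<open>norm_le_cpos\<close>. Later norm estimates for algebra-valued sums go through this
  monotonicity.\<close>

lemma norm_cpos_mono:
  assumes "x \<in> cpos" "y - x \<in> cpos"
  shows "norm x \<le> norm y"
proof -
  have sx: "star x = x" and y: "star y = y"
    using assms cpos_star[of "y - x"] by (auto simp: cpos_star star_diff)
  have "of_real (norm y) - x = (of_real (norm y) - y) + (y - x)" by simp
  also have "\<dots> \<in> cpos" by (intro cpos_add of_real_minus_cpos assms y) simp
  finally show ?thesis
    using assms by (intro norm_le_cpos sx) (auto intro!: cpos_add cpos_of_real)
qed

text \<open>A bound \<open>B\<close> for all the norms is a common witness, and a fixed witness
  passes to the limit.\<close>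

lemma cpos_closed:
  assumes "X \<longlonglongrightarrow> (x::'a::cstar_algebra)" "\<And>n. X n \<in> cpos"
  shows "x \<in> cpos"
proof -
  have "(\<lambda>n. star (X n)) = X" using assms(2) cpos_star by blast
  then have "star x = x"
    using tendsto_star[OF assms(1)] assms(1) LIMSEQ_unique by metis
  moreover obtain B where B: "\<And>n. norm (X n) \<le> B"
    using convergent_imp_Bseq[of X] assms(1) by (auto simp: convergent_def Bseq_def)
  have "norm (of_real B - x) \<le> B"
    by (rule LIMSEQ_le_const2[OF tendsto_norm[OF tendsto_diff[OF tendsto_const assms(1)]]])
      (use cpos_norm[OF assms(2) B] in blast)
  ultimately show ?thesis by (rule cposI)
qed

text \<open>Bernoulli's inequality in the order of the algebra: the surplus for \<open>n\<close>,
  multiplied by \<open>1 + p\<close>, falls short of the surplus for \<open>n + 1\<close> by the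
  positive term \<open>n p\<^sup>2\<close>.\<close>

lemma cpos_binomial:
  assumes p: "p \<in> cpos"
  shows "(1 + p) ^ n - (1 + of_nat n * p) \<in> cpos \<and> p * ((1 + p) ^ n) = (1 + p) ^ n * p"
proof (induction n)
  case (Suc n)
  let ?Q = "(1 + p) ^ n - (1 + of_nat n * p)"
  have c: "p * (1 + p) ^ n = (1 + p) ^ n * p" and Q: "?Q \<in> cpos" using Suc by auto
  have nat: "of_nat n * p = real n *\<^sub>R p" by (simp add: scaleR_conv_of_real)
  have "(1 + p) * ?Q = ?Q * (1 + p)"
    unfolding nat using c by (simp add: algebra_simps)
  then have "(1 + p) * ?Q \<in> cpos"
    by (intro cpos_mult cpos_add p Q) auto
  moreover have "real n *\<^sub>R (p * p) \<in> cpos"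
    by (intro cpos_scaleR cpos_mult p) auto
  ultimately have "(1 + p) * ?Q + real n *\<^sub>R (p * p) \<in> cpos" by (rule cpos_add)
  moreover have "(1 + p) * ?Q + real n *\<^sub>R (p * p) = (1 + p) ^ Suc n - (1 + of_nat (Suc n) * p)"
    unfolding of_nat_Suc distrib_right nat by (simp add: algebra_simps)
  moreover have "p * (1 + p) ^ Suc n = (1 + p) ^ Suc n * p"
    using c by (simp add: algebra_simps) (metis c mult.assoc)
  ultimately show ?case by simp
qed simp

text \<open>The powers \<open>p (1 + p)\<^sup>n\<close> of \<open>p = b b\<^sup>*\<close> grow at least linearly unless \<open>p = 0\<close>, but they equal
  \<open>b (1 + b\<^sup>* b)\<^sup>n b\<^sup>*\<close>, which stays bounded when \<open>b\<^sup>* b\<close> is negative.\<close>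

lemma eq_0_if_opposite_signs_aux:
  fixes b :: "'a::cstar_algebra"
  assumes p: "b * star b \<in> cpos" and k: "- (star b * b) \<in> cpos" and b: "norm b \<le> 1"
  shows "b = 0"
proof -
  define p where "p = b * star b"
  have pp: "p \<in> cpos" using assms p_def by simp
  have "norm (- (star b * b)) \<le> 1" using b by (simp add: cstar_identity power_le_one)
  then have k1: "norm (1 + star b * b) \<le> 1" using cpos_norm[OF k, of 1] by simp
  have step: "p * (1 + p) ^ n = b * (1 + star b * b) ^ n * star b" for n
  proof (induction n)
    case (Suc n)
    have "star b * (1 + p) = (1 + star b * b) * star b" by (simp add: p_def algebra_simps)
    have "p * (1 + p) ^ Suc n = b * (1 + star b * b) ^ n * (star b * (1 + p))"
      unfolding power_Suc2 using Suc by (simp add: mult.assoc[symmetric])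
    also have "\<dots> = b * (1 + star b * b) ^ Suc n * star b"
      unfolding power_Suc2 \<open>star b * (1 + p) = _\<close> by (simp only: mult.assoc)
    finally show ?case .
  qed (simp add: p_def)
  have le1: "norm (p * (1 + p) ^ n) \<le> 1" for n
  proof -
    have "norm (b * (1 + star b * b) ^ n * star b) \<le> norm b * norm ((1 + star b * b) ^ n) * norm (star b)"
      by (meson norm_mult_ineq mult_right_mono norm_ge_zero order_trans)
    also have "\<dots> \<le> 1 * 1 * 1"
      using b k1 by (intro mult_mono order_trans[OF norm_power_ineq] power_le_one) auto
    finally show ?thesis by (simp add: step)
  qed
  have bound: "real n * (norm p)\<^sup>2 \<le> 1" for n
  proof -
    \<comment> \<open>Bernoulli multiplied by \<open>p\<close> gives
      \<open>n p\<^sup>2 \<le> p (1 + p)\<^sup>n\<close>, whose right side has norm at most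
      \<open>1\<close>.\<close>
    let ?Q = "(1 + p) ^ n - (1 + of_nat n * p)"
    have Q: "?Q \<in> cpos" and c: "p * (1 + p) ^ n = (1 + p) ^ n * p" using cpos_binomial[OF pp] by auto
    have nat: "of_nat n * p = real n *\<^sub>R p" by (simp add: scaleR_conv_of_real)
    have "p * ?Q = ?Q * p" unfolding nat using c by (simp add: algebra_simps)
    then have "p * ?Q + p \<in> cpos" by (intro cpos_add cpos_mult pp Q)
    moreover have "p * ?Q + p = p * (1 + p) ^ n - real n *\<^sub>R (p * p)"
      unfolding nat by (simp add: algebra_simps)
    moreover have "real n *\<^sub>R (p * p) \<in> cpos" by (intro cpos_scaleR cpos_mult pp) auto
    ultimately have "norm (real n *\<^sub>R (p * p)) \<le> norm (p * (1 + p) ^ n)"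
      by (intro norm_cpos_mono) auto
    then show ?thesis using le1[of n] norm_self_adjoint_square[OF cpos_star[OF pp]] by simp
  qed
  have "norm p = 0"
  proof (rule ccontr)
    assume "norm p \<noteq> 0"
    then have "(norm p)\<^sup>2 > 0" by simp
    then obtain n where "1 < real n * (norm p)\<^sup>2" using reals_Archimedean3 by blast
    with bound[of n] show False by simp
  qed
  then show ?thesis using cstar_identity[of "star b"] by (simp add: p_def star_star)
qed

lemma eq_0_if_opposite_signs:
  fixes b :: "'a::cstar_algebra"
  assumes p: "b * star b \<in> cpos" and k: "- (star b * b) \<in> cpos"
  shows "b = 0"
proof (rule ccontr)
  assume "b \<noteq> 0"
  define c where "c = 1 / norm b"
  have c: "c > 0" using \<open>b \<noteq> 0\<close> by (simp add: c_def)
  have "c *\<^sub>R b = 0"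
  proof (rule eq_0_if_opposite_signs_aux)
    show "c *\<^sub>R b * star (c *\<^sub>R b) \<in> cpos"
      using cpos_scaleR[OF cpos_scaleR[OF p, of c], of c] c by simp
    show "- (star (c *\<^sub>R b) * c *\<^sub>R b) \<in> cpos"
      using cpos_scaleR[OF cpos_scaleR[OF k, of c], of c] c by simp
  qed (use \<open>b \<noteq> 0\<close> in \<open>simp add: c_def\<close>)
  with c \<open>b \<noteq> 0\<close> show False by simp
qed

text \<open>Here \<open>r\<close> is the absolute value and \<open>q\<close> the negative part of
  \<open>h = star a * a\<close>. For \<open>b = a * q\<close> one finds
  \<open>star b * b = q * h * q \<le> 0\<close>, while \<open>b * star b + star b * b\<close> is
  half a sum of two squares. Hence \<open>b * star b\<close> is positive, and opposite signs force
  \<open>b = 0\<close>; this gives \<open>q = 0\<close> and \<open>h = r\<close>.\<close>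

theorem star_mult_self_cpos:
  fixes a :: "'a::cstar_algebra"
  shows "star a * a \<in> cpos"
proof -
  define h where "h = star a * a"
  have h: "star h = h" by (simp add: h_def star_mult star_star)
  obtain r where r: "star r = r" "r * r = h * h" "r \<in> cpos"
    and rc: "\<And>z. z * (h * h) = (h * h) * z \<Longrightarrow> z * r = r * z"
    using cpos_sqrt[OF cpos_square(1)[OF h]] by metis
  have hr: "h * r = r * h" by (rule rc) (simp add: mult.assoc)
  define q where "q = (1/2) *\<^sub>R (r - h)"
  have q: "star q = q" by (simp add: q_def star_diff h r)
  have qr: "q * r = r * q" and qh: "q * h = h * q" by (auto simp: q_def algebra_simps hr)
  have "q * (r + h) = 0" by (simp add: q_def algebra_simps hr r)
  then have qhr: "q * h = - (q * r)" by (simp add: algebra_simps eq_neg_iff_add_eq_0)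
  have "r = (r + h) - h" "h = r - 2 *\<^sub>R q" by (auto simp: q_def)
  define b where "b = a * q"
  define k where "k = q * q * r"
  have "star b * b = q * h * q" by (simp add: b_def star_mult q h_def mult.assoc)
  also have "\<dots> = - k" unfolding k_def by (metis mult.assoc mult_minus_left qhr qr)
  finally have bb: "star b * b = - k" .
  have k: "k \<in> cpos"
    unfolding k_def
  proof (rule cpos_mult[OF cpos_square(1)[OF q] r(3)])
    show "q * q * r = r * (q * q)" by (simp only: mult.assoc qr) (simp only: mult.assoc[symmetric] qr)
  qed
  have s1: "star (b + star b) = b + star b" by (simp add: star_add star_star)
  have s2: "star (scaleC \<i> (b - star b)) = scaleC \<i> (b - star b)"
    by (simp add: star_scaleC_ii star_diff star_star scaleC_diff_right)
  \<comment> \<open>The summands are the squares of twice the real part and, up to sign, twice the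
    imaginary part of \<open>b\<close>.\<close>
  have "(b + star b) * (b + star b) + scaleC \<i> (b - star b) * scaleC \<i> (b - star b)
      = 2 *\<^sub>R (b * star b + star b * b)"
    by (simp add: mult_scaleC_left mult_scaleC_right algebra_simps scaleR_2 scaleC_diff_right)
  then have "2 *\<^sub>R (b * star b + star b * b) \<in> cpos"
    using cpos_add[OF cpos_square(1)[OF s1] cpos_square(1)[OF s2]] by simp
  from cpos_scaleR[OF this, of "1/2"] have "b * star b + star b * b \<in> cpos" by simp
  from cpos_add[OF this k] have "b * star b \<in> cpos" by (simp add: bb)
  then have "b = 0" by (rule eq_0_if_opposite_signs) (simp add: bb k)
  then have "k = 0" using bb by simp
  \<comment> \<open>From \<open>q * q = q * r\<close> the fourth power of \<open>q\<close> equals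
    \<open>q * k = 0\<close>; the norm identity for self-adjoint squares, used twice, gives
    \<open>q = 0\<close>.\<close>
  have "2 *\<^sub>R (q * q) = q * r - q * h" by (simp add: q_def algebra_simps)
  also have "\<dots> = 2 *\<^sub>R (q * r)" by (simp add: qhr scaleR_2)
  finally have "q * q = q * r" by simp
  from arg_cong[OF this, of "\<lambda>z. (q * q) * z"] have "(q * q) * (q * q) = q * k"
    by (simp only: k_def mult.assoc)
  with \<open>k = 0\<close> have "norm ((q * q) * (q * q)) = 0" by simp
  then have "q = 0"
    using norm_self_adjoint_square[of "q * q"] norm_self_adjoint_square[OF q] q by (simp add: star_mult)
  then show ?thesis using r(3) by (simp add: q_def h_def)
qed

lemma cpos_conjugate: assumes "h \<in> cpos" shows "star a * h * a \<in> cpos"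
proof -
  obtain r where r: "star r = r" "r * r = h" using cpos_sqrt[OF assms] by metis
  have "star a * h * a = star (r * a) * (r * a)" using r by (simp add: star_mult mult.assoc flip: r(2))
  then show ?thesis using star_mult_self_cpos by metis
qed

section \<open>Hilbert modules and their bounded module maps\<close>

text \<open>The axioms are relative to \<open>car H\<close>, a bare subset of a group, so a closed
  submodule becomes an instance by shrinking the carrier. Completeness is spelled out with
  \<open>hnorm\<close> because the carrier has no metric of its own.\<close>

locale hilbert_module =
  fixes H :: "('m::ab_group_add, 'a::cstar_algebra) hmod"
  assumes zero_closed [simp]: "0 \<in> car H"
    and add_closed [simp]: "x \<in> car H \<Longrightarrow> y \<in> car H \<Longrightarrow> x + y \<in> car H"
    and act_closed [simp]: "x \<in> car H \<Longrightarrow> act H x a \<in> car H"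
    and act_one: "x \<in> car H \<Longrightarrow> act H x 1 = x"
    and act_act: "x \<in> car H \<Longrightarrow> act H (act H x a) b = act H x (a * b)"
    and act_add_left: "x \<in> car H \<Longrightarrow> y \<in> car H \<Longrightarrow> act H (x + y) a = act H x a + act H y a"
    and act_add_right: "x \<in> car H \<Longrightarrow> act H x (a + b) = act H x a + act H x b"
    and ip_add_right: "x \<in> car H \<Longrightarrow> y \<in> car H \<Longrightarrow> z \<in> car H \<Longrightarrow> ip H x (y + z) = ip H x y + ip H x z"
    and ip_act_right: "x \<in> car H \<Longrightarrow> y \<in> car H \<Longrightarrow> ip H x (act H y a) = ip H x y * a"
    and star_ip: "x \<in> car H \<Longrightarrow> y \<in> car H \<Longrightarrow> star (ip H x y) = ip H y x"
    and ip_cpos: "x \<in> car H \<Longrightarrow> ip H x x \<in> cpos"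
    and ip_definite: "x \<in> car H \<Longrightarrow> ip H x x = 0 \<Longrightarrow> x = 0"
    and complete: "(\<And>n. X n \<in> car H) \<Longrightarrow> (\<forall>e>0. \<exists>M::nat. \<forall>m\<ge>M. \<forall>n\<ge>M. hnorm H (X m - X n) < e)
      \<Longrightarrow> \<exists>l\<in>car H. (\<lambda>n. hnorm H (X n - l)) \<longlonglongrightarrow> 0"
begin

lemma act_zero_right [simp]: "x \<in> car H \<Longrightarrow> act H x 0 = 0"
  using act_add_right[of x 0 0] by simp

lemma act_zero_left [simp]: "act H 0 a = 0"
  using act_add_left[of 0 0 a] by simp

lemma act_minus_right: "x \<in> car H \<Longrightarrow> act H x (- a) = - act H x a"
  using act_add_right[of x a "- a"] by (simp add: eq_neg_iff_add_eq_0 add.commute)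

lemma minus_closed [simp]: "x \<in> car H \<Longrightarrow> - x \<in> car H"
  using act_closed[of x "-1"] by (simp add: act_minus_right act_one)

lemma diff_closed [simp]: "x \<in> car H \<Longrightarrow> y \<in> car H \<Longrightarrow> x - y \<in> car H"
  using add_closed[of x "- y"] by simp

lemma sum_closed: "(\<And>i. i \<in> I \<Longrightarrow> f i \<in> car H) \<Longrightarrow> sum f I \<in> car H"
  by (induction I rule: infinite_finite_induct) auto

lemma act_minus_left: "x \<in> car H \<Longrightarrow> act H (- x) a = - act H x a"
  using act_add_left[of x "- x" a] by (simp add: eq_neg_iff_add_eq_0 add.commute)

lemma act_diff_left: "x \<in> car H \<Longrightarrow> y \<in> car H \<Longrightarrow> act H (x - y) a = act H x a - act H y a"
  using act_add_left[of x "- y" a] by (simp add: act_minus_left)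

lemma act_sum: "(\<And>i. i \<in> I \<Longrightarrow> f i \<in> car H) \<Longrightarrow> act H (sum f I) a = (\<Sum>i\<in>I. act H (f i) a)"
  by (induction I rule: infinite_finite_induct) (auto simp: act_add_left sum_closed)

lemma ip_zero_right [simp]: "x \<in> car H \<Longrightarrow> ip H x 0 = 0"
  using ip_add_right[of x 0 0] by simp

lemma ip_zero_left [simp]: "x \<in> car H \<Longrightarrow> ip H 0 x = 0"
  using star_ip[of x 0] by simp

lemma ip_minus_right: "x \<in> car H \<Longrightarrow> y \<in> car H \<Longrightarrow> ip H x (- y) = - ip H x y"
  using ip_add_right[of x y "- y"] by (simp add: eq_neg_iff_add_eq_0 add.commute)

lemma ip_diff_right:
  "x \<in> car H \<Longrightarrow> y \<in> car H \<Longrightarrow> z \<in> car H \<Longrightarrow> ip H x (y - z) = ip H x y - ip H x z"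
  using ip_add_right[of x y "- z"] by (simp add: ip_minus_right)

lemma ip_add_left:
  "x \<in> car H \<Longrightarrow> y \<in> car H \<Longrightarrow> z \<in> car H \<Longrightarrow> ip H (x + y) z = ip H x z + ip H y z"
  using star_ip[of z "x + y"] by (simp add: ip_add_right star_add star_ip)

lemma ip_minus_left: "x \<in> car H \<Longrightarrow> y \<in> car H \<Longrightarrow> ip H (- x) y = - ip H x y"
  using star_ip[of y "- x"] by (simp add: ip_minus_right star_ip)

lemma ip_diff_left:
  "x \<in> car H \<Longrightarrow> y \<in> car H \<Longrightarrow> z \<in> car H \<Longrightarrow> ip H (x - y) z = ip H x z - ip H y z"
  using star_ip[of z "x - y"] by (simp add: ip_diff_right star_diff star_ip)

lemma ip_act_left: "x \<in> car H \<Longrightarrow> y \<in> car H \<Longrightarrow> ip H (act H x a) y = star a * ip H x y"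
  using star_ip[of y "act H x a"] by (simp add: ip_act_right star_mult star_ip)

lemma ip_sum_right:
  "x \<in> car H \<Longrightarrow> (\<And>i. i \<in> I \<Longrightarrow> f i \<in> car H) \<Longrightarrow> ip H x (sum f I) = (\<Sum>i\<in>I. ip H x (f i))"
  by (induction I rule: infinite_finite_induct) (auto simp: ip_add_right sum_closed)

lemma hnorm_nonneg [simp]: "0 \<le> hnorm H x"
  by (simp add: hnorm_def)

lemma hnorm_square: "(hnorm H x)\<^sup>2 = norm (ip H x x)"
  by (simp add: hnorm_def)

lemma hnorm_zero [simp]: "hnorm H 0 = 0"
  by (simp add: hnorm_def)

lemma hnorm_eq_0: "x \<in> car H \<Longrightarrow> hnorm H x = 0 \<longleftrightarrow> x = 0"
  using ip_definite[of x] by (auto simp: hnorm_def)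

text \<open>With \<open>z = ip H x y\<close> and \<open>N = (hnorm H x)\<^sup>2\<close>, the
  positive element \<open>ip H v v\<close> for \<open>v = x z - y N\<close> is expanded, and its
  term \<open>star z * ip H x x * z\<close> is estimated by \<open>N (star z * z)\<close>. What
  remains is \<open>N (star z * z) \<le> N\<^sup>2 (ip H y y)\<close>.\<close>

lemma Cauchy_Schwarz:
  assumes x: "x \<in> car H" and y: "y \<in> car H"
  shows "norm (ip H x y) \<le> hnorm H x * hnorm H y"
proof (cases "x = 0")
  case False
  define N z where "N = (hnorm H x)\<^sup>2" and "z = ip H x y"
  have N: "N > 0" using False x hnorm_eq_0[of x] by (simp add: N_def)
  have "star z * (of_real N - ip H x x) * z \<in> cpos"
    by (intro cpos_conjugate of_real_minus_cpos) (use x in \<open>auto simp: star_ip N_def hnorm_square\<close>)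
  moreover define v where "v = act H x z - act H y (of_real N)"
  have "ip H v v \<in> cpos" using x y by (intro ip_cpos) (auto simp: v_def)
  moreover have "ip H v v = star z * ip H x x * z - (2 * N) *\<^sub>R (star z * z) + (N * N) *\<^sub>R ip H y y"
    using x y unfolding v_def
    by (simp add: ip_diff_left ip_diff_right ip_act_left ip_act_right of_real_def z_def star_ip algebra_simps
        flip: scaleR_2)
  ultimately have "star z * (of_real N - ip H x x) * z
     + (star z * ip H x x * z - (2 * N) *\<^sub>R (star z * z) + (N * N) *\<^sub>R ip H y y) \<in> cpos"
    by (metis cpos_add)
  also have "star z * (of_real N - ip H x x) * z
     + (star z * ip H x x * z - (2 * N) *\<^sub>R (star z * z) + (N * N) *\<^sub>R ip H y y)
     = (N * N) *\<^sub>R ip H y y - N *\<^sub>R (star z * z)"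
    by (simp add: algebra_simps of_real_def) (simp add: scaleR_add_left[symmetric])
  finally have "norm (N *\<^sub>R (star z * z)) \<le> norm ((N * N) *\<^sub>R ip H y y)"
    using N by (intro norm_cpos_mono cpos_scaleR star_mult_self_cpos) auto
  then have "N * (norm z)\<^sup>2 \<le> N * (N * (hnorm H y)\<^sup>2)"
    using N by (simp add: cstar_identity hnorm_square)
  then have "(norm z)\<^sup>2 \<le> N * (hnorm H y)\<^sup>2" using N by (simp only: mult_le_cancel_left_pos)
  then have "(norm z)\<^sup>2 \<le> (hnorm H x * hnorm H y)\<^sup>2" by (simp add: N_def power_mult_distrib)
  then show ?thesis unfolding z_def by (rule power2_le_imp_le) simp
qed (use y in simp)

lemma hnorm_triangle:
  assumes x: "x \<in> car H" and y: "y \<in> car H"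
  shows "hnorm H (x + y) \<le> hnorm H x + hnorm H y"
proof -
  have "(hnorm H (x + y))\<^sup>2 = norm ((ip H x x + ip H x y) + (ip H y x + ip H y y))"
    using x y by (simp add: hnorm_square ip_add_left ip_add_right algebra_simps)
  also have "\<dots> \<le> (norm (ip H x x) + norm (ip H x y)) + (norm (ip H y x) + norm (ip H y y))"
    by (intro norm_triangle_mono) auto
  also have "\<dots> \<le> ((hnorm H x)\<^sup>2 + hnorm H x * hnorm H y) + (hnorm H y * hnorm H x + (hnorm H y)\<^sup>2)"
    using x y by (intro add_mono Cauchy_Schwarz) (auto simp: hnorm_square)
  also have "\<dots> = (hnorm H x + hnorm H y)\<^sup>2" by (simp add: power2_eq_square algebra_simps)
  finally show ?thesis by (rule power2_le_imp_le) simp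
qed

lemma hnorm_minus [simp]: "x \<in> car H \<Longrightarrow> hnorm H (- x) = hnorm H x"
  by (simp add: hnorm_def ip_minus_right ip_minus_left)

lemma hnorm_minus_commute: "x \<in> car H \<Longrightarrow> y \<in> car H \<Longrightarrow> hnorm H (x - y) = hnorm H (y - x)"
  using hnorm_minus[of "x - y"] by simp

lemma hnorm_triangle_diff: "x \<in> car H \<Longrightarrow> y \<in> car H \<Longrightarrow> hnorm H (x - y) \<le> hnorm H x + hnorm H y"
  using hnorm_triangle[of x "- y"] by simp

lemma hnorm_triangle_3:
  "x \<in> car H \<Longrightarrow> y \<in> car H \<Longrightarrow> z \<in> car H \<Longrightarrow> hnorm H (x - z) \<le> hnorm H (x - y) + hnorm H (y - z)"
  using hnorm_triangle[of "x - y" "y - z"] by simp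

lemma hnorm_sum: "(\<And>i. i \<in> I \<Longrightarrow> f i \<in> car H) \<Longrightarrow> hnorm H (sum f I) \<le> (\<Sum>i\<in>I. hnorm H (f i))"
proof (induction I rule: infinite_finite_induct)
  case (insert i I)
  then have "hnorm H (f i + sum f I) \<le> hnorm H (f i) + hnorm H (sum f I)"
    by (intro hnorm_triangle sum_closed) auto
  with insert show ?case by force
qed auto

lemma hnorm_act_le: assumes x: "x \<in> car H" shows "hnorm H (act H x a) \<le> hnorm H x * norm a"
proof -
  have "(hnorm H (act H x a))\<^sup>2 = norm (star a * ip H x x * a)"
    using x by (simp add: hnorm_square ip_act_left ip_act_right mult.assoc)
  also have "\<dots> \<le> norm (star a) * norm (ip H x x) * norm a"
    by (meson mult_right_mono norm_ge_zero norm_mult_ineq order_trans)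
  also have "\<dots> = (hnorm H x * norm a)\<^sup>2" by (simp flip: hnorm_square add: power2_eq_square)
  finally show ?thesis by (rule power2_le_imp_le) simp
qed

lemma hnorm_act_of_real:
  assumes x: "x \<in> car H" shows "hnorm H (act H x (of_real t)) = \<bar>t\<bar> * hnorm H x"
proof -
  have "ip H (act H x (of_real t)) (act H x (of_real t)) = (t * t) *\<^sub>R ip H x x"
    using x by (simp add: ip_act_left ip_act_right of_real_def)
  then show ?thesis by (simp add: hnorm_def real_sqrt_mult abs_mult_self flip: power2_eq_square)
qed

lemma limit_unique:
  assumes "\<And>n. X n \<in> car H" "a \<in> car H" "b \<in> car H"
    and "(\<lambda>n. hnorm H (X n - a)) \<longlonglongrightarrow> 0" "(\<lambda>n. hnorm H (X n - b)) \<longlonglongrightarrow> 0"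
  shows "a = b"
proof -
  have "(\<lambda>n. hnorm H (X n - a) + hnorm H (X n - b)) \<longlonglongrightarrow> 0"
    using tendsto_add[OF assms(4,5)] by simp
  moreover have "hnorm H (a - b) \<le> hnorm H (X n - a) + hnorm H (X n - b)" for n
    using hnorm_triangle_3[of a "X n" b] assms(1-3) by (simp add: hnorm_minus_commute)
  ultimately have "hnorm H (a - b) \<le> 0" by (intro LIMSEQ_le_const) auto
  then have "hnorm H (a - b) = 0" by (simp add: order_antisym)
  then show ?thesis using assms(2,3) by (subst (asm) hnorm_eq_0) auto
qed

lemma hnorm_limit_le:
  assumes "\<And>n. X n \<in> car H" "l \<in> car H" "(\<lambda>n. hnorm H (X n - l)) \<longlonglongrightarrow> 0" "\<And>n. hnorm H (X n) \<le> C"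
  shows "hnorm H l \<le> C"
proof -
  have "(\<lambda>n. C + hnorm H (X n - l)) \<longlonglongrightarrow> C + 0" by (intro tendsto_intros assms)
  moreover have "hnorm H l \<le> C + hnorm H (X n - l)" for n
    using hnorm_triangle_diff[of "X n" "X n - l"] assms(1,2) assms(4)[of n] by simp
  ultimately show ?thesis by (intro LIMSEQ_le_const[of _ C]) auto
qed

text \<open>The bound on the limit matters as much as its existence: it becomes the norm bound on
  preimages found by successive approximation.\<close>

lemma geometric_limit:
  assumes X: "\<And>n. X n \<in> car H" "X 0 = 0" and step: "\<And>n. hnorm H (X (Suc n) - X n) \<le> c * q ^ n"
    and q: "0 \<le> q" "q < 1"
  obtains l where "l \<in> car H" "(\<lambda>n. hnorm H (X n - l)) \<longlonglongrightarrow> 0" "hnorm H l \<le> c / (1 - q)"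
proof -
  have c: "c \<ge> 0" using order_trans[OF hnorm_nonneg step[of 0]] by simp
  have le: "hnorm H (X (n + k) - X n) \<le> c * q ^ n / (1 - q)" for n k
  proof -
    have "hnorm H (X (n + k) - X n) \<le> c * q ^ n * (\<Sum>i<k. q ^ i)"
    proof (induction k)
      case (Suc k)
      have "hnorm H (X (n + Suc k) - X n) \<le> hnorm H (X (Suc (n + k)) - X (n + k)) + hnorm H (X (n + k) - X n)"
        using hnorm_triangle_3[of "X (Suc (n + k))" "X (n + k)" "X n"] X by simp
      also have "\<dots> \<le> c * q ^ (n + k) + c * q ^ n * (\<Sum>i<k. q ^ i)" by (intro add_mono step Suc)
      finally show ?case by (simp add: algebra_simps power_add)
    qed simp
    also have "\<dots> \<le> c * q ^ n * (1 / (1 - q))"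
      using q c by (intro mult_left_mono) (auto simp: sum_gp_strict divide_simps)
    finally show ?thesis by simp
  qed
  have lim: "(\<lambda>n. c * q ^ n / (1 - q)) \<longlonglongrightarrow> 0"
    using tendsto_mult[OF tendsto_const[of "c / (1 - q)"] LIMSEQ_realpow_zero[OF q]] by simp
  have "\<exists>l\<in>car H. (\<lambda>n. hnorm H (X n - l)) \<longlonglongrightarrow> 0"
  proof (rule complete[OF X(1)], intro allI impI)
    fix e :: real assume "e > 0"
    then obtain M where M: "\<And>n. n \<ge> M \<Longrightarrow> c * q ^ n / (1 - q) < e"
      using order_tendstoD(2)[OF lim] by (auto simp: eventually_sequentially)
    have *: "hnorm H (X m - X n) < e" if "n \<ge> M" "m \<ge> n" for m n
      using le[of n "m - n"] M[of n] that by simp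
    have "hnorm H (X m - X n) < e" if "n \<ge> M" "m \<ge> M" for m n
      using *[of n m] *[of m n] that hnorm_minus_commute[of "X m" "X n"] X by (cases "m \<ge> n") auto
    then show "\<exists>M. \<forall>m\<ge>M. \<forall>n\<ge>M. hnorm H (X m - X n) < e" by blast
  qed
  then obtain l where l: "l \<in> car H" "(\<lambda>n. hnorm H (X n - l)) \<longlonglongrightarrow> 0" by blast
  have "hnorm H l \<le> c / (1 - q)"
    by (rule hnorm_limit_le[OF X(1) l]) (use le[of 0] X in simp)
  with l that show ?thesis by blast
qed

end

lemma tendsto_zero_bound:
  fixes f g :: "nat \<Rightarrow> real"
  assumes "\<And>n. 0 \<le> f n" "\<And>n. f n \<le> g n" "g \<longlonglongrightarrow> 0"
  shows "f \<longlonglongrightarrow> 0"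
  by (rule tendsto_sandwich[OF _ _ tendsto_const assms(3)]) (use assms in auto)

section \<open>Bounded module maps, successive approximation and the open mapping theorem\<close>

lemma bmm_closed: "bounded_module_map H K T \<Longrightarrow> x \<in> car H \<Longrightarrow> T x \<in> car K"
  by (auto simp: bounded_module_map_def)

lemma bmm_add: "bounded_module_map H K T \<Longrightarrow> x \<in> car H \<Longrightarrow> y \<in> car H \<Longrightarrow> T (x + y) = T x + T y"
  by (auto simp: bounded_module_map_def)

lemma bmm_act: "bounded_module_map H K T \<Longrightarrow> x \<in> car H \<Longrightarrow> T (act H x a) = act K (T x) a"
  by (auto simp: bounded_module_map_def)

lemma bmm_bound:
  assumes "bounded_module_map H K T"
  obtains B where "B > 0" "\<And>x. x \<in> car H \<Longrightarrow> hnorm K (T x) \<le> B * hnorm H x"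
proof -
  obtain B where B: "\<And>x. x \<in> car H \<Longrightarrow> hnorm K (T x) \<le> B * hnorm H x"
    using assms unfolding bounded_module_map_def bounded_between_def by blast
  have "hnorm K (T x) \<le> (\<bar>B\<bar> + 1) * hnorm H x" if "x \<in> car H" for x
  proof -
    have "B * hnorm H x \<le> (\<bar>B\<bar> + 1) * hnorm H x" by (intro mult_right_mono) (auto simp: hnorm_def)
    with B[OF that] show ?thesis by linarith
  qed
  then show ?thesis by (intro that[of "\<bar>B\<bar> + 1"]) auto
qed

lemma bmmI:
  assumes "\<And>x. x \<in> car H \<Longrightarrow> T x \<in> car K"
    "\<And>x y. x \<in> car H \<Longrightarrow> y \<in> car H \<Longrightarrow> T (x + y) = T x + T y"
    "\<And>x a. x \<in> car H \<Longrightarrow> T (act H x a) = act K (T x) a"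
    "\<And>x. x \<in> car H \<Longrightarrow> hnorm K (T x) \<le> B * hnorm H x"
  shows "bounded_module_map H K T"
  using assms unfolding bounded_module_map_def bounded_between_def by blast

lemma bmm_compose:
  assumes S: "bounded_module_map K G S" and T: "bounded_module_map H K T"
  shows "bounded_module_map H G (\<lambda>x. S (T x))"
proof -
  obtain B where B: "B > 0" "\<And>x. x \<in> car K \<Longrightarrow> hnorm G (S x) \<le> B * hnorm K x" using bmm_bound[OF S] by metis
  obtain C where C: "C > 0" "\<And>x. x \<in> car H \<Longrightarrow> hnorm K (T x) \<le> C * hnorm H x" using bmm_bound[OF T] by metis
  have "hnorm G (S (T x)) \<le> (B * C) * hnorm H x" if "x \<in> car H" for x
  proof -
    have "hnorm G (S (T x)) \<le> B * hnorm K (T x)" by (rule B(2)[OF bmm_closed[OF T that]])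
    also have "\<dots> \<le> B * (C * hnorm H x)" using that B C by (intro mult_left_mono) auto
    finally show ?thesis by simp
  qed
  then show ?thesis
    using bmm_closed[OF S] bmm_closed[OF T] bmm_add[OF S] bmm_add[OF T] bmm_act[OF S] bmm_act[OF T]
    by (intro bmmI[where B = "B * C"]) auto
qed

lemma bmm_id: "bounded_module_map H H (\<lambda>x. x)"
  by (rule bmmI[where B = 1]) auto

locale hilbert_module_pair = H: hilbert_module H + K: hilbert_module K
  for H :: "('m::ab_group_add, 'a::cstar_algebra) hmod" and K :: "('n::ab_group_add, 'a) hmod"
begin

lemma bmm_zero [simp]: "bounded_module_map H K T \<Longrightarrow> T 0 = 0"
  using bmm_add[of H K T 0 0] by simp

lemma bmm_minus: "bounded_module_map H K T \<Longrightarrow> x \<in> car H \<Longrightarrow> T (- x) = - T x"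
  using bmm_add[of H K T x "- x"] by (simp add: eq_neg_iff_add_eq_0 add.commute)

lemma bmm_diff: "bounded_module_map H K T \<Longrightarrow> x \<in> car H \<Longrightarrow> y \<in> car H \<Longrightarrow> T (x - y) = T x - T y"
  using bmm_add[of H K T x "- y"] by (simp add: bmm_minus)

lemma bmm_sum:
  assumes "bounded_module_map H K T"
  shows "(\<And>i. i \<in> I \<Longrightarrow> f i \<in> car H) \<Longrightarrow> T (sum f I) = (\<Sum>i\<in>I. T (f i))"
  by (induction I rule: infinite_finite_induct) (auto simp: bmm_add[OF assms] H.sum_closed assms)

lemma bmm_limit:
  assumes T: "bounded_module_map H K T" and X: "\<And>n. X n \<in> car H" "l \<in> car H"
    and lim: "(\<lambda>n. hnorm H (X n - l)) \<longlonglongrightarrow> 0"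
  shows "(\<lambda>n. hnorm K (T (X n) - T l)) \<longlonglongrightarrow> 0"
proof -
  obtain B where B: "B > 0" "\<And>x. x \<in> car H \<Longrightarrow> hnorm K (T x) \<le> B * hnorm H x" using bmm_bound[OF T] by metis
  have "(\<lambda>n. B * hnorm H (X n - l)) \<longlonglongrightarrow> 0" using tendsto_mult[OF tendsto_const lim] by simp
  then show ?thesis
    by (rule tendsto_zero_bound[rotated 2]) (use B X in \<open>auto simp flip: bmm_diff[OF T]\<close>)
qed

lemma bmm_plus:
  assumes S: "bounded_module_map H K S" and T: "bounded_module_map H K T"
  shows "bounded_module_map H K (\<lambda>x. S x + T x)"
proof -
  obtain B where B: "B > 0" "\<And>x. x \<in> car H \<Longrightarrow> hnorm K (S x) \<le> B * hnorm H x" using bmm_bound[OF S] by metis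
  obtain C where C: "C > 0" "\<And>x. x \<in> car H \<Longrightarrow> hnorm K (T x) \<le> C * hnorm H x" using bmm_bound[OF T] by metis
  show ?thesis
  proof (rule bmmI)
    fix x assume x: "x \<in> car H"
    then show "hnorm K (S x + T x) \<le> (B + C) * hnorm H x"
      using K.hnorm_triangle[of "S x" "T x"] B(2)[OF x] C(2)[OF x] bmm_closed[OF S x] bmm_closed[OF T x]
      by (simp add: algebra_simps)
  qed (use bmm_closed[OF S] bmm_closed[OF T] in
      \<open>auto simp: bmm_add[OF S] bmm_add[OF T] bmm_act[OF S] bmm_act[OF T] K.act_add_left\<close>)
qed

lemma bmm_uminus:
  assumes T: "bounded_module_map H K T"
  shows "bounded_module_map H K (\<lambda>x. - T x)"
proof -
  obtain C where C: "C > 0" "\<And>x. x \<in> car H \<Longrightarrow> hnorm K (T x) \<le> C * hnorm H x" using bmm_bound[OF T] by metis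
  show ?thesis
    by (rule bmmI[where B = C])
      (use bmm_closed[OF T] C in \<open>auto simp: bmm_add[OF T] bmm_act[OF T] K.act_minus_left\<close>)
qed

lemma bmm_subtract:
  assumes "bounded_module_map H K S" "bounded_module_map H K T"
  shows "bounded_module_map H K (\<lambda>x. S x - T x)"
  using bmm_plus[OF assms(1) bmm_uminus[OF assms(2)]] by simp

lemma bmm_zero_map: "bounded_module_map H K (\<lambda>x. 0)"
  by (rule bmmI[where B = 0]) auto

lemma closed_kernel:
  assumes T: "bounded_module_map H K T"
  shows "closed_submodule H {x \<in> car H. T x = 0}"
  unfolding closed_submodule_def
proof (intro conjI allI impI ballI)
  fix X l assume X: "\<forall>n. X n \<in> {x \<in> car H. T x = 0}" "l \<in> car H" "(\<lambda>n. hnorm H (X n - l)) \<longlonglongrightarrow> 0"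
  have "(\<lambda>n. hnorm K (T (X n) - T l)) \<longlonglongrightarrow> 0" using X by (intro bmm_limit T) auto
  then have "(\<lambda>n::nat. hnorm K (0 - T l)) \<longlonglongrightarrow> 0" using X by simp
  then have "hnorm K (0 - T l) = 0" using LIMSEQ_const_iff by blast
  then show "l \<in> {x \<in> car H. T x = 0}" using X(2) bmm_closed[OF T X(2)] by (simp add: K.hnorm_eq_0)
qed (auto simp: T bmm_add[OF T] bmm_act[OF T])

text \<open>A solver with relative error \<open>q < 1\<close> is applied again to the residual, and
  the corrections sum geometrically. The same statement completes the open mapping theorem, inverts
  Gram operators and replaces the Neumann series on tails.\<close>

lemma approximate_surjection:
  assumes T: "bounded_module_map H K T" and q: "0 \<le> q" "q < 1"
    and appr: "\<And>y. y \<in> car K \<Longrightarrow>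
      \<exists>x\<in>car H. hnorm H x \<le> C * hnorm K y \<and> hnorm K (y - T x) \<le> q * hnorm K y"
    and y: "y \<in> car K"
  obtains x where "x \<in> car H" "T x = y" "hnorm H x \<le> C / (1 - q) * hnorm K y"
proof -
  obtain g where g: "\<And>y. y \<in> car K \<Longrightarrow>
      g y \<in> car H \<and> hnorm H (g y) \<le> C * hnorm K y \<and> hnorm K (y - T (g y)) \<le> q * hnorm K y"
    using appr by metis
  \<comment> \<open>\<open>r n\<close> is the residual left after \<open>n\<close>
    corrections.\<close>
  define r where "r = rec_nat y (\<lambda>_ z. z - T (g z))"
  have r0: "r 0 = y" and rS: "r (Suc n) = r n - T (g (r n))" for n by (auto simp: r_def)
  have r: "r n \<in> car K" for n
    by (induction n) (auto simp: r0 rS y g bmm_closed[OF T])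
  have rn: "hnorm K (r n) \<le> q ^ n * hnorm K y" for n
  proof (induction n)
    case (Suc n)
    have "hnorm K (r (Suc n)) \<le> q * hnorm K (r n)" using g[OF r] by (simp add: rS)
    also have "\<dots> \<le> q * (q ^ n * hnorm K y)" using Suc q by (intro mult_left_mono)
    finally show ?case by simp
  qed (simp add: r0)
  define s where "s n = (\<Sum>i<n. g (r i))" for n
  have s: "s n \<in> car H" for n using g r by (simp add: s_def H.sum_closed)
  have Ts: "T (s n) = y - r n" for n
    by (induction n) (use s g r in \<open>auto simp: s_def r0 rS bmm_add[OF T] T\<close>)
  have C: "C * hnorm K y \<ge> 0" using g[OF y] order_trans[OF H.hnorm_nonneg] by blast
  have step: "hnorm H (s (Suc n) - s n) \<le> (C * hnorm K y) * q ^ n" for n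
  \<comment> \<open>For \<open>y = 0\<close> the sign of \<open>C\<close> is unknown, so the
    estimate comes from the vanishing of the residuals.\<close>
  proof (cases "hnorm K y = 0")
    case True
    then have "y = 0" using y by (simp add: K.hnorm_eq_0)
    have "hnorm K (r n) = 0" using rn[of n] True by (simp add: order_antisym)
    then have "hnorm H (g (r n)) \<le> 0" using g[OF r[of n]] by simp
    then show ?thesis using True by (simp add: s_def)
  next
    case False
    then have "C \<ge> 0" using C K.hnorm_nonneg[of y] by (simp add: zero_le_mult_iff)
    have "hnorm H (s (Suc n) - s n) \<le> C * hnorm K (r n)" using g[OF r] by (simp add: s_def)
    also have "\<dots> \<le> C * (q ^ n * hnorm K y)" using rn \<open>C \<ge> 0\<close> by (intro mult_left_mono)
    finally show ?thesis by (simp add: mult_ac)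
  qed
  have "s 0 = 0" by (simp add: s_def)
  obtain x where x: "x \<in> car H" "(\<lambda>n. hnorm H (s n - x)) \<longlonglongrightarrow> 0"
      "hnorm H x \<le> (C * hnorm K y) / (1 - q)"
    using H.geometric_limit[of s, OF s \<open>s 0 = 0\<close> step q] by metis
  have "(\<lambda>n. hnorm K (T (s n) - T x)) \<longlonglongrightarrow> 0" by (rule bmm_limit[OF T s x(1,2)])
  moreover have "(\<lambda>n. hnorm K (T (s n) - y)) \<longlonglongrightarrow> 0"
  proof -
    have lim: "(\<lambda>n. q ^ n * hnorm K y) \<longlonglongrightarrow> 0"
      using tendsto_mult[OF LIMSEQ_realpow_zero[OF q] tendsto_const] by simp
    have "hnorm K (T (s n) - y) \<le> q ^ n * hnorm K y" for n
      using rn[of n] r[of n] by (simp add: Ts)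
    then show ?thesis by (rule tendsto_zero_bound[OF K.hnorm_nonneg _ lim])
  qed
  ultimately have "T x = y"
    by (intro K.limit_unique[of "\<lambda>n. T (s n)"]) (auto simp: bmm_closed[OF T] s x y)
  with x that show ?thesis by (simp add: field_simps)
qed

end

text \<open>Presents the carrier as a complete metric space so that Baire's theorem applies. Off the
  carrier the distance is set to \<open>0\<close>, since \<open>hnorm H (x - y)\<close> need not be
  symmetric there.\<close>

lemma (in hilbert_module) Metric_space_car:
  defines "d \<equiv> \<lambda>x y. if x \<in> car H \<and> y \<in> car H then hnorm H (x - y) else 0"
  shows "Metric_space (car H) d" "Metric_space.mcomplete (car H) d"
proof -
  show M: "Metric_space (car H) d"
    by unfold_locales
      (auto simp: d_def hnorm_eq_0 hnorm_triangle_3 intro: hnorm_minus_commute)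
  interpret Metric_space "car H" d by (rule M)
  show mcomplete
    unfolding mcomplete_def
  proof (intro allI impI)
    fix X assume X: "MCauchy X"
    then have c: "X n \<in> car H" for n by (auto simp: MCauchy_def)
    have "\<forall>e>0. \<exists>M::nat. \<forall>m\<ge>M. \<forall>n\<ge>M. hnorm H (X m - X n) < e"
    proof (intro allI impI)
      fix e :: real assume "e > 0"
      then obtain N where "\<And>m n. N \<le> m \<Longrightarrow> N \<le> n \<Longrightarrow> d (X m) (X n) < e"
        using X unfolding MCauchy_def by blast
      then show "\<exists>M. \<forall>m\<ge>M. \<forall>n\<ge>M. hnorm H (X m - X n) < e" using c by (auto simp: d_def)
    qed
    with c obtain l where l: "l \<in> car H" "(\<lambda>n. hnorm H (X n - l)) \<longlonglongrightarrow> 0" using complete by metis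
    have "eventually (\<lambda>n. X n \<in> car H \<and> d (X n) l < e) sequentially" if "e > 0" for e
      using order_tendstoD(2)[OF l(2) that] by eventually_elim (simp add: d_def c l)
    then show "\<exists>x. limitin mtopology X x sequentially" using l(1) unfolding limitin_metric by blast
  qed
qed

context hilbert_module_pair
begin

theorem open_mapping:
  assumes T: "bounded_module_map H K T" and surj: "T ` car H = car K"
  obtains C where "C > 0" "\<And>y. y \<in> car K \<Longrightarrow> \<exists>x\<in>car H. T x = y \<and> hnorm H x \<le> C * hnorm K y"
proof -
  define d where "d = (\<lambda>x y. if x \<in> car K \<and> y \<in> car K then hnorm K (x - y) else 0)"
  interpret M: Metric_space "car K" d unfolding d_def by (rule K.Metric_space_car)
  have d: "d x y = hnorm K (x - y)" if "x \<in> car K" "y \<in> car K" for x y using that by (simp add: d_def)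
  have compl: M.mcomplete using K.Metric_space_car(2) by (simp add: d_def)
  \<comment> \<open>Closures of images of balls of radius \<open>n\<close>. They cover
    \<open>car K\<close>, so by Baire one of them contains a ball about some
    \<open>y0\<close>.\<close>
  define V where "V n = M.mtopology closure_of (T ` {x \<in> car H. hnorm H x \<le> real n})" for n
  have Un: "\<Union>(range V) = car K"
  proof
    show "\<Union>(range V) \<subseteq> car K" by (auto simp: V_def M.metric_closure_of)
    show "car K \<subseteq> \<Union>(range V)"
    proof
      fix y assume "y \<in> car K"
      then obtain x where x: "x \<in> car H" "y = T x" using surj by blast
      obtain n where "hnorm H x \<le> real n" using real_arch_simple by blast
      then have "y \<in> V n" unfolding V_def
        by (intro subsetD[OF closure_of_subset]) (use x in \<open>auto simp: bmm_closed[OF T]\<close>)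
      then show "y \<in> \<Union>(range V)" by blast
    qed
  qed
  have "\<exists>n. M.mtopology interior_of V n \<noteq> {}"
  proof (rule ccontr)
    assume "\<nexists>n. M.mtopology interior_of V n \<noteq> {}"
    then have "M.mtopology interior_of \<Union>(range V) = {}"
      by (intro M.metric_Baire_category_alt compl) (auto simp: V_def)
    then show False unfolding Un using interior_of_topspace[of M.mtopology] K.zero_closed by auto
  qed
  then obtain n y0 e where y0: "y0 \<in> car K" "e > 0" "M.mball y0 e \<subseteq> V n"
    by (auto simp: M.in_interior_of_mball)
  have appr: "\<exists>x\<in>car H. hnorm H x \<le> real n \<and> hnorm K (y0 + y - T x) < s"
    if "y \<in> car K" "hnorm K y < e" "s > 0" for y s
  proof -
    have "y0 + y \<in> M.mball y0 e" using that y0 by (simp add: M.in_mball d)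
    then have "y0 + y \<in> V n" using y0 by blast
    then obtain x where "x \<in> car H" "hnorm H x \<le> real n" "d (y0 + y) (T x) < s"
      using \<open>s > 0\<close> by (auto simp: V_def M.metric_closure_of M.in_mball)
    then show ?thesis using that(1) y0(1) by (auto simp: d bmm_closed[OF T])
  qed
  have half: "\<exists>x\<in>car H. hnorm H x \<le> (4 * real n / e) * hnorm K y \<and> hnorm K (y - T x) \<le> (1/2) * hnorm K y"
    if y: "y \<in> car K" for y
  proof (cases "y = 0")
    case False
    \<comment> \<open>Scaling by \<open>t\<close> brings \<open>y\<close> to \<open>z\<close> of
      norm \<open>e / 2\<close>. Approximating \<open>y0 + z\<close> and \<open>y0\<close> within
      \<open>e / 8\<close> and subtracting removes the centre and leaves an error of at most
      \<open>e / 4\<close>, half the norm of \<open>z\<close>. Undoing the scaling turns the radius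
      \<open>2 n\<close> into the factor \<open>4 n / e\<close>.\<close>
    define t where "t = e / (2 * hnorm K y)"
    have ny: "hnorm K y > 0" using False y K.hnorm_eq_0[of y] K.hnorm_nonneg[of y] by linarith
    then have t: "t > 0" using y0 by (simp add: t_def)
    define z where "z = act K y (of_real t)"
    have z: "z \<in> car K" "hnorm K z < e" "hnorm K z = e / 2"
      using y t ny y0 by (auto simp: z_def K.hnorm_act_of_real) (auto simp: t_def)
    obtain x1 where x1: "x1 \<in> car H" "hnorm H x1 \<le> real n" "hnorm K (y0 + z - T x1) < e / 8"
      using appr[OF z(1,2), of "e / 8"] y0 by auto
    obtain x2 where x2: "x2 \<in> car H" "hnorm H x2 \<le> real n" "hnorm K (y0 - T x2) < e / 8"
      using appr[of 0 "e / 8"] y0 by auto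
    define x where "x = act H (x1 - x2) (of_real (1 / t))"
    have "hnorm H (x1 - x2) \<le> 2 * real n" using H.hnorm_triangle_diff[of x1 x2] x1 x2 by simp
    then have "hnorm H x \<le> (1 / t) * (2 * real n)"
      unfolding x_def using t x1 x2 by (subst H.hnorm_act_of_real) (auto intro!: divide_right_mono)
    also have "\<dots> = (4 * real n / e) * hnorm K y" using y0 ny by (simp add: t_def field_simps)
    finally have 1: "hnorm H x \<le> (4 * real n / e) * hnorm K y" .
    have e1: "z - T (x1 - x2) = (y0 + z - T x1) - (y0 - T x2)"
      using x1 x2 by (simp add: bmm_diff[OF T])
    have "hnorm K (z - T (x1 - x2)) \<le> hnorm K (y0 + z - T x1) + hnorm K (y0 - T x2)"
      unfolding e1 using K.hnorm_triangle_diff[of "y0 + z - T x1" "y0 - T x2"] x1(1) x2(1) y0(1) z(1)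
      by (simp only: bmm_closed[OF T] K.diff_closed K.add_closed)
    also have "\<dots> \<le> e / 4" using x1 x2 by simp
    finally have le: "hnorm K (z - T (x1 - x2)) \<le> e / 4" .
    have "y = act K z (of_real (1 / t))"
      using y t by (simp add: z_def K.act_act K.act_one flip: of_real_mult)
    then have "y - T x = act K (z - T (x1 - x2)) (of_real (1 / t))"
      using x1 x2 z by (simp add: x_def bmm_act[OF T] K.act_diff_left bmm_closed[OF T])
    then have "hnorm K (y - T x) = (1 / t) * hnorm K (z - T (x1 - x2))"
      using x1 x2 z t by (simp add: K.hnorm_act_of_real bmm_closed[OF T])
    also have "\<dots> \<le> (1 / t) * (e / 4)" using le t by (intro mult_left_mono) auto
    also have "\<dots> = (1/2) * hnorm K y" using y0 ny by (simp add: t_def field_simps)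
    finally show ?thesis using 1 x1 x2 by (intro bexI[of _ x]) (auto simp: x_def)
  qed (auto intro!: bexI[of _ 0] simp: T)
  show ?thesis
  proof (rule that)
    \<comment> \<open>The geometric series with ratio \<open>1/2\<close> doubles
      \<open>4 n / e\<close>; the added \<open>1\<close> keeps the constant positive when
      \<open>n = 0\<close>.\<close>
    show "8 * real n / e + 1 > 0" using y0 by (simp add: add_nonneg_pos)
    fix y assume y: "y \<in> car K"
    obtain x where x: "x \<in> car H" "T x = y" "hnorm H x \<le> (4 * real n / e) / (1 - 1/2) * hnorm K y"
      using approximate_surjection[OF T _ _ half y] by auto
    have "(4 * real n / e) / (1 - 1/2) * hnorm K y \<le> (8 * real n / e + 1) * hnorm K y"
      by (intro mult_right_mono) auto
    then have "hnorm H x \<le> (8 * real n / e + 1) * hnorm K y" using x(3) by linarith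
    with x show "\<exists>x\<in>car H. T x = y \<and> hnorm H x \<le> (8 * real n / e + 1) * hnorm K y" by blast
  qed
qed

end

section \<open>The standard module, sums and submodules\<close>

text \<open>Series in \<open>ell2\<close> converge in norm but not necessarily absolutely, so
  domination is applied to whole blocks of terms, whose sums are compared by
  \<open>norm_cpos_mono\<close>.\<close>

lemma summable_cpos_comparison:
  fixes f g :: "nat \<Rightarrow> 'a::cstar_algebra"
  assumes "\<And>n. f n \<in> cpos" "\<And>n. g n - f n \<in> cpos" "summable g"
  shows "summable f"
  unfolding summable_Cauchy
proof (intro allI impI)
  fix e :: real assume "e > 0"
  then obtain N where N: "\<And>m n. m \<ge> N \<Longrightarrow> norm (sum g {m..<n}) < e"
    using assms(3) unfolding summable_Cauchy by blast
  have "norm (sum f {m..<n}) \<le> norm (sum g {m..<n})" for m n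
    by (rule norm_cpos_mono) (use assms in \<open>auto intro!: cpos_sum simp flip: sum_subtractf\<close>)
  then show "\<exists>N. \<forall>m\<ge>N. \<forall>n. norm (sum f {m..<n}) < e" using N order_le_less_trans by blast
qed

lemma suminf_cpos:
  fixes f :: "nat \<Rightarrow> 'a::cstar_algebra"
  assumes "\<And>n. f n \<in> cpos" "summable f"
  shows "suminf f \<in> cpos"
  by (rule cpos_closed[OF summable_LIMSEQ[OF assms(2)]]) (use assms in \<open>auto intro: cpos_sum\<close>)

lemma norm_partial_sum_le:
  fixes f :: "nat \<Rightarrow> 'a::cstar_algebra"
  assumes f: "\<And>n. f n \<in> cpos" "summable f" and I: "finite I"
  shows "norm (sum f I) \<le> norm (suminf f)"
proof (rule norm_cpos_mono)
  obtain n where n: "I \<subseteq> {..<n}" using I finite_nat_iff_bounded by blast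
  have "suminf f - sum f I = (suminf f - sum f {..<n}) + sum f ({..<n} - I)"
    using n by (simp add: sum_diff)
  also have "suminf f - sum f {..<n} = (\<Sum>i. f (i + n))"
    using suminf_split_initial_segment[OF f(2), of n] by simp
  finally show "suminf f - sum f I \<in> cpos"
    using f by (auto intro!: cpos_add cpos_sum suminf_cpos simp: summable_iff_shift)
qed (use f in \<open>auto intro: cpos_sum\<close>)

text \<open>The element is \<open>star (a - b) * (a - b)\<close>. This bound makes
  \<open>ell2\<close> closed under addition.\<close>

lemma parallelogram_bound:
  "2 *\<^sub>R (star a * a) + 2 *\<^sub>R (star b * b) - star (a + b) * (a + b) \<in> (cpos :: 'a::cstar_algebra set)"
  using star_mult_self_cpos[of "a - b"]
  by (simp add: star_add star_diff algebra_simps scaleR_2)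

section \<open>Inner product and completeness of the standard module\<close>

lemma ell2_car: "x \<in> car ell2 \<longleftrightarrow> summable (\<lambda>n. star (x n) * x n)"
  by (simp add: ell2_def)

lemma ell2_ip: "ip ell2 x y = (\<Sum>n. star (x n) * y n)"
  by (simp add: ell2_def)

lemma ell2_act: "act ell2 x a = (\<lambda>n. x n * a)"
  by (simp add: ell2_def)

lemma ell2_zero: "0 \<in> car ell2"
  by (simp add: ell2_car)

lemma ell2_add: "x \<in> car ell2 \<Longrightarrow> y \<in> car ell2 \<Longrightarrow> x + y \<in> car ell2"
  unfolding ell2_car
  by (rule summable_cpos_comparison[where
        g = "\<lambda>n. 2 *\<^sub>R (star (x n) * x n) + 2 *\<^sub>R (star (y n) * y n)"])
    (auto simp: parallelogram_bound star_mult_self_cpos intro!: summable_add summable_scaleR_right)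

lemma ell2_mult_right: "x \<in> car ell2 \<Longrightarrow> (\<lambda>n. x n * a) \<in> car ell2"
  using summable_mult[OF summable_mult2, of "\<lambda>n. star (x n) * x n" "star a" a]
  by (simp add: ell2_car star_mult mult.assoc)

lemma ell2_scaleC: "x \<in> car ell2 \<Longrightarrow> (\<lambda>n. scaleC c (x n)) \<in> car ell2"
  using ell2_mult_right[of x "scaleC c 1"] by (simp add: mult_scaleC_right)

lemma ell2_minus: "x \<in> car ell2 \<Longrightarrow> - x \<in> car ell2"
  by (simp add: ell2_car)

lemma ell2_diff: "x \<in> car ell2 \<Longrightarrow> y \<in> car ell2 \<Longrightarrow> x - y \<in> car ell2"
  using ell2_add[of x "- y"] by (simp add: ell2_minus)

lemma summable_scaleC:
  fixes f :: "nat \<Rightarrow> 'a::cstar_algebra"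
  shows "summable f \<Longrightarrow> summable (\<lambda>n. scaleC c (f n))"
  using summable_mult[of f "scaleC c 1"] by (simp add: mult_scaleC_left)

text \<open>Reduces convergence of the mixed series \<open>star (x n) * y n\<close> to that of four
  series of squares. The sign before \<open>scaleC \<i>\<close> reflects conjugate linearity in the
  first argument.\<close>

lemma polarization:
  fixes a b :: "'a::cstar_algebra"
  defines "f \<equiv> \<lambda>z::'a. star z * z"
  shows "4 *\<^sub>R (star a * b) =
    (f (a + b) - f (a - b)) - scaleC \<i> (f (a + scaleC \<i> b) - f (a - scaleC \<i> b))"
proof -
  have "f (a + scaleC \<i> b) - f (a - scaleC \<i> b) = scaleC \<i> (2 *\<^sub>R (star a * b) - 2 *\<^sub>R (star b * a))"
    by (simp add: f_def star_add star_diff star_scaleC_ii algebra_simps mult_scaleC_left mult_scaleC_right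
        scaleR_2 scaleC_add_right scaleC_diff_right)
  then have "(f (a + b) - f (a - b)) - scaleC \<i> (f (a + scaleC \<i> b) - f (a - scaleC \<i> b))
     = (f (a + b) - f (a - b)) + (2 *\<^sub>R (star a * b) - 2 *\<^sub>R (star b * a))" by simp
  also have "\<dots> = (2 + 2) *\<^sub>R (star a * b)"
    unfolding scaleR_add_left by (simp add: f_def star_add star_diff algebra_simps scaleR_2)
  finally show ?thesis by simp
qed

lemma ell2_summable_ip:
  assumes x: "x \<in> car ell2" and y: "y \<in> car ell2"
  shows "summable (\<lambda>n. star (x n) * y n)"
proof -
  let ?f = "\<lambda>z. star z * z"
  have iy: "(\<lambda>n. scaleC \<i> (y n)) \<in> car ell2" using y by (rule ell2_scaleC)
  have "summable (\<lambda>n. ?f (x n + y n))" "summable (\<lambda>n. ?f (x n - y n))"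
    using ell2_add[OF x y] ell2_diff[OF x y] by (auto simp: ell2_car)
  moreover have "summable (\<lambda>n. ?f (x n + scaleC \<i> (y n)))" "summable (\<lambda>n. ?f (x n - scaleC \<i> (y n)))"
    using ell2_add[OF x iy] ell2_diff[OF x iy] by (auto simp: ell2_car)
  ultimately have "summable (\<lambda>n. (1/4) *\<^sub>R ((?f (x n + y n) - ?f (x n - y n))
      - scaleC \<i> (?f (x n + scaleC \<i> (y n)) - ?f (x n - scaleC \<i> (y n)))))"
    by (intro summable_scaleR_right summable_diff summable_scaleC)
  then show ?thesis unfolding polarization[symmetric] by simp
qed

lemma ell2_hnorm_square: "(hnorm ell2 x)\<^sup>2 = norm (\<Sum>n. star (x n) * x n)"
  by (simp add: hnorm_def ell2_ip)

lemma ell2_norm_sum_le: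
  assumes "x \<in> car ell2" "finite I"
  shows "norm (\<Sum>n\<in>I. star (x n) * x n) \<le> (hnorm ell2 x)\<^sup>2"
  unfolding ell2_hnorm_square
  by (rule norm_partial_sum_le) (use assms in \<open>auto simp: ell2_car star_mult_self_cpos\<close>)

lemma ell2_component_le: assumes "x \<in> car ell2" shows "norm (x n) \<le> hnorm ell2 x"
proof -
  have "(norm (x n))\<^sup>2 \<le> (hnorm ell2 x)\<^sup>2"
    using ell2_norm_sum_le[OF assms, of "{n}"] by (simp add: cstar_identity)
  then show ?thesis by (rule power2_le_imp_le) (simp add: hnorm_def)
qed

lemma ell2_hnorm_le:
  assumes "x \<in> car ell2" "\<And>n. norm (\<Sum>i<n. star (x i) * x i) \<le> e\<^sup>2" "e \<ge> 0"
  shows "hnorm ell2 x \<le> e"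
proof -
  have "(\<lambda>n. norm (\<Sum>i<n. star (x i) * x i)) \<longlonglongrightarrow> norm (\<Sum>n. star (x n) * x n)"
    using assms(1) by (intro tendsto_norm summable_LIMSEQ) (simp add: ell2_car)
  then have "(hnorm ell2 x)\<^sup>2 \<le> e\<^sup>2"
    unfolding ell2_hnorm_square by (rule LIMSEQ_le_const2) (use assms in blast)
  then show ?thesis using assms(3) by (rule power2_le_imp_le)
qed

lemma star_diff_mult_commute: "star (a - b) * (a - b) = star (b - a) * (b - (a::'a::cstar_algebra))"
  by (simp add: star_diff algebra_simps)

lemma ell2_complete:
  assumes X: "\<And>n. X n \<in> car ell2"
    and C: "\<forall>e>0. \<exists>M::nat. \<forall>m\<ge>M. \<forall>n\<ge>M. hnorm ell2 (X m - X n) < e"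
  shows "\<exists>l\<in>car ell2. (\<lambda>n. hnorm ell2 (X n - l)) \<longlonglongrightarrow> 0"
proof -
  have "Cauchy (\<lambda>n. X n i)" for i
  proof (rule metric_CauchyI)
    fix e :: real assume "e > 0"
    then obtain M where M: "\<forall>m\<ge>M. \<forall>n\<ge>M. hnorm ell2 (X m - X n) < e" using C by blast
    have "dist (X m i) (X n i) \<le> hnorm ell2 (X m - X n)" for m n
      using ell2_component_le[OF ell2_diff[OF X X], of m n i] by (simp add: dist_norm)
    then show "\<exists>M. \<forall>m\<ge>M. \<forall>n\<ge>M. dist (X m i) (X n i) < e" using M order_le_less_trans by blast
  qed
  then have "\<forall>i. \<exists>z. (\<lambda>n. X n i) \<longlonglongrightarrow> z" by (simp add: Cauchy_convergent_iff convergent_def)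
  then obtain l where l: "\<And>i. (\<lambda>n. X n i) \<longlonglongrightarrow> l i" by metis
  \<comment> \<open>Uniformity over all finite index sets is what survives the coordinatewise limit;
    it yields both \<open>l \<in> car ell2\<close> and convergence in norm.\<close>
  have block: "\<exists>M. \<forall>k\<ge>M. \<forall>I. finite I \<longrightarrow> norm (\<Sum>i\<in>I. star (X k i - l i) * (X k i - l i)) \<le> e\<^sup>2"
    if "e > 0" for e
  proof -
    obtain M where M: "\<forall>m\<ge>M. \<forall>n\<ge>M. hnorm ell2 (X m - X n) < e" using C \<open>e > 0\<close> by blast
    have "norm (\<Sum>i\<in>I. star (X k i - l i) * (X k i - l i)) \<le> e\<^sup>2" if "k \<ge> M" "finite I" for k I
    proof (rule LIMSEQ_le_const2)
      show "(\<lambda>m. norm (\<Sum>i\<in>I. star (X k i - X m i) * (X k i - X m i)))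
          \<longlonglongrightarrow> norm (\<Sum>i\<in>I. star (X k i - l i) * (X k i - l i))"
        by (intro tendsto_intros tendsto_star l)
      have "norm (\<Sum>i\<in>I. star (X k i - X m i) * (X k i - X m i)) \<le> e\<^sup>2" if "m \<ge> M" for m
      proof -
        have "norm (\<Sum>i\<in>I. star (X k i - X m i) * (X k i - X m i)) \<le> (hnorm ell2 (X k - X m))\<^sup>2"
          using ell2_norm_sum_le[OF ell2_diff[OF X X] \<open>finite I\<close>, of k m] by simp
        also have "\<dots> \<le> e\<^sup>2"
          using M that \<open>k \<ge> M\<close> by (intro power_mono) (auto simp: hnorm_def less_imp_le)
        finally show ?thesis .
      qed
      then show "\<exists>N. \<forall>m\<ge>N. norm (\<Sum>i\<in>I. star (X k i - X m i) * (X k i - X m i)) \<le> e\<^sup>2" by blast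
    qed
    then show ?thesis by blast
  qed
  have lc: "l \<in> car ell2"
    unfolding ell2_car summable_Cauchy
  proof (intro allI impI)
    fix e :: real assume "e > 0"
    \<comment> \<open>The \<open>parallelogram_bound\<close> doubles both parts, so each is allowed
      \<open>e / 4\<close>.\<close>
    define d where "d = sqrt (e / 4)"
    have d: "d > 0" "d\<^sup>2 = e / 4" using \<open>e > 0\<close> by (auto simp: d_def)
    obtain k where k: "\<And>I. finite I \<Longrightarrow> norm (\<Sum>i\<in>I. star (X k i - l i) * (X k i - l i)) \<le> e / 4"
      using block[OF d(1)] d(2) by auto
    have "e / 4 > 0" using \<open>e > 0\<close> by simp
    then obtain N where N: "\<And>m n. m \<ge> N \<Longrightarrow> norm (\<Sum>i=m..<n. star (X k i) * X k i) < e / 4"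
      using X[of k] unfolding ell2_car summable_Cauchy by blast
    have "norm (\<Sum>i=m..<n. star (l i) * l i) < e" if "m \<ge> N" for m n
    proof -
      let ?I = "{m..<n}"
      have "norm (\<Sum>i\<in>?I. star (l i) * l i) \<le> norm (\<Sum>i\<in>?I.
          2 *\<^sub>R (star (l i - X k i) * (l i - X k i)) + 2 *\<^sub>R (star (X k i) * X k i))"
      proof (rule norm_cpos_mono)
        show "(\<Sum>i\<in>?I. star (l i) * l i) \<in> cpos" by (intro cpos_sum star_mult_self_cpos)
        have "2 *\<^sub>R (star (l i - X k i) * (l i - X k i)) + 2 *\<^sub>R (star (X k i) * X k i) - star (l i) * l i \<in> cpos" for i
          using parallelogram_bound[of "l i - X k i" "X k i"] by simp
        then show "(\<Sum>i\<in>?I. 2 *\<^sub>R (star (l i - X k i) * (l i - X k i)) + 2 *\<^sub>R (star (X k i) * X k i))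
            - (\<Sum>i\<in>?I. star (l i) * l i) \<in> cpos"
          unfolding sum_subtractf[symmetric] by (rule cpos_sum)
      qed
      also have "\<dots> = norm (2 *\<^sub>R (\<Sum>i\<in>?I. star (X k i - l i) * (X k i - l i)) + 2 *\<^sub>R (\<Sum>i\<in>?I. star (X k i) * X k i))"
        unfolding star_diff_mult_commute[of "l _"] by (simp add: sum.distrib scaleR_right.sum)
      also have "\<dots> \<le> 2 * (e / 4) + 2 * norm (\<Sum>i\<in>?I. star (X k i) * X k i)"
        by (rule norm_triangle_mono) (use k[of ?I] in auto)
      also have "\<dots> < e" using N[OF that, of n] by simp
      finally show ?thesis .
    qed
    then show "\<exists>N. \<forall>m\<ge>N. \<forall>n. norm (\<Sum>i=m..<n. star (l i) * l i) < e" by blast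
  qed
  have "(\<lambda>n. hnorm ell2 (X n - l)) \<longlonglongrightarrow> 0"
  proof (rule LIMSEQ_I)
    fix e :: real assume "e > 0"
    then obtain M where M: "\<forall>k\<ge>M. \<forall>I. finite I \<longrightarrow> norm (\<Sum>i\<in>I. star (X k i - l i) * (X k i - l i)) \<le> (e / 2)\<^sup>2"
      using block[of "e / 2"] by auto
    have "hnorm ell2 (X k - l) \<le> e / 2" if "k \<ge> M" for k
      by (rule ell2_hnorm_le) (use M that \<open>e > 0\<close> ell2_diff[OF X lc] in auto)
    then show "\<exists>N. \<forall>n\<ge>N. norm (hnorm ell2 (X n - l) - 0) < e"
      using \<open>e > 0\<close> by (intro exI[of _ M]) (force simp: hnorm_def)
  qed
  with lc show ?thesis by blast
qed

lemma hilbert_ell2: "hilbert_module (ell2 :: (nat \<Rightarrow> 'a::cstar_algebra, 'a) hmod)"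
proof
  fix x y z :: "nat \<Rightarrow> 'a" and a b :: 'a
  assume x: "x \<in> car ell2"
  show "act ell2 x 1 = x" "act ell2 (act ell2 x a) b = act ell2 x (a * b)"
    "act ell2 x (a + b) = act ell2 x a + act ell2 x b" "act ell2 x a \<in> car ell2"
    using ell2_mult_right[OF x] by (auto simp: ell2_act mult.assoc algebra_simps fun_eq_iff)
  show "ip ell2 x x \<in> cpos"
    unfolding ell2_ip by (rule suminf_cpos) (use x in \<open>auto simp: star_mult_self_cpos ell2_car\<close>)
  show "x = 0" if "ip ell2 x x = 0"
  proof
    fix n have "norm (x n) \<le> hnorm ell2 x" using x by (rule ell2_component_le)
    then show "x n = 0 n" using that by (simp add: hnorm_def)
  qed
  assume y: "y \<in> car ell2"
  show "x + y \<in> car ell2" using x y by (rule ell2_add)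
  show "act ell2 (x + y) a = act ell2 x a + act ell2 y a"
    by (auto simp: ell2_act algebra_simps)
  show "ip ell2 x (act ell2 y a) = ip ell2 x y * a"
    using suminf_mult2[OF ell2_summable_ip[OF x y], of a] by (simp add: ell2_ip ell2_act mult.assoc)
  show "star (ip ell2 x y) = ip ell2 y x"
    using bounded_linear.suminf[OF bounded_linear_star ell2_summable_ip[OF x y]]
    by (simp add: ell2_ip star_mult star_star)
  assume z: "z \<in> car ell2"
  show "ip ell2 x (y + z) = ip ell2 x y + ip ell2 x z"
    using suminf_add[OF ell2_summable_ip[OF x y] ell2_summable_ip[OF x z]]
    by (simp add: ell2_ip distrib_left)
qed (fact ell2_zero, rule ell2_complete)

section \<open>Orthogonal sums and closed submodules as Hilbert modules\<close>

lemma osum_simps [simp]: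
  "car (H \<oplus>\<^sub>H K) = car H \<times> car K"
  "ip (H \<oplus>\<^sub>H K) u v = ip H (fst u) (fst v) + ip K (snd u) (snd v)"
  "act (H \<oplus>\<^sub>H K) u a = (act H (fst u) a, act K (snd u) a)"
  by (auto simp: osum_def)

lemma restr_simps [simp]:
  "car (restr H M) = M" "ip (restr H M) = ip H" "act (restr H M) = act H" "hnorm (restr H M) = hnorm H"
  by (auto simp: restr_def hnorm_def fun_eq_iff)

lemma closed_submodule_car: "closed_submodule H M \<Longrightarrow> x \<in> M \<Longrightarrow> x \<in> car H"
  by (auto simp: closed_submodule_def)

lemma (in hilbert_module) hilbert_restr:
  assumes M: "closed_submodule H M"
  shows "hilbert_module (restr H M)"
proof
  fix X :: "nat \<Rightarrow> 'm"
  assume X: "\<And>n. X n \<in> car (restr H M)"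
    "\<forall>e>0. \<exists>N. \<forall>m\<ge>N. \<forall>n\<ge>N. hnorm (restr H M) (X m - X n) < e"
  then have XM: "\<And>n. X n \<in> M" and "\<And>n. X n \<in> car H" using closed_submodule_car[OF M] by auto
  then obtain l where l: "l \<in> car H" "(\<lambda>n. hnorm H (X n - l)) \<longlonglongrightarrow> 0"
    using complete[of X] X by auto
  then have "l \<in> M" using M XM unfolding closed_submodule_def by blast
  then show "\<exists>l\<in>car (restr H M). (\<lambda>n. hnorm (restr H M) (X n - l)) \<longlonglongrightarrow> 0" using l by auto
qed (use M closed_submodule_car[OF M] in \<open>auto simp: closed_submodule_def act_one act_act act_add_left
  act_add_right ip_add_right ip_act_right star_ip ip_cpos ip_definite\<close>)

context hilbert_module_pair
begin

text \<open>The norm on the orthogonal sum comes from a sum of algebra elements and is not the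
  Euclidean combination of the two norms, so it is only compared with the norms of the
  coordinates.\<close>

lemma hnorm_osum_le:
  assumes "u \<in> car H \<times> car K"
  shows "hnorm (H \<oplus>\<^sub>H K) u \<le> hnorm H (fst u) + hnorm K (snd u)"
proof -
  have "(hnorm (H \<oplus>\<^sub>H K) u)\<^sup>2 \<le> (hnorm H (fst u))\<^sup>2 + (hnorm K (snd u))\<^sup>2"
    by (simp add: hnorm_def norm_triangle_ineq)
  also have "\<dots> \<le> (hnorm H (fst u) + hnorm K (snd u))\<^sup>2" by (simp add: power2_sum)
  finally show ?thesis by (rule power2_le_imp_le) simp
qed

lemma hnorm_osum_ge:
  assumes "u \<in> car H \<times> car K"
  shows "hnorm H (fst u) \<le> hnorm (H \<oplus>\<^sub>H K) u" "hnorm K (snd u) \<le> hnorm (H \<oplus>\<^sub>H K) u"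
  using assms unfolding hnorm_def
  by (auto intro!: norm_cpos_mono simp: H.ip_cpos K.ip_cpos)

lemma hilbert_osum: "hilbert_module (H \<oplus>\<^sub>H K)"
proof
  fix x assume x: "x \<in> car (H \<oplus>\<^sub>H K)" and 0: "ip (H \<oplus>\<^sub>H K) x x = 0"
  then have "hnorm H (fst x) = 0" "hnorm K (snd x) = 0"
    using hnorm_osum_ge[of x] by (auto simp: hnorm_def order_antisym)
  then show "x = 0" using x by (auto simp: H.hnorm_eq_0 K.hnorm_eq_0 zero_prod_def)
next
  fix X :: "nat \<Rightarrow> 'm \<times> 'n"
  assume X: "\<And>n. X n \<in> car (H \<oplus>\<^sub>H K)"
    "\<forall>e>0. \<exists>N. \<forall>m\<ge>N. \<forall>n\<ge>N. hnorm (H \<oplus>\<^sub>H K) (X m - X n) < e"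
  have c: "fst (X n) \<in> car H" "snd (X n) \<in> car K" for n using X(1)[of n] by auto
  have d: "X m - X n \<in> car H \<times> car K" for m n using c by (auto simp: mem_Times_iff)
  have "\<forall>e>0. \<exists>N. \<forall>m\<ge>N. \<forall>n\<ge>N. hnorm H (fst (X m) - fst (X n)) < e"
    "\<forall>e>0. \<exists>N. \<forall>m\<ge>N. \<forall>n\<ge>N. hnorm K (snd (X m) - snd (X n)) < e"
    using hnorm_osum_ge[OF d] X(2) order_le_less_trans unfolding fst_diff snd_diff by meson+
  then obtain l k where l: "l \<in> car H" "(\<lambda>n. hnorm H (fst (X n) - l)) \<longlonglongrightarrow> 0"
    and k: "k \<in> car K" "(\<lambda>n. hnorm K (snd (X n) - k)) \<longlonglongrightarrow> 0"
    using H.complete[of "\<lambda>n. fst (X n)"] K.complete[of "\<lambda>n. snd (X n)"] c by blast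
  have "(\<lambda>n. hnorm (H \<oplus>\<^sub>H K) (X n - (l, k))) \<longlonglongrightarrow> 0"
  proof (rule tendsto_zero_bound)
    show "(\<lambda>n. hnorm H (fst (X n) - l) + hnorm K (snd (X n) - k)) \<longlonglongrightarrow> 0"
      using tendsto_add[OF l(2) k(2)] by simp
    show "hnorm (H \<oplus>\<^sub>H K) (X n - (l, k)) \<le> hnorm H (fst (X n) - l) + hnorm K (snd (X n) - k)" for n
      using hnorm_osum_le[of "X n - (l, k)"] c l k by (auto simp: mem_Times_iff)
  qed (simp add: hnorm_def)
  with l k show "\<exists>l\<in>car (H \<oplus>\<^sub>H K). (\<lambda>n. hnorm (H \<oplus>\<^sub>H K) (X n - l)) \<longlonglongrightarrow> 0"
    by (intro bexI[of _ "(l, k)"]) auto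
qed (auto simp: zero_prod_def H.act_one K.act_one H.act_act K.act_act H.act_add_left K.act_add_left
  H.act_add_right K.act_add_right H.ip_add_right K.ip_add_right H.ip_act_right K.ip_act_right
  algebra_simps star_add H.star_ip K.star_ip intro!: cpos_add H.ip_cpos K.ip_cpos)

end

section \<open>Gram operators and frames of finitely generated modules\<close>

lemma (in hilbert_module) ip_nondegenerate:
  assumes "u \<in> car H" "v \<in> car H" "\<And>x. x \<in> car H \<Longrightarrow> ip H x u = ip H x v"
  shows "u = v"
proof -
  have "ip H (u - v) (u - v) = 0" using assms by (simp add: ip_diff_right)
  then have "u - v = 0" using assms by (intro ip_definite) auto
  then show ?thesis by simp
qed

lemma (in hilbert_module) bmm_act_center:
  assumes "\<alpha> \<in> center"
  shows "bounded_module_map H H (\<lambda>x. act H x \<alpha>)"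
  by (rule bmmI[where B = "norm \<alpha>"])
    (use assms in \<open>auto simp: act_add_left act_act center_def hnorm_act_le mult.commute[of "norm \<alpha>"]\<close>)

lemma of_real_center: "of_real t \<in> center"
  by (simp add: center_def of_real_def)

context hilbert_module_pair
begin

text \<open>Membership in \<open>B\<^sup>a\<close> only provides some function \<open>S\<close>.
  Nondegeneracy of the inner product makes it linear, and Cauchy-Schwarz for
  \<open>ip K (T (S x)) x\<close> makes it bounded.\<close>

lemma adjoint_bmm:
  assumes T: "bounded_module_map H K T" and S: "\<And>y. y \<in> car K \<Longrightarrow> S y \<in> car H"
    and adj: "\<And>x y. x \<in> car H \<Longrightarrow> y \<in> car K \<Longrightarrow> ip K (T x) y = ip H x (S y)"
  shows "bounded_module_map K H S"
proof -
  obtain B where B: "B > 0" "\<And>x. x \<in> car H \<Longrightarrow> hnorm K (T x) \<le> B * hnorm H x" using bmm_bound[OF T] by metis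
  show ?thesis
  proof (rule bmmI)
    fix x y a assume x: "x \<in> car K" and y: "y \<in> car K"
    show "S (x + y) = S x + S y"
      by (rule H.ip_nondegenerate)
        (use x y S in \<open>auto simp: H.ip_add_right K.ip_add_right bmm_closed[OF T] simp flip: adj\<close>)
  next
    fix x a assume x: "x \<in> car K"
    show "S (act K x a) = act H (S x) a"
      by (rule H.ip_nondegenerate)
        (use x S in \<open>auto simp: H.ip_act_right K.ip_act_right bmm_closed[OF T] simp flip: adj\<close>)
    have "(hnorm H (S x))\<^sup>2 = norm (ip K (T (S x)) x)" using x S by (simp add: H.hnorm_square adj)
    also have "\<dots> \<le> hnorm K (T (S x)) * hnorm K x"
      using x S by (intro K.Cauchy_Schwarz bmm_closed[OF T]) auto
    also have "\<dots> \<le> (B * hnorm H (S x)) * hnorm K x"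
      using x S by (intro mult_right_mono B) auto
    finally have "hnorm H (S x) * hnorm H (S x) \<le> hnorm H (S x) * (B * hnorm K x)"
      by (simp add: power2_eq_square mult_ac)
    then show "hnorm H (S x) \<le> B * hnorm K x"
      using H.hnorm_nonneg[of "S x"] B(1) by (cases "hnorm H (S x) = 0") auto
  qed (use S in auto)
qed

lemma bijection_inverse:
  assumes T: "bounded_module_map H K T" and bij: "bij_betw T (car H) (car K)"
    and bd: "\<And>x. x \<in> car H \<Longrightarrow> hnorm H x \<le> C * hnorm K (T x)"
  obtains V where "bounded_module_map K H V" "\<And>x. x \<in> car H \<Longrightarrow> V (T x) = x" "\<And>y. y \<in> car K \<Longrightarrow> T (V y) = y"
proof -
  define V where "V = inv_into (car H) T"
  have VT: "V (T x) = x" if "x \<in> car H" for x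
    using that bij by (simp add: V_def bij_betw_def)
  have TV: "T (V y) = y" if "y \<in> car K" for y
    using that bij by (simp add: V_def bij_betw_def f_inv_into_f)
  have V: "V y \<in> car H" if "y \<in> car K" for y
    using that bij unfolding V_def by (metis bij_betw_def inv_into_into)
  have "bounded_module_map K H V"
  proof (rule bmmI)
    fix x y a assume x: "x \<in> car K" and y: "y \<in> car K"
    have "V (x + y) = V (T (V x + V y))" using x y by (simp add: bmm_add[OF T] V TV)
    then show "V (x + y) = V x + V y" using x y by (simp add: VT V)
  next
    fix x a assume x: "x \<in> car K"
    have "V (act K x a) = V (T (act H (V x) a))" using x by (simp add: bmm_act[OF T] V TV)
    then show "V (act K x a) = act H (V x) a" using x by (simp add: VT V)
    show "hnorm H (V x) \<le> C * hnorm K x" using bd[OF V[OF x]] x by (simp add: TV)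
  qed (rule V)
  with VT TV that show ?thesis by blast
qed

lemma isomorphismI:
  assumes T: "bounded_module_map H K T" and V: "bounded_module_map K H V"
    and "\<And>x. x \<in> car H \<Longrightarrow> V (T x) = x" "\<And>y. y \<in> car K \<Longrightarrow> T (V y) = y"
  shows "isomorphism H K T"
proof -
  have bij: "bij_betw T (car H) (car K)"
    by (rule bij_betwI[where g = V]) (use assms bmm_closed[OF T] bmm_closed[OF V] in auto)
  have "inv_into (car H) T y = V y" if "y \<in> car K" for y
    by (rule inv_into_f_eq) (use bij that assms(4) bmm_closed[OF V] in \<open>auto simp: bij_betw_def\<close>)
  then have "bounded_between K H (inv_into (car H) T)"
    using V by (simp add: bounded_module_map_def bounded_between_def)
  with T bij show ?thesis by (simp add: isomorphism_def)
qed

lemma isomorphism_inverse: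
  assumes "isomorphism H K T"
  obtains V where "bounded_module_map K H V" "\<And>x. x \<in> car H \<Longrightarrow> V (T x) = x" "\<And>y. y \<in> car K \<Longrightarrow> T (V y) = y"
proof -
  have T: "bounded_module_map H K T" and bij: "bij_betw T (car H) (car K)" using assms by (auto simp: isomorphism_def)
  obtain C where C: "\<And>y. y \<in> car K \<Longrightarrow> hnorm H (inv_into (car H) T y) \<le> C * hnorm K y"
    using assms by (auto simp: isomorphism_def bounded_between_def)
  have "hnorm H x \<le> C * hnorm K (T x)" if "x \<in> car H" for x
    using C[of "T x"] that bij bmm_closed[OF T that] by (simp add: bij_betw_def)
  with T bij that show ?thesis using bijection_inverse by metis
qed

text \<open>The Gram operator \<open>P = S \<circ> T\<close> of an adjointable operator bounded below is invertible: \<open>P + t\<close> is bounded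
  below uniformly in \<open>t \<ge> 0\<close>, and it is surjective for large \<open>t\<close>, so surjectivity propagates down to \<open>t = 0\<close>
  in steps of constant length.\<close>

theorem gram_inverse:
  assumes T: "bounded_module_map H K T" and S: "\<And>y. y \<in> car K \<Longrightarrow> S y \<in> car H"
    and adj: "\<And>x y. x \<in> car H \<Longrightarrow> y \<in> car K \<Longrightarrow> ip K (T x) y = ip H x (S y)"
    and c: "c > 0" and below: "\<And>x. x \<in> car H \<Longrightarrow> c * hnorm H x \<le> hnorm K (T x)"
  obtains V where "bounded_module_map H H V" "\<And>x. x \<in> car H \<Longrightarrow> V (S (T x)) = x"
    "\<And>y. y \<in> car H \<Longrightarrow> S (T (V y)) = y"
proof -
  interpret HH: hilbert_module_pair H H ..
  define P where "P x = S (T x)" for x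
  have "bounded_module_map K H S" by (rule adjoint_bmm[OF T S adj])
  then have P: "bounded_module_map H H P" unfolding P_def by (rule bmm_compose[OF _ T])
  obtain B where B: "B > 0" "\<And>x. x \<in> car H \<Longrightarrow> hnorm H (P x) \<le> B * hnorm H x" using bmm_bound[OF P] by metis
  have ipP: "ip H x (P y) = ip K (T x) (T y)" if "x \<in> car H" "y \<in> car H" for x y
    using that by (simp add: P_def adj bmm_closed[OF T])
  have ipP': "ip H (P x) y = ip K (T x) (T y)" if "x \<in> car H" "y \<in> car H" for x y
    using that H.star_ip[of y "P x"] by (simp add: ipP bmm_closed[OF P] bmm_closed[OF T] K.star_ip)
  have Pbelow: "c\<^sup>2 * hnorm H x \<le> hnorm H (P x)" if x: "x \<in> car H" for x
  proof (cases "hnorm H x = 0")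
    case False
    have "(c * hnorm H x)\<^sup>2 \<le> (hnorm K (T x))\<^sup>2" using below[OF x] c by (intro power_mono) auto
    also have "\<dots> = norm (ip H x (P x))" using x by (simp add: K.hnorm_square ipP)
    also have "\<dots> \<le> hnorm H x * hnorm H (P x)" using x by (intro H.Cauchy_Schwarz bmm_closed[OF P])
    finally have "hnorm H x * (c\<^sup>2 * hnorm H x) \<le> hnorm H x * hnorm H (P x)"
      by (simp add: power_mult_distrib power2_eq_square mult_ac)
    moreover have "hnorm H x > 0" using False H.hnorm_nonneg[of x] by linarith
    ultimately show ?thesis by (simp only: mult_le_cancel_left_pos)
  qed simp
  define Q where "Q t x = P x + act H x (of_real t)" for t x
  have Q: "bounded_module_map H H (Q t)" for t
    unfolding Q_def by (intro HH.bmm_plus P H.bmm_act_center of_real_center)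
  \<comment> \<open>Expanding \<open>ip H (Q t x) (Q t x)\<close>, the parameter \<open>t\<close>
    contributes only positive terms, so the lower bound for \<open>P\<close> holds for all
    \<open>Q t\<close> with the same constant.\<close>
  have Qbelow: "c\<^sup>2 * hnorm H x \<le> hnorm H (Q t x)" if x: "x \<in> car H" and t: "t \<ge> 0" for t x
  proof -
    have "(2 * t) *\<^sub>R ip K (T x) (T x) = t *\<^sub>R ip K (T x) (T x) + t *\<^sub>R ip K (T x) (T x)"
      by (simp flip: scaleR_add_left)
    then have "ip H (Q t x) (Q t x) - ip H (P x) (P x) = (2 * t) *\<^sub>R ip K (T x) (T x) + (t * t) *\<^sub>R ip H x x"
      using x ipP[OF x x] ipP'[OF x x]
      by (simp add: Q_def H.ip_add_left H.ip_add_right H.ip_act_left H.ip_act_right bmm_closed[OF P]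
          of_real_def algebra_simps)
    also have "\<dots> \<in> cpos" using x t by (intro cpos_add cpos_scaleR H.ip_cpos K.ip_cpos bmm_closed[OF T]) auto
    finally have "hnorm H (P x) \<le> hnorm H (Q t x)"
      unfolding hnorm_def using x by (auto intro!: norm_cpos_mono H.ip_cpos bmm_closed[OF P])
    with Pbelow[OF x] show ?thesis by simp
  qed
  \<comment> \<open>For large \<open>t\<close> the multiple of the identity dominates:
    \<open>y / t\<close> is a solution up to the relative error
    \<open>B / t \<le> 1/2\<close>.\<close>
  have large: "\<exists>x\<in>car H. Q t x = y" if y: "y \<in> car H" and t: "t \<ge> 2 * B" for t y
  proof -
    have t0: "t > 0" using t B by linarith
    have "\<exists>x\<in>car H. hnorm H x \<le> (1 / t) * hnorm H y \<and> hnorm H (y - Q t x) \<le> (1/2) * hnorm H y"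
      if y: "y \<in> car H" for y
    proof (intro bexI conjI)
      let ?x = "act H y (of_real (1 / t))"
      show x: "?x \<in> car H" using y by simp
      show nx: "hnorm H ?x \<le> (1 / t) * hnorm H y" using y t0 by (simp only: H.hnorm_act_of_real) simp
      have "act H ?x (of_real t) = y" using y t0 by (simp add: H.act_act H.act_one flip: of_real_mult)
      then have "y - Q t ?x = - P ?x" by (simp add: Q_def)
      then have "hnorm H (y - Q t ?x) = hnorm H (P ?x)"
        using x by (simp add: bmm_closed[OF P] del: of_real_divide)
      also have "\<dots> \<le> B * ((1 / t) * hnorm H y)"
        using B(2)[OF x] nx B(1) by (meson mult_left_mono order_trans less_imp_le)
      also have "\<dots> = (B / t) * hnorm H y" by simp
      also have "\<dots> \<le> (1/2) * hnorm H y" using t t0 by (intro mult_right_mono) (auto simp: divide_simps)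
      finally show "hnorm H (y - Q t ?x) \<le> (1/2) * hnorm H y" .
    qed
    then obtain x where "x \<in> car H" "Q t x = y"
      using HH.approximate_surjection[OF Q[of t] _ _ _ y, where q = "1/2" and C = "1 / t"] by auto
    then show ?thesis by blast
  qed
  \<comment> \<open>Solutions satisfy \<open>c\<^sup>2 * hnorm H x \<le> hnorm H y\<close>, so
    moving \<open>t\<close> by at most \<open>d\<close> spoils a solution by at most half of
    \<open>hnorm H y\<close>. The admissible step does not depend on \<open>t\<close>.\<close>
  define d where "d = c\<^sup>2 / 2"
  have d: "d > 0" using c by (simp add: d_def)
  have step: "\<exists>x\<in>car H. Q s x = y"
    if surj: "\<And>y. y \<in> car H \<Longrightarrow> \<exists>x\<in>car H. Q t x = y" and st: "s \<ge> 0" "s \<le> t" "t \<le> s + d" and y: "y \<in> car H"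
    for s t y
  proof -
    have "\<exists>x\<in>car H. hnorm H x \<le> (1 / c\<^sup>2) * hnorm H y \<and> hnorm H (y - Q s x) \<le> (1/2) * hnorm H y"
      if y: "y \<in> car H" for y
    proof -
      obtain x where x: "x \<in> car H" "Q t x = y" using surj[OF y] by blast
      have "c\<^sup>2 * hnorm H x \<le> hnorm H y" using Qbelow[OF x(1), of t] st x by simp
      then have nx: "hnorm H x \<le> (1 / c\<^sup>2) * hnorm H y" using c by (simp add: field_simps)
      have "act H x (of_real t) = act H x (of_real s) + act H x (of_real (t - s))"
        using x by (simp flip: H.act_add_right of_real_add)
      then have "y - Q s x = act H x (of_real (t - s))" unfolding x(2)[symmetric] Q_def by simp
      then have "hnorm H (y - Q s x) = (t - s) * hnorm H x"
        using x st by (simp add: H.hnorm_act_of_real del: of_real_diff)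
      also have "\<dots> \<le> d * ((1 / c\<^sup>2) * hnorm H y)" using st nx by (intro mult_mono) auto
      also have "\<dots> = (1/2) * hnorm H y" using c by (simp add: d_def)
      finally show ?thesis using x nx by blast
    qed
    then obtain x where "x \<in> car H" "Q s x = y"
      using HH.approximate_surjection[OF Q[of s] _ _ _ y, where q = "1/2" and C = "1 / c\<^sup>2"] by auto
    then show ?thesis by blast
  qed
  \<comment> \<open>Each round lowers the threshold for surjectivity by \<open>d\<close>; finitely
    many rounds reach \<open>t = 0\<close>, where \<open>Q 0\<close> agrees with
    \<open>P\<close>.\<close>
  have all: "\<forall>t\<ge>0. t \<ge> 2 * B - real n * d \<longrightarrow> (\<forall>y\<in>car H. \<exists>x\<in>car H. Q t x = y)" for n
  proof (induction n)
    case (Suc n)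
    show ?case
    proof (intro allI impI ballI)
      fix t y assume t: "t \<ge> 0" "t \<ge> 2 * B - real (Suc n) * d" and y: "y \<in> car H"
      have "t + d \<ge> 2 * B - real n * d" "t + d \<ge> 0" using t d by (auto simp: algebra_simps)
      then show "\<exists>x\<in>car H. Q t x = y" using Suc t d y by (intro step[of "t + d" t y]) auto
    qed
  qed (use large in auto)
  obtain n where "2 * B \<le> real n * d" using real_arch_simple[of "2 * B / d"] d by (auto simp: field_simps)
  then have "\<forall>y\<in>car H. \<exists>x\<in>car H. Q 0 x = y" using all[of n] by simp
  then have surj: "P ` car H = car H" by (auto simp: Q_def bmm_closed[OF P] image_iff)
  have "inj_on P (car H)"
  proof (rule inj_onI)
    fix x y assume xy: "x \<in> car H" "y \<in> car H" "P x = P y"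
    then have "c\<^sup>2 * hnorm H (x - y) \<le> 0" using Pbelow[of "x - y"] by (simp add: HH.bmm_diff[OF P])
    then have "hnorm H (x - y) = 0" using c H.hnorm_nonneg[of "x - y"] by (simp add: mult_le_0_iff)
    then have "x - y = 0" using xy by (subst (asm) H.hnorm_eq_0) auto
    then show "x = y" by simp
  qed
  then have "bij_betw P (car H) (car H)" using surj by (simp add: bij_betw_def)
  moreover have "hnorm H x \<le> (1 / c\<^sup>2) * hnorm H (P x)" if "x \<in> car H" for x
    using Pbelow[OF that] c by (simp add: field_simps)
  ultimately obtain V where "bounded_module_map H H V" "\<And>x. x \<in> car H \<Longrightarrow> V (P x) = x" "\<And>y. y \<in> car H \<Longrightarrow> P (V y) = y"
    using HH.bijection_inverse[OF P] by metis
  with that show ?thesis unfolding P_def by blast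
qed

end

text \<open>Allows generators indexed with repetitions, where the definition uses a set:
  coefficients of equal generators are added up.\<close>

lemma finitely_generatedI:
  assumes H: "hilbert_module H" and I: "finite I" and s: "\<And>i. i \<in> I \<Longrightarrow> s i \<in> car H"
    and gen: "\<And>x. x \<in> car H \<Longrightarrow> \<exists>a. x = (\<Sum>i\<in>I. act H (s i) (a i))"
  shows "finitely_generated H"
  unfolding finitely_generated_def
proof (intro exI conjI)
  interpret hilbert_module H by (rule H)
  show "finite (s ` I)" "s ` I \<subseteq> car H" using I s by auto
  have act_sum_right: "act H x (sum a J) = (\<Sum>j\<in>J. act H x (a j))" if "x \<in> car H" for x a and J :: "'c set"
    by (induction J rule: infinite_finite_induct) (auto simp: that act_add_right)
  show "car H = {\<Sum>\<sigma>\<in>s ` I. act H \<sigma> (a \<sigma>) |a. True}"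
  proof (intro equalityI subsetI)
    fix x assume "x \<in> car H"
    then obtain a where a: "x = (\<Sum>i\<in>I. act H (s i) (a i))" using gen by blast
    also have "\<dots> = (\<Sum>\<sigma>\<in>s ` I. \<Sum>i\<in>{i\<in>I. s i = \<sigma>}. act H (s i) (a i))" by (rule sum.image_gen[OF I])
    also have "\<dots> = (\<Sum>\<sigma>\<in>s ` I. act H \<sigma> (\<Sum>i\<in>{i\<in>I. s i = \<sigma>}. a i))"
      by (intro sum.cong refl) (use s in \<open>auto simp: act_sum_right\<close>)
    finally have "x = (\<Sum>\<sigma>\<in>s ` I. act H \<sigma> (\<Sum>i\<in>{i\<in>I. s i = \<sigma>}. a i))" .
    then show "x \<in> {\<Sum>\<sigma>\<in>s ` I. act H \<sigma> (a \<sigma>) |a. True}"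
      by (intro CollectI exI conjI TrueI)
  qed (use s in \<open>auto intro!: sum_closed\<close>)
qed

lemma finitely_generated_image:
  assumes K: "hilbert_module K" and fg: "finitely_generated H" and surj: "T ` car H = car K"
    and H: "hilbert_module H" and T: "bounded_module_map H K T"
  shows "finitely_generated K"
proof -
  interpret hilbert_module_pair H K using H K by (simp add: hilbert_module_pair_def)
  obtain S where S: "finite S" "S \<subseteq> car H" "car H = {(\<Sum>s\<in>S. act H s (a s)) | a. True}"
    using fg unfolding finitely_generated_def by blast
  show ?thesis
  proof (rule finitely_generatedI[OF K S(1)])
    fix y assume "y \<in> car K"
    then obtain x where "x \<in> car H" "y = T x" using surj by blast
    moreover from this obtain a where "x = (\<Sum>s\<in>S. act H s (a s))" using S(3) by blast
    ultimately have "y = (\<Sum>s\<in>S. act K (T s) (a s))"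
      using S(2) by (simp add: bmm_sum[OF T] subset_iff bmm_act[OF T])
    then show "\<exists>a. y = (\<Sum>s\<in>S. act K (T s) (a s))" by blast
  qed (use S(2) bmm_closed[OF T] in auto)
qed

lemma (in hilbert_module_pair) finitely_generated_osum:
  assumes "finitely_generated H" "finitely_generated K"
  shows "finitely_generated (H \<oplus>\<^sub>H K)"
proof -
  obtain S where S: "finite S" "S \<subseteq> car H" "car H = {(\<Sum>s\<in>S. act H s (a s)) | a. True}"
    using assms(1) unfolding finitely_generated_def by blast
  obtain R where R: "finite R" "R \<subseteq> car K" "car K = {(\<Sum>s\<in>R. act K s (a s)) | a. True}"
    using assms(2) unfolding finitely_generated_def by blast
  let ?s = "case_sum (\<lambda>s. (s, 0)) (\<lambda>r. (0, r))"
  show ?thesis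
  proof (rule finitely_generatedI[OF hilbert_osum])
    show "finite (S <+> R)" using S R by simp
    show "?s i \<in> car (H \<oplus>\<^sub>H K)" if "i \<in> S <+> R" for i using that S(2) R(2) by auto
    fix u assume "u \<in> car (H \<oplus>\<^sub>H K)"
    then have "fst u \<in> car H" "snd u \<in> car K" by auto
    then obtain a b where a: "fst u = (\<Sum>s\<in>S. act H s (a s))" and b: "snd u = (\<Sum>r\<in>R. act K r (b r))"
      using S(3) R(3) by blast
    have "(\<Sum>i\<in>S <+> R. act (H \<oplus>\<^sub>H K) (?s i) (case_sum a b i))
        = (\<Sum>s\<in>S. (act H s (a s), 0)) + (\<Sum>r\<in>R. (0, act K r (b r)))"
      using S(1) R(1) by (simp add: sum.Plus)
    also have "\<dots> = u"
      by (simp add: sum_prod prod_eq_iff a b fst_sum snd_sum)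
    finally show "\<exists>c. u = (\<Sum>i\<in>S <+> R. act (H \<oplus>\<^sub>H K) (?s i) (c i))" by metis
  qed
qed

text \<open>The generators give a surjection of \<open>ell2\<close> onto \<open>H\<close>, whose adjoint is bounded below by the open
  mapping theorem; the frame comes from the inverse of the Gram operator of this adjoint.\<close>

theorem finitely_generated_frame:
  fixes H :: "('m::ab_group_add, 'a::cstar_algebra) hmod"
  assumes H: "hilbert_module H" and fg: "finitely_generated H"
  obtains k and s w :: "nat \<Rightarrow> 'm"
  where "\<And>i. i < k \<Longrightarrow> s i \<in> car H" "\<And>i. i < k \<Longrightarrow> w i \<in> car H"
    "\<And>y. y \<in> car H \<Longrightarrow> y = (\<Sum>i<k. act H (s i) (ip H (w i) y))"
proof -
  obtain S where S: "finite S" "S \<subseteq> car H" "car H = {(\<Sum>s\<in>S. act H s (a s)) | a. True}"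
    using fg unfolding finitely_generated_def by blast
  define k where "k = card S"
  obtain s where s: "bij_betw s {..<k} S"
    using ex_bij_betw_nat_finite[OF S(1)] by (auto simp: k_def lessThan_atLeast0)
  have sc: "s i \<in> car H" if "i < k" for i using s S(2) that by (auto simp: bij_betw_def)
  interpret A: hilbert_module "ell2 :: (nat \<Rightarrow> 'a, 'a) hmod" by (rule hilbert_ell2)
  interpret AH: hilbert_module_pair "ell2 :: (nat \<Rightarrow> 'a, 'a) hmod" H
    using H by (simp add: hilbert_module_pair_def hilbert_ell2)
  interpret HA: hilbert_module_pair H "ell2 :: (nat \<Rightarrow> 'a, 'a) hmod" ..
  \<comment> \<open>Only the first \<open>k\<close> coordinates matter; with \<open>ell2\<close> as
    the source, in place of \<open>k\<close> copies of the algebra, the Hilbert module structure is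
    already at hand.\<close>
  define T where "T x = (\<Sum>i<k. act H (s i) (x i))" for x :: "nat \<Rightarrow> 'a"
  have T: "bounded_module_map ell2 H T"
  proof (rule bmmI)
    fix x y :: "nat \<Rightarrow> 'a" and a
    show "T x \<in> car H" using sc by (auto simp: T_def intro!: AH.K.sum_closed)
    show "T (x + y) = T x + T y"
      using sc by (simp add: T_def AH.K.act_add_right sum.distrib)
    show "T (act ell2 x a) = act H (T x) a"
      unfolding T_def using sc by (subst AH.K.act_sum) (auto simp: ell2_act AH.K.act_act)
    assume x: "x \<in> car ell2"
    have "hnorm H (T x) \<le> (\<Sum>i<k. hnorm H (act H (s i) (x i)))"
      unfolding T_def using sc by (intro AH.K.hnorm_sum) auto
    also have "\<dots> \<le> (\<Sum>i<k. hnorm H (s i) * hnorm ell2 x)"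
    proof (rule sum_mono)
      fix i assume "i \<in> {..<k}"
      then have "hnorm H (act H (s i) (x i)) \<le> hnorm H (s i) * norm (x i)"
        using sc by (intro AH.K.hnorm_act_le) auto
      also have "\<dots> \<le> hnorm H (s i) * hnorm ell2 x"
        using x by (intro mult_left_mono ell2_component_le) auto
      finally show "hnorm H (act H (s i) (x i)) \<le> hnorm H (s i) * hnorm ell2 x" .
    qed
    finally show "hnorm H (T x) \<le> (\<Sum>i<k. hnorm H (s i)) * hnorm ell2 x" by (simp add: sum_distrib_right)
  qed
  have fin: "(\<lambda>i. if i < k then f i else 0) \<in> car ell2" for f :: "nat \<Rightarrow> 'a"
    unfolding ell2_car by (rule summable_finite[of "{..<k}"]) auto
  have surj: "T ` car ell2 = car H"
  proof (intro equalityI subsetI)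
    fix y assume "y \<in> car H"
    then obtain a where "y = (\<Sum>\<sigma>\<in>S. act H \<sigma> (a \<sigma>))" using S(3) by blast
    also have "\<dots> = (\<Sum>i<k. act H (s i) (a (s i)))" by (rule sum.reindex_bij_betw[OF s, symmetric])
    also have "\<dots> = T (\<lambda>i. if i < k then a (s i) else 0)" by (simp add: T_def)
    finally show "y \<in> T ` car ell2" by (rule image_eqI[OF _ fin])
  qed (use bmm_closed[OF T] in auto)
  \<comment> \<open>The adjoint of \<open>T\<close>: the inner products of \<open>y\<close> with the
    generators, padded with \<open>0\<close> from index \<open>k\<close> on.\<close>
  define R where "R y = (\<lambda>i. if i < k then ip H (s i) y else 0)" for y
  have R: "R y \<in> car ell2" for y unfolding R_def by (rule fin)
  have ipR: "ip ell2 x (R y) = ip H (T x) y" if x: "x \<in> car ell2" and y: "y \<in> car H" for x y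
  proof -
    have "ip ell2 x (R y) = (\<Sum>i<k. star (x i) * ip H (s i) y)"
      unfolding ell2_ip by (subst suminf_finite[of "{..<k}"]) (auto simp: R_def)
    also have "\<dots> = star (\<Sum>i<k. ip H y (s i) * x i)"
      using sc y by (simp add: star_sum star_mult AH.K.star_ip)
    also have "(\<Sum>i<k. ip H y (s i) * x i) = ip H y (T x)"
      unfolding T_def using sc y by (subst AH.K.ip_sum_right) (auto simp: AH.K.ip_act_right)
    finally show ?thesis using y bmm_closed[OF T x] by (simp add: AH.K.star_ip)
  qed
  have Rb: "bounded_module_map H ell2 R"
    by (rule AH.adjoint_bmm[OF T R]) (simp add: ipR)
  have adj: "ip ell2 (R y) x = ip H y (T x)" if "x \<in> car ell2" "y \<in> car H" for x y
    using arg_cong[OF ipR[OF that], of star] that by (simp add: A.star_ip R AH.K.star_ip bmm_closed[OF T])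
  obtain C where C: "C > 0" "\<And>y. y \<in> car H \<Longrightarrow> \<exists>x\<in>car ell2. T x = y \<and> hnorm ell2 x \<le> C * hnorm H y"
    using AH.open_mapping[OF T surj] by metis
  \<comment> \<open>For \<open>y = T x\<close> the squared norm of \<open>y\<close> is
    \<open>norm (ip ell2 (R y) x)\<close>, and the open mapping constant bounds \<open>x\<close> by
    \<open>y\<close>; one factor \<open>hnorm H y\<close> cancels.\<close>
  have below: "(1 / C) * hnorm H y \<le> hnorm ell2 (R y)" if y: "y \<in> car H" for y
  proof (cases "hnorm H y = 0")
    case False
    obtain x where x: "x \<in> car ell2" "T x = y" "hnorm ell2 x \<le> C * hnorm H y" using C(2)[OF y] by blast
    have "(hnorm H y)\<^sup>2 = norm (ip ell2 (R y) x)" using x y by (simp add: adj AH.K.hnorm_square)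
    also have "\<dots> \<le> hnorm ell2 (R y) * hnorm ell2 x" by (rule A.Cauchy_Schwarz[OF R x(1)])
    also have "\<dots> \<le> hnorm ell2 (R y) * (C * hnorm H y)" using x by (intro mult_left_mono) auto
    finally have "hnorm H y * hnorm H y \<le> hnorm H y * (C * hnorm ell2 (R y))"
      by (simp add: power2_eq_square mult_ac)
    moreover have "hnorm H y > 0" using False AH.K.hnorm_nonneg[of y] by linarith
    ultimately have "hnorm H y \<le> C * hnorm ell2 (R y)" by (simp only: mult_le_cancel_left_pos)
    then show ?thesis using C(1) by (simp add: field_simps)
  qed simp
  obtain V where V: "bounded_module_map H H V" and VG: "\<And>x. x \<in> car H \<Longrightarrow> V (T (R x)) = x"
    and GV: "\<And>y. y \<in> car H \<Longrightarrow> T (R (V y)) = y"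
    using HA.gram_inverse[OF Rb bmm_closed[OF T] adj _ below] C(1) by auto
  have Vc: "V y \<in> car H" if "y \<in> car H" for y by (rule bmm_closed[OF V that])
  \<comment> \<open>\<open>T \<circ> R\<close> is self-adjoint, hence so is its inverse. This moves
    \<open>V\<close> onto the generators, and the \<open>V (s i)\<close> form the canonical dual
    frame.\<close>
  have Vsym: "ip H x (V y) = ip H (V x) y" if x: "x \<in> car H" and y: "y \<in> car H" for x y
  proof -
    have "ip H (V x) y = ip H (V x) (T (R (V y)))" using y by (simp add: GV)
    also have "\<dots> = ip H (T (R (V x))) (V y)" using x y Vc R by (simp flip: adj add: ipR[symmetric])
    finally show ?thesis using x by (simp add: GV)
  qed
  show ?thesis
  proof (rule that[of k s "\<lambda>i. V (s i)"])
    fix y assume y: "y \<in> car H"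
    have "y = T (R (V y))" using y by (simp add: GV)
    also have "\<dots> = (\<Sum>i<k. act H (s i) (ip H (V (s i)) y))"
      unfolding T_def by (intro sum.cong refl) (use sc y in \<open>auto simp: R_def Vsym\<close>)
    finally show "y = (\<Sum>i<k. act H (s i) (ip H (V (s i)) y))" .
  qed (use sc Vc in auto)
qed

section \<open>Decompositions and semi-Fredholm operators\<close>

lemma bmm_restr_domain: "bounded_module_map H K T \<Longrightarrow> M \<subseteq> car H \<Longrightarrow> bounded_module_map (restr H M) K T"
  unfolding bounded_module_map_def bounded_between_def by (simp add: subset_iff Pi_iff) blast

lemma bmm_restr_codomain:
  "bounded_module_map H K T \<Longrightarrow> (\<And>x. x \<in> car H \<Longrightarrow> T x \<in> M) \<Longrightarrow> bounded_module_map H (restr K M) T"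
  by (auto simp: bounded_module_map_def bounded_between_def)

lemma bmm_extend_codomain:
  "bounded_module_map H (restr K M) T \<Longrightarrow> M \<subseteq> car K \<Longrightarrow> bounded_module_map H K T"
  by (auto simp: bounded_module_map_def bounded_between_def)

lemma (in hilbert_module) closed_submodule_diff:
  "closed_submodule H M \<Longrightarrow> x \<in> M \<Longrightarrow> y \<in> M \<Longrightarrow> x - y \<in> M"
  using hilbert_module.diff_closed[OF hilbert_restr, of M x y] by simp

lemma direct_sum_decompose:
  assumes "direct_sum H M N" "x \<in> car H"
  obtains m n where "m \<in> M" "n \<in> N" "x = m + n"
  using assms unfolding direct_sum_def by blast

lemma direct_sum_closed:
  "direct_sum H M N \<Longrightarrow> closed_submodule H M" "direct_sum H M N \<Longrightarrow> closed_submodule H N"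
  "direct_sum H M N \<Longrightarrow> M \<subseteq> car H" "direct_sum H M N \<Longrightarrow> N \<subseteq> car H"
  by (auto simp: direct_sum_def closed_submodule_def)

context hilbert_module
begin

text \<open>Addition maps the orthogonal sum of \<open>M\<close> and \<open>N\<close> bijectively
  onto \<open>H\<close>, and the open mapping theorem bounds the inverse. Adjointability of
  \<open>p\<close> is not claimed.\<close>

theorem direct_sum_projection:
  assumes MN: "direct_sum H M N"
  obtains p where "bounded_module_map H H p" "\<And>x. x \<in> car H \<Longrightarrow> p x \<in> M"
    "\<And>x. x \<in> car H \<Longrightarrow> x - p x \<in> N" "\<And>x. x \<in> M \<Longrightarrow> p x = x" "\<And>x. x \<in> N \<Longrightarrow> p x = 0"
proof -
  note cl = direct_sum_closed[OF MN]
  have c0: "0 \<in> M" "0 \<in> N" using cl by (auto simp: closed_submodule_def)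
  interpret M: hilbert_module "restr H M" using cl(1) by (rule hilbert_restr)
  interpret N: hilbert_module "restr H N" using cl(2) by (rule hilbert_restr)
  interpret MN: hilbert_module_pair "restr H M" "restr H N" ..
  interpret S: hilbert_module "restr H M \<oplus>\<^sub>H restr H N" by (rule MN.hilbert_osum)
  interpret SH: hilbert_module_pair "restr H M \<oplus>\<^sub>H restr H N" H ..
  have un: "m = m'" if "m \<in> M" "m' \<in> M" "n \<in> N" "n' \<in> N" "m + n = m' + n'" for m m' n n'
  proof -
    have "m - m' = n' - n" using that(5) by (simp add: algebra_simps)
    then have "m - m' \<in> M \<inter> N"
      using closed_submodule_diff[OF cl(1) that(1,2)] closed_submodule_diff[OF cl(2) that(4,3)] by simp
    then have "m - m' = 0" using MN unfolding direct_sum_def by blast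
    then show ?thesis by simp
  qed
  have T: "bounded_module_map (restr H M \<oplus>\<^sub>H restr H N) H (\<lambda>u. fst u + snd u)"
  proof (rule bmmI)
    fix u assume u: "u \<in> car (restr H M \<oplus>\<^sub>H restr H N)"
    then have u': "fst u \<in> M" "snd u \<in> N" "fst u \<in> car H" "snd u \<in> car H" using cl by auto
    then show "fst u + snd u \<in> car H" by simp
    show "fst (act (restr H M \<oplus>\<^sub>H restr H N) u a) + snd (act (restr H M \<oplus>\<^sub>H restr H N) u a)
        = act H (fst u + snd u) a" for a
      using u' by (simp add: act_add_left)
    show "hnorm H (fst u + snd u) \<le> 2 * hnorm (restr H M \<oplus>\<^sub>H restr H N) u"
      using hnorm_triangle[OF u'(3,4)] MN.hnorm_osum_ge[of u] u by simp
  qed (simp add: algebra_simps)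
  have car: "car H = {x + y |x y. x \<in> M \<and> y \<in> N}" using MN by (simp add: direct_sum_def)
  have surj: "(\<lambda>u. fst u + snd u) ` car (restr H M \<oplus>\<^sub>H restr H N) = car H"
    unfolding car by (force simp: image_iff)
  obtain C where C: "C > 0"
    "\<And>y. y \<in> car H \<Longrightarrow> \<exists>u\<in>car (restr H M \<oplus>\<^sub>H restr H N). fst u + snd u = y
      \<and> hnorm (restr H M \<oplus>\<^sub>H restr H N) u \<le> C * hnorm H y"
    using SH.open_mapping[OF T surj] by blast
  have "\<exists>m\<in>M. x - m \<in> N \<and> hnorm H m \<le> C * hnorm H x" if x: "x \<in> car H" for x
  proof -
    obtain u where u: "u \<in> car (restr H M \<oplus>\<^sub>H restr H N)" "fst u + snd u = x"
      "hnorm (restr H M \<oplus>\<^sub>H restr H N) u \<le> C * hnorm H x" using C(2)[OF x] by blast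
    then have "hnorm H (fst u) \<le> C * hnorm H x" using MN.hnorm_osum_ge(1)[of u] by simp
    with u show ?thesis by (intro bexI[of _ "fst u"]) auto
  qed
  then obtain p where p: "\<And>x. x \<in> car H \<Longrightarrow> p x \<in> M \<and> x - p x \<in> N \<and> hnorm H (p x) \<le> C * hnorm H x"
    by metis
  have pI: "p x = m" if "m \<in> M" "n \<in> N" "x = m + n" for x m n
  proof -
    have "m \<in> car H" "n \<in> car H" using that cl by auto
    then have "x \<in> car H" using that by simp
    then show ?thesis using un[of "p x" m "x - p x" n] p[of x] that by simp
  qed
  have add: "x + y \<in> M" if "x \<in> M" "y \<in> M" for x y using that M.add_closed by simp
  have add': "x + y \<in> N" if "x \<in> N" "y \<in> N" for x y using that N.add_closed by simp
  have act: "act H x a \<in> M" if "x \<in> M" for x a using that M.act_closed by simp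
  have act': "act H x a \<in> N" if "x \<in> N" for x a using that N.act_closed by simp
  have "bounded_module_map H H p"
  proof (rule bmmI)
    fix x y assume x: "x \<in> car H" and y: "y \<in> car H"
    show "p (x + y) = p x + p y"
      by (rule pI[OF add[of "p x" "p y"] add'[of "x - p x" "y - p y"]]) (use p x y in auto)
  next
    fix x a assume x: "x \<in> car H"
    have px: "p x \<in> car H" using p[OF x] cl by blast
    show "p (act H x a) = act H (p x) a"
      by (rule pI[OF act[of "p x" a] act'[of "x - p x" a]]) (use p[OF x] x px in \<open>auto simp: act_diff_left\<close>)
  qed (use p cl in auto)
  moreover have "p x = x" if "x \<in> M" for x using pI[of x 0] that c0 by simp
  moreover have "p x = 0" if "x \<in> N" for x using pI[of 0 x] that c0 by simp
  ultimately show ?thesis using p that by blast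
qed

text \<open>\<open>J\<close> is the inverse of the first diagonal entry after the projection onto \<open>M2\<close> along \<open>N2\<close>.\<close>

lemma diagonal_iso_left_inverse:
  assumes T: "bounded_module_map H H T" and diag: "diagonal_iso H T M1 N1 M2 N2"
  obtains J where "bounded_module_map H H J" "\<And>y. y \<in> car H \<Longrightarrow> J y \<in> M1"
    "\<And>x. x \<in> M1 \<Longrightarrow> J (T x) = x" "\<And>y. y \<in> M2 \<Longrightarrow> T (J y) = y"
    "N2 = {y \<in> car H. J y = 0}" "N1 = {x \<in> car H. J (T x) = 0}"
proof -
  interpret HH: hilbert_module_pair H H ..
  have d1: "direct_sum H M1 N1" and d2: "direct_sum H M2 N2"
    and TM: "T ` M1 \<subseteq> M2" and TN: "T ` N1 \<subseteq> N2" and iso: "isomorphism (restr H M1) (restr H M2) T"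
    using diag by (auto simp: diagonal_iso_def)
  note cl1 = direct_sum_closed[OF d1] and cl2 = direct_sum_closed[OF d2]
  interpret R: hilbert_module_pair "restr H M1" "restr H M2"
    using hilbert_restr[OF cl1(1)] hilbert_restr[OF cl2(1)] by (simp add: hilbert_module_pair_def)
  obtain V where V: "bounded_module_map (restr H M2) (restr H M1) V"
      "\<And>x. x \<in> M1 \<Longrightarrow> V (T x) = x" "\<And>y. y \<in> M2 \<Longrightarrow> T (V y) = y"
    using R.isomorphism_inverse[OF iso] by auto
  obtain p where p: "bounded_module_map H H p" "\<And>x. x \<in> car H \<Longrightarrow> p x \<in> M2"
    "\<And>x. x \<in> car H \<Longrightarrow> x - p x \<in> N2" "\<And>x. x \<in> M2 \<Longrightarrow> p x = x" "\<And>x. x \<in> N2 \<Longrightarrow> p x = 0"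
    using direct_sum_projection[OF d2] by blast
  define J where "J x = V (p x)" for x
  have "bounded_module_map H (restr H M1) J"
    unfolding J_def by (rule bmm_compose[OF V(1) bmm_restr_codomain[OF p(1,2)]])
  then have J: "bounded_module_map H H J" using cl1(3) by (rule bmm_extend_codomain)
  have Vc: "V y \<in> M1" if "y \<in> M2" for y using bmm_closed[OF V(1), of y] that by simp
  have V0: "V 0 = 0"
    using V(2)[of 0] HH.bmm_zero[OF T] cl1 by (auto simp: closed_submodule_def)
  have JM: "J (T x) = x" if "x \<in> M1" for x using that TM by (auto simp: J_def p(4) V(2))
  have JN: "J y = 0 \<longleftrightarrow> y \<in> N2" if y: "y \<in> car H" for y
  proof
    assume "J y = 0"
    then have "p y = 0" using V(3)[OF p(2)[OF y]] HH.bmm_zero[OF T] by (simp add: J_def)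
    then show "y \<in> N2" using p(3)[OF y] by simp
  qed (simp add: J_def p(5) V0)
  have "x \<in> N1" if x: "x \<in> car H" "J (T x) = 0" for x
  proof -
    obtain m n where mn: "m \<in> M1" "n \<in> N1" "x = m + n" using direct_sum_decompose[OF d1 x(1)] by blast
    have c: "m \<in> car H" "n \<in> car H" using mn cl1 by auto
    have "J (T n) = 0" using TN mn cl2 JN by auto
    then have "J (T x) = m"
      using mn c by (simp add: bmm_add[OF T] bmm_add[OF J] bmm_closed[OF T] JM)
    with x mn show ?thesis by simp
  qed
  moreover have "J (T x) = 0" if "x \<in> N1" for x using that TN cl2 JN by auto
  ultimately show ?thesis
    using cl1 cl2 JN JM J by (intro that[of J]) (auto simp: J_def Vc V0 p V(3))
qed

text \<open>Both \<open>J \<circ> T\<close> and \<open>T \<circ> J\<close> are idempotents, with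
  ranges \<open>M\<close> and the image of \<open>M\<close>; the listed complements are their
  kernels.\<close>

lemma left_inverse_diagonal_iso:
  assumes T: "bounded_module_map H H T" and M: "closed_submodule H M"
    and J: "bounded_module_map H H J" "\<And>y. y \<in> car H \<Longrightarrow> J y \<in> M" "\<And>x. x \<in> M \<Longrightarrow> J (T x) = x"
  shows "diagonal_iso H T M {x \<in> car H. J (T x) = 0} (T ` M) {y \<in> car H. J y = 0}"
proof -
  interpret HH: hilbert_module_pair H H ..
  have Mc: "x \<in> car H" if "x \<in> M" for x using closed_submodule_car[OF M that] .
  have M0: "0 \<in> M" using M by (simp add: closed_submodule_def)
  \<comment> \<open>The image of \<open>M\<close> is the fixed-point set of the bounded map
    \<open>T \<circ> J\<close>, hence closed.\<close>
  have im: "T ` M = {y \<in> car H. y - T (J y) = 0}"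
    using Mc J(2,3) bmm_closed[OF T] by (auto simp: image_iff)
  have b: "bounded_module_map H H (\<lambda>y. y - T (J y))"
    by (rule HH.bmm_subtract[OF bmm_id bmm_compose[OF T J(1)]])
  have cl: "closed_submodule H (T ` M)" unfolding im by (rule HH.closed_kernel[OF b])
  have d1: "direct_sum H M {x \<in> car H. J (T x) = 0}"
    unfolding direct_sum_def
  proof (intro conjI equalityI subsetI)
    show "closed_submodule H {x \<in> car H. J (T x) = 0}"
      by (rule HH.closed_kernel[OF bmm_compose[OF J(1) T]])
    fix x assume x: "x \<in> car H"
    have "x = J (T x) + (x - J (T x))" by simp
    moreover have "x - J (T x) \<in> {x \<in> car H. J (T x) = 0}"
      using x J(2) Mc bmm_closed[OF T] by (simp add: HH.bmm_diff[OF T] HH.bmm_diff[OF J(1)] J(3))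
    moreover have "J (T x) \<in> M" using x J(2) bmm_closed[OF T] by blast
    ultimately show "x \<in> {x + y |x y. x \<in> M \<and> y \<in> {x \<in> car H. J (T x) = 0}}" by blast
  qed (use M Mc M0 J(3) HH.bmm_zero[OF T] HH.bmm_zero[OF J(1)] in auto)
  have d2: "direct_sum H (T ` M) {y \<in> car H. J y = 0}"
    unfolding direct_sum_def
  proof (intro conjI equalityI subsetI)
    show "closed_submodule H {y \<in> car H. J y = 0}" by (rule HH.closed_kernel[OF J(1)])
    fix y assume y: "y \<in> car H"
    have "y = T (J y) + (y - T (J y))" by simp
    moreover have "y - T (J y) \<in> {y \<in> car H. J y = 0}"
      using y J(2) Mc bmm_closed[OF T] by (simp add: HH.bmm_diff[OF J(1)] J(3))
    moreover have "T (J y) \<in> T ` M" using y J(2) by blast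
    ultimately show "y \<in> {x + y |x y. x \<in> T ` M \<and> y \<in> {y \<in> car H. J y = 0}}" by blast
  next
    fix y assume "y \<in> T ` M \<inter> {y \<in> car H. J y = 0}"
    then show "y \<in> {0}" using J(3) HH.bmm_zero[OF T] by auto
  next
    fix y :: 'm assume "y \<in> {0}"
    moreover have "0 \<in> T ` M" using image_eqI[of 0 T 0 M] M0 HH.bmm_zero[OF T] by simp
    ultimately show "y \<in> T ` M \<inter> {y \<in> car H. J y = 0}" using HH.bmm_zero[OF J(1)] by simp
  qed (use cl Mc bmm_closed[OF T] in auto)
  interpret R: hilbert_module_pair "restr H M" "restr H (T ` M)"
    using hilbert_restr[OF M] hilbert_restr[OF cl] by (simp add: hilbert_module_pair_def)
  have "isomorphism (restr H M) (restr H (T ` M)) T"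
  proof (rule R.isomorphismI)
    show "bounded_module_map (restr H M) (restr H (T ` M)) T"
      by (intro bmm_restr_codomain bmm_restr_domain T) (use Mc in auto)
    show "bounded_module_map (restr H (T ` M)) (restr H M) J"
      by (intro bmm_restr_codomain bmm_restr_domain J) (use Mc J bmm_closed[OF T] in auto)
  qed (use J(3) in auto)
  with d1 d2 show ?thesis using bmm_closed[OF T] by (auto simp: diagonal_iso_def)
qed

text \<open>The diagonalisation has the kernel of \<open>J \<circ> T\<close> in place of the given
  complement \<open>N\<close>. The projection \<open>q = 1 - J \<circ> T\<close> onto this kernel
  kills \<open>M\<close>, so it maps \<open>N\<close> onto the kernel and finite generation is
  inherited.\<close>

lemma left_inverse_upper_semi_Fredholm:
  assumes T: "T \<in> B\<^sup>a H H" and MN: "direct_sum H M N" and fg: "finitely_generated (restr H N)"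
    and J: "bounded_module_map H H J" "\<And>y. y \<in> car H \<Longrightarrow> J y \<in> M" "\<And>x. x \<in> M \<Longrightarrow> J (T x) = x"
  shows "T \<in> M\<Phi>\<^sub>+ H"
proof -
  interpret HH: hilbert_module_pair H H ..
  have Tb: "bounded_module_map H H T" using T by (simp add: adjointable_def)
  note cl = direct_sum_closed[OF MN]
  let ?N = "{x \<in> car H. J (T x) = 0}"
  have diag: "diagonal_iso H T M ?N (T ` M) {y \<in> car H. J y = 0}"
    by (rule left_inverse_diagonal_iso[OF Tb cl(1) J])
  then have clN: "closed_submodule H ?N" by (simp add: diagonal_iso_def direct_sum_def)
  define q where "q y = y - J (T y)" for y
  have q: "bounded_module_map H H q"
    unfolding q_def by (rule HH.bmm_subtract[OF bmm_id bmm_compose[OF J(1) Tb]])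
  have qN: "q y \<in> ?N" if "y \<in> car H" for y
    using that J(2) cl(3) bmm_closed[OF Tb]
    by (auto simp: q_def HH.bmm_diff[OF Tb] HH.bmm_diff[OF J(1)] J(3) subset_iff)
  have "finitely_generated (restr H ?N)"
  proof (rule finitely_generated_image[OF hilbert_restr[OF clN] fg _ hilbert_restr[OF cl(2)]])
    show "bounded_module_map (restr H N) (restr H ?N) q"
      by (intro bmm_restr_codomain bmm_restr_domain q qN) (use cl in auto)
    have "x \<in> q ` N" if x: "x \<in> car H" "J (T x) = 0" for x
    proof -
      obtain m n where mn: "m \<in> M" "n \<in> N" "x = m + n" using direct_sum_decompose[OF MN x(1)] by blast
      then have "m \<in> car H" "n \<in> car H" using cl by auto
      then have "q x = q n" using mn bmm_add[OF q, of m n] by (simp add: q_def J(3))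
      moreover have "q x = x" using x by (simp add: q_def)
      ultimately show ?thesis using mn by (metis imageI)
    qed
    then show "q ` car (restr H N) = car (restr H ?N)" using qN cl(4) by auto
  qed
  with T diag show ?thesis unfolding upper_semi_Fredholm_def by blast
qed

text \<open>\<open>J \<circ> G\<close> is a left inverse of \<open>E\<close> on \<open>M1\<close>
  because \<open>J (G (E x)) = J (T x)\<close>, and its kernel is the preimage of \<open>N2\<close>
  under \<open>G\<close>. On the first middle summand \<open>G\<close> is inverted by
  \<open>E \<circ> J\<close>.\<close>

lemma diagonal_iso_factor:
  assumes E: "bounded_module_map H H E" and G: "bounded_module_map H H G"
    and T: "bounded_module_map H H T" "\<And>x. x \<in> car H \<Longrightarrow> T x = G (E x)"
    and diag: "diagonal_iso H T M1 N1 M2 N2"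
  defines "R \<equiv> {x \<in> car H. G x \<in> N2}"
  shows "diagonal_iso H E M1 N1 (E ` M1) R" "diagonal_iso H G (E ` M1) R M2 N2"
proof -
  obtain J where J: "bounded_module_map H H J" "\<And>y. y \<in> car H \<Longrightarrow> J y \<in> M1"
    "\<And>x. x \<in> M1 \<Longrightarrow> J (T x) = x" "\<And>y. y \<in> M2 \<Longrightarrow> T (J y) = y"
    and N2: "N2 = {y \<in> car H. J y = 0}" and N1: "N1 = {x \<in> car H. J (T x) = 0}"
    using diagonal_iso_left_inverse[OF T(1) diag] by blast
  have d1: "direct_sum H M1 N1" and d2: "direct_sum H M2 N2" and TM: "T ` M1 \<subseteq> M2"
    using diag by (auto simp: diagonal_iso_def)
  note cl1 = direct_sum_closed[OF d1] and cl2 = direct_sum_closed[OF d2]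
  have "diagonal_iso H E M1 {x \<in> car H. J (G (E x)) = 0} (E ` M1) {y \<in> car H. J (G y) = 0}"
    by (rule left_inverse_diagonal_iso[OF E cl1(1) bmm_compose[OF J(1) G]])
      (use J(2,3) T(2) cl1 bmm_closed[OF G] in \<open>auto simp: subset_iff\<close>)
  moreover have "{x \<in> car H. J (G (E x)) = 0} = N1" using T(2) by (auto simp: N1)
  moreover have "{y \<in> car H. J (G y) = 0} = R" using bmm_closed[OF G] by (auto simp: N2 R_def)
  ultimately show *: "diagonal_iso H E M1 N1 (E ` M1) R" by simp
  then have d3: "direct_sum H (E ` M1) R" by (simp add: diagonal_iso_def)
  note cl3 = direct_sum_closed[OF d3]
  interpret P: hilbert_module_pair "restr H (E ` M1)" "restr H M2"
    using hilbert_restr[OF cl3(1)] hilbert_restr[OF cl2(1)] by (simp add: hilbert_module_pair_def)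
  have GE: "G (E x) \<in> M2" "J (G (E x)) = x" if "x \<in> M1" for x
    using that TM T(2)[of x] cl1 J(3)[of x] by (auto simp: subset_iff)
  have EJ: "bounded_module_map H H (\<lambda>y. E (J y))" by (rule bmm_compose[OF E J(1)])
  have "isomorphism (restr H (E ` M1)) (restr H M2) G"
  proof (rule P.isomorphismI)
    show "bounded_module_map (restr H (E ` M1)) (restr H M2) G"
      by (intro bmm_restr_codomain bmm_restr_domain G) (use cl3 GE in auto)
    show "bounded_module_map (restr H M2) (restr H (E ` M1)) (\<lambda>y. E (J y))"
      by (intro bmm_restr_codomain bmm_restr_domain EJ) (use cl2 J(2) in \<open>auto simp: subset_iff\<close>)
    show "G (E (J y)) = y" if "y \<in> car (restr H M2)" for y
    proof -
      have "y \<in> M2" "y \<in> car H" using that cl2 by auto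
      then have "J y \<in> car H" using J(2) cl1 by auto
      then show ?thesis using T(2) J(4)[OF \<open>y \<in> M2\<close>] by simp
    qed
  qed (use GE in auto)
  with d2 d3 show "diagonal_iso H G (E ` M1) R M2 N2"
    using GE(1) by (auto simp: diagonal_iso_def R_def)
qed

end

section \<open>Tails of the standard module\<close>

definition tail :: "nat \<Rightarrow> (nat \<Rightarrow> 'a::cstar_algebra) set" where
  "tail n = {x \<in> car ell2. \<forall>i<n. x i = 0}"

text \<open>On \<open>ell2\<close> this is the coordinate projection onto \<open>tail n\<close>; its
  kernel there is spanned by the first \<open>n\<close> unit vectors.\<close>

definition cut :: "nat \<Rightarrow> (nat \<Rightarrow> 'a::cstar_algebra) \<Rightarrow> nat \<Rightarrow> 'a" where
  "cut n x = (\<lambda>i. if i < n then 0 else x i)"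

lemma cut_ell2: assumes "x \<in> car ell2" shows "cut n x \<in> car ell2"
  unfolding ell2_car
  by (rule summable_cpos_comparison[where g = "\<lambda>i. star (x i) * x i"])
    (use assms in \<open>auto simp: cut_def star_mult_self_cpos ell2_car\<close>)

lemma cut_tail: "x \<in> car ell2 \<Longrightarrow> cut n x \<in> tail n"
  by (simp add: tail_def cut_ell2) (simp add: cut_def)

lemma cut_tail_id: "x \<in> tail n \<Longrightarrow> cut n x = x"
  by (auto simp: tail_def cut_def fun_eq_iff)

lemma hnorm_cut_le: assumes x: "x \<in> car ell2" shows "hnorm ell2 (cut n x) \<le> hnorm ell2 x"
proof (rule ell2_hnorm_le)
  fix k
  have "norm (\<Sum>i<k. star (cut n x i) * cut n x i) \<le> norm (\<Sum>i<k. star (x i) * x i)"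
  proof (rule norm_cpos_mono)
    have "star (x i) * x i - star (cut n x i) * cut n x i \<in> cpos" for i
      by (simp add: cut_def star_mult_self_cpos)
    then show "(\<Sum>i<k. star (x i) * x i) - (\<Sum>i<k. star (cut n x i) * cut n x i) \<in> cpos"
      unfolding sum_subtractf[symmetric] by (rule cpos_sum)
  qed (intro cpos_sum star_mult_self_cpos)
  also have "\<dots> \<le> (hnorm ell2 x)\<^sup>2" using x by (intro ell2_norm_sum_le) auto
  finally show "norm (\<Sum>i<k. star (cut n x i) * cut n x i) \<le> (hnorm ell2 x)\<^sup>2" .
qed (use cut_ell2[OF x] in \<open>auto simp: hnorm_def\<close>)

lemma bmm_cut: "bounded_module_map ell2 ell2 (cut n :: (nat \<Rightarrow> 'a::cstar_algebra) \<Rightarrow> nat \<Rightarrow> 'a)"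
proof (rule bmmI[where B = 1])
  show "cut n x \<in> car ell2" "hnorm ell2 (cut n x) \<le> 1 * hnorm ell2 x" if "x \<in> car ell2" for x :: "nat \<Rightarrow> 'a"
    using that by (simp_all add: cut_ell2 hnorm_cut_le)
qed (auto simp: cut_def ell2_act fun_eq_iff)

text \<open>The squared norm is the norm of a remainder of a norm-convergent series. Convergence is
  for each fixed \<open>x\<close>, not uniform on the unit ball.\<close>

lemma hnorm_cut_tendsto_0:
  assumes x: "x \<in> car ell2"
  shows "(\<lambda>n. hnorm ell2 (cut n x)) \<longlonglongrightarrow> 0"
proof -
  let ?f = "\<lambda>i. star (x i) * x i"
  have f: "summable ?f" using x by (simp add: ell2_car)
  have "(hnorm ell2 (cut n x))\<^sup>2 = norm (suminf ?f - sum ?f {..<n})" for n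
  proof -
    let ?g = "\<lambda>i. star (cut n x i) * cut n x i"
    have g: "summable ?g" using cut_ell2[OF x] by (simp add: ell2_car)
    have "suminf ?g = (\<Sum>i. ?g (i + n)) + sum ?g {..<n}"
      by (rule suminf_split_initial_segment[OF g])
    also have "\<dots> = (\<Sum>i. ?f (i + n))" by (simp add: cut_def)
    also have "\<dots> = suminf ?f - sum ?f {..<n}"
      using suminf_split_initial_segment[OF f, of n] by simp
    finally show ?thesis by (simp add: ell2_hnorm_square)
  qed
  moreover have "(\<lambda>n. norm (suminf ?f - sum ?f {..<n})) \<longlonglongrightarrow> norm (suminf ?f - suminf ?f)"
    by (intro tendsto_intros summable_LIMSEQ f)
  ultimately have "(\<lambda>n. (hnorm ell2 (cut n x))\<^sup>2) \<longlonglongrightarrow> 0" by simp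
  then have "(\<lambda>n. sqrt ((hnorm ell2 (cut n x))\<^sup>2)) \<longlonglongrightarrow> sqrt 0" by (rule tendsto_real_sqrt)
  then show ?thesis by (simp add: hnorm_def)
qed

text \<open>A vector in the tail sees only \<open>cut n v\<close>, whose norm tends to
  \<open>0\<close>; the threshold depends on \<open>v\<close> and \<open>e\<close> but not on
  \<open>x\<close>.\<close>

lemma ip_tail_small:
  fixes v :: "nat \<Rightarrow> 'a::cstar_algebra"
  assumes v: "v \<in> car ell2" and e: "e > 0"
  shows "eventually (\<lambda>n. \<forall>x\<in>tail n. norm (ip ell2 v x) \<le> e * hnorm ell2 x) sequentially"
  using order_tendstoD(2)[OF hnorm_cut_tendsto_0[OF v] e]
proof eventually_elim
  case (elim n)
  interpret A: hilbert_module "ell2 :: (nat \<Rightarrow> 'a, 'a) hmod" by (rule hilbert_ell2)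
  show ?case
  proof
    fix x :: "nat \<Rightarrow> 'a" assume x: "x \<in> tail n"
    then have xc: "x \<in> car ell2" by (simp add: tail_def)
    have "(\<lambda>i. star (v i) * x i) = (\<lambda>i. star (cut n v i) * x i)"
      using x by (auto simp: tail_def cut_def fun_eq_iff)
    then have "ip ell2 v x = ip ell2 (cut n v) x" unfolding ell2_ip by (rule arg_cong)
    then have "norm (ip ell2 v x) \<le> hnorm ell2 (cut n v) * hnorm ell2 x"
      using A.Cauchy_Schwarz[OF cut_ell2[OF v] xc] by simp
    also have "\<dots> \<le> e * hnorm ell2 x" using elim by (intro mult_right_mono) auto
    finally show "norm (ip ell2 v x) \<le> e * hnorm ell2 x" .
  qed
qed

lemma sum_apply: "(\<Sum>i\<in>I. f i) j = (\<Sum>i\<in>I. f i j)"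
  by (induction I rule: infinite_finite_induct) auto

lemma tail_direct_sum:
  shows "direct_sum ell2 (tail n) {x \<in> car ell2. cut n (x :: nat \<Rightarrow> 'a::cstar_algebra) = 0}"
    and "finitely_generated (restr ell2 {x \<in> car ell2. cut n (x :: nat \<Rightarrow> 'a::cstar_algebra) = 0})"
proof -
  interpret A: hilbert_module "ell2 :: (nat \<Rightarrow> 'a, 'a) hmod" by (rule hilbert_ell2)
  interpret AA: hilbert_module_pair "ell2 :: (nat \<Rightarrow> 'a, 'a) hmod" ell2 ..
  let ?L = "{x \<in> car ell2. cut n (x :: nat \<Rightarrow> 'a) = 0}"
  have cL: "closed_submodule ell2 ?L" by (rule AA.closed_kernel[OF bmm_cut])
  have t: "tail n = {x \<in> car ell2. x - cut n x = (0 :: nat \<Rightarrow> 'a)}"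
    by (auto simp: tail_def cut_def fun_eq_iff)
  have cT: "closed_submodule ell2 (tail n :: (nat \<Rightarrow> 'a) set)"
    unfolding t by (rule AA.closed_kernel[OF AA.bmm_subtract[OF bmm_id bmm_cut]])
  have cc: "cut n (cut n x) = cut n x" for x :: "nat \<Rightarrow> 'a" by (auto simp: cut_def)
  have "x \<in> {x + y |x y. x \<in> tail n \<and> y \<in> ?L}" if x: "x \<in> car ell2" for x :: "nat \<Rightarrow> 'a"
  proof -
    have "x = cut n x + (x - cut n x)" by simp
    moreover have "x - cut n x \<in> ?L" using x by (simp add: AA.bmm_diff[OF bmm_cut] cut_ell2 cc)
    ultimately show ?thesis using cut_tail[OF x] by blast
  qed
  moreover have "tail n \<inter> ?L = {0}" by (auto simp: cut_tail_id tail_def ell2_zero)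
  ultimately show "direct_sum ell2 (tail n) ?L"
    using cL cT by (auto simp: direct_sum_def tail_def)
  show "finitely_generated (restr ell2 ?L)"
  proof (rule finitely_generatedI[OF A.hilbert_restr[OF cL]])
    let ?e = "\<lambda>i j. if j = i then 1 else (0::'a)"
    show "finite {..<n}" by simp
    have ec: "?e i \<in> car ell2" for i unfolding ell2_car by (rule summable_finite[of "{i}"]) auto
    show "?e i \<in> car (restr ell2 ?L)" if "i \<in> {..<n}" for i
      using that ec[of i] by (auto simp: cut_def fun_eq_iff)
    fix x :: "nat \<Rightarrow> 'a" assume "x \<in> car (restr ell2 ?L)"
    then have "cut n x = 0" by simp
    then have x: "x j = 0" if "j \<ge> n" for j using fun_cong[OF \<open>cut n x = 0\<close>, of j] that unfolding cut_def by simp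
    have "x = (\<Sum>i<n. act (restr ell2 ?L) (?e i) (x i))"
    proof
      fix j
      have "(\<Sum>i<n. act (restr ell2 ?L) (?e i) (x i)) j = (\<Sum>i<n. if i = j then x i else 0)"
        unfolding sum_apply by (intro sum.cong refl) (auto simp: ell2_act)
      also have "\<dots> = x j" using x[of j] by (simp add: sum.delta)
      finally show "x j = (\<Sum>i<n. act (restr ell2 ?L) (?e i) (x i)) j" by simp
    qed
    then show "\<exists>a. x = (\<Sum>i<n. act (restr ell2 ?L) (?e i) (a i))" by blast
  qed
qed

text \<open>With a left inverse \<open>G'\<close> of \<open>F\<close> up to a finite-rank operator \<open>\<kappa>\<close>, which is small on tails, \<open>F\<close> is left invertible on
  a tail of \<open>ell2\<close> by a Neumann series.\<close>

theorem compression_upper_semi_Fredholm: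
  fixes F :: "(nat \<Rightarrow> 'a::cstar_algebra) \<Rightarrow> nat \<Rightarrow> 'a" and H :: "('m::ab_group_add, 'a) hmod"
  assumes H: "hilbert_module H" and T: "bounded_module_map H H T"
    and diag: "diagonal_iso H T M1 N1 M2 N2" and fg: "finitely_generated (restr H N1)"
    and F: "F \<in> B\<^sup>a ell2 ell2"
    and j: "bounded_module_map ell2 H j" and p: "bounded_module_map H ell2 p"
    and pj: "\<And>x. x \<in> car ell2 \<Longrightarrow> p (j x) = x"
    and adj: "\<And>w x. w \<in> car H \<Longrightarrow> x \<in> car ell2 \<Longrightarrow> ip H w (j x) = ip ell2 (p w) x"
    and Tj: "\<And>x. x \<in> car ell2 \<Longrightarrow> T (j x) = j (F x)"
  shows "F \<in> M\<Phi>\<^sub>+ ell2"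
proof -
  interpret H: hilbert_module H by (rule H)
  interpret HH: hilbert_module_pair H H ..
  interpret A: hilbert_module "ell2 :: (nat \<Rightarrow> 'a, 'a) hmod" by (rule hilbert_ell2)
  interpret AA: hilbert_module_pair "ell2 :: (nat \<Rightarrow> 'a, 'a) hmod" ell2 ..
  interpret HA: hilbert_module_pair H "ell2 :: (nat \<Rightarrow> 'a, 'a) hmod" ..
  have Fb: "bounded_module_map ell2 ell2 F" using F by (simp add: adjointable_def)
  have d1: "direct_sum H M1 N1" using diag by (simp add: diagonal_iso_def)
  note cl = direct_sum_closed[OF d1]
  obtain J where J: "bounded_module_map H H J" "\<And>y. y \<in> car H \<Longrightarrow> J y \<in> M1"
    "\<And>x. x \<in> M1 \<Longrightarrow> J (T x) = x" "\<And>y. y \<in> M2 \<Longrightarrow> T (J y) = y"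
    "N2 = {y \<in> car H. J y = 0}" and N1: "N1 = {x \<in> car H. J (T x) = 0}"
    using H.diagonal_iso_left_inverse[OF T diag] by blast
  obtain k s w where s: "\<And>i. i < k \<Longrightarrow> s i \<in> N1" and w: "\<And>i. i < k \<Longrightarrow> w i \<in> N1"
    and frame: "\<And>y. y \<in> N1 \<Longrightarrow> y = (\<Sum>i<(k::nat). act H (s i) (ip H (w i) y))"
    using finitely_generated_frame[OF H.hilbert_restr[OF cl(2)] fg] by auto
  have sc: "s i \<in> car H" and wc: "w i \<in> car H" if "i < k" for i using s w cl that by auto
  \<comment> \<open>The frame formula read on all of \<open>H\<close>: it fixes \<open>N1\<close>.
    Unlike the projection of the direct sum it is an explicit sum of inner products with the
    \<open>w i\<close>, and these become small on tails.\<close>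
  define \<pi> where "\<pi> y = (\<Sum>i<k. act H (s i) (ip H (w i) y))" for y
  have \<pi>: "bounded_module_map H H \<pi>"
  proof (rule bmmI)
    fix x y assume x: "x \<in> car H" and y: "y \<in> car H"
    show "\<pi> (x + y) = \<pi> x + \<pi> y"
      using sc wc x y by (simp add: \<pi>_def H.ip_add_right H.act_add_right sum.distrib)
  next
    fix x a assume x: "x \<in> car H"
    show "\<pi> x \<in> car H" using sc by (auto simp: \<pi>_def intro!: H.sum_closed)
    show "\<pi> (act H x a) = act H (\<pi> x) a"
      unfolding \<pi>_def using sc wc x by (subst H.act_sum) (auto simp: H.ip_act_right H.act_act)
    have "hnorm H (\<pi> x) \<le> (\<Sum>i<k. hnorm H (act H (s i) (ip H (w i) x)))"
      unfolding \<pi>_def using sc by (intro H.hnorm_sum) auto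
    also have "\<dots> \<le> (\<Sum>i<k. hnorm H (s i) * (hnorm H (w i) * hnorm H x))"
    proof (rule sum_mono)
      fix i assume "i \<in> {..<k}"
      then have "hnorm H (act H (s i) (ip H (w i) x)) \<le> hnorm H (s i) * norm (ip H (w i) x)"
        using sc by (intro H.hnorm_act_le) auto
      also have "\<dots> \<le> hnorm H (s i) * (hnorm H (w i) * hnorm H x)"
        using x wc \<open>i \<in> {..<k}\<close> by (intro mult_left_mono H.Cauchy_Schwarz) auto
      finally show "hnorm H (act H (s i) (ip H (w i) x)) \<le> hnorm H (s i) * (hnorm H (w i) * hnorm H x)" .
    qed
    finally show "hnorm H (\<pi> x) \<le> (\<Sum>i<k. hnorm H (s i) * hnorm H (w i)) * hnorm H x"
      by (simp add: sum_distrib_right mult.assoc)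
  qed
  \<comment> \<open>\<open>x - J (T x)\<close> lies in \<open>N1\<close> and is therefore fixed by
    \<open>\<pi>\<close>; subtracting \<open>\<pi> \<circ> J\<close> from \<open>J\<close> thus
    gives a left inverse of \<open>T\<close> with error exactly \<open>\<pi>\<close>.\<close>
  define G where "G y = J y - \<pi> (J y)" for y
  have G: "bounded_module_map H H G"
    unfolding G_def by (rule HH.bmm_subtract[OF J(1) bmm_compose[OF \<pi> J(1)]])
  have GT: "G (T x) = x - \<pi> x" if x: "x \<in> car H" for x
  proof -
    let ?n = "x - J (T x)"
    have JT: "J (T x) \<in> M1" "J (T x) \<in> car H" using x J(2) cl bmm_closed[OF T] by auto
    have "?n \<in> N1"
      using x JT by (simp add: N1 HH.bmm_diff[OF T] HH.bmm_diff[OF J(1)] bmm_closed[OF T] J(3))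
    then have "\<pi> ?n = ?n" using frame[of ?n] by (simp add: \<pi>_def)
    then show ?thesis using x JT by (simp add: G_def HH.bmm_diff[OF \<pi>] algebra_simps)
  qed
  \<comment> \<open>Compression along the embedding \<open>j\<close>: the relation
    \<open>T (j x) = j (F x)\<close> turns the identity for \<open>T\<close> into one for
    \<open>F\<close>, whose error \<open>\<kappa>\<close> is again a finite sum of inner
    products.\<close>
  define \<kappa> where "\<kappa> x = p (\<pi> (j x))" for x
  have \<kappa>: "bounded_module_map ell2 ell2 \<kappa>"
    unfolding \<kappa>_def by (intro bmm_compose[OF p] bmm_compose[OF \<pi>] j)
  define G' where "G' x = p (G (j x))" for x
  have G': "bounded_module_map ell2 ell2 G'"
    unfolding G'_def by (intro bmm_compose[OF p] bmm_compose[OF G] j)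
  have G'F: "G' (F x) = x - \<kappa> x" if x: "x \<in> car ell2" for x
  proof -
    have "G (j (F x)) = j x - \<pi> (j x)" using x by (simp add: GT bmm_closed[OF j] flip: Tj)
    then show ?thesis
      using x by (simp add: G'_def \<kappa>_def HA.bmm_diff[OF p] bmm_closed[OF j] bmm_closed[OF \<pi>] pj)
  qed
  have \<kappa>_eq: "\<kappa> x = (\<Sum>i<k. act ell2 (p (s i)) (ip ell2 (p (w i)) x))" if x: "x \<in> car ell2" for x
    unfolding \<kappa>_def \<pi>_def using sc wc x
    by (subst HA.bmm_sum[OF p]) (auto simp: bmm_act[OF p] adj bmm_closed[OF j])
  define \<Sigma> where "\<Sigma> = (\<Sum>i<k. hnorm ell2 (p (s i)))"
  have \<Sigma>: "\<Sigma> \<ge> 0" unfolding \<Sigma>_def by (intro sum_nonneg) auto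
  \<comment> \<open>Chosen so that \<open>\<Sigma> * e \<le> 1 / 2\<close>; the added
    \<open>1\<close> avoids division by \<open>0\<close>.\<close>
  define e where "e = 1 / (2 * (1 + \<Sigma>))"
  have e: "e > 0" "\<Sigma> * e \<le> 1 / 2" using \<Sigma> by (auto simp: e_def divide_simps)
  have "eventually (\<lambda>n. \<forall>i\<in>{..<k}. \<forall>x\<in>tail n. norm (ip ell2 (p (w i)) x) \<le> e * hnorm ell2 x) sequentially"
    using wc by (intro eventually_ball_finite ballI ip_tail_small e) (auto simp: bmm_closed[OF p])
  then obtain n where n: "\<And>i x. i < k \<Longrightarrow> x \<in> tail n \<Longrightarrow> norm (ip ell2 (p (w i)) x) \<le> e * hnorm ell2 x"
    by (auto simp: eventually_sequentially)
  have small: "hnorm ell2 (\<kappa> x) \<le> (1/2) * hnorm ell2 x" if x: "x \<in> tail n" for x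
  proof -
    have xc: "x \<in> car ell2" using x by (simp add: tail_def)
    have "hnorm ell2 (\<kappa> x) \<le> (\<Sum>i<k. hnorm ell2 (act ell2 (p (s i)) (ip ell2 (p (w i)) x)))"
      unfolding \<kappa>_eq[OF xc] using sc by (intro A.hnorm_sum) (auto simp: bmm_closed[OF p])
    also have "\<dots> \<le> (\<Sum>i<k. hnorm ell2 (p (s i)) * (e * hnorm ell2 x))"
    proof (rule sum_mono)
      fix i assume i: "i \<in> {..<k}"
      then have "hnorm ell2 (act ell2 (p (s i)) (ip ell2 (p (w i)) x))
          \<le> hnorm ell2 (p (s i)) * norm (ip ell2 (p (w i)) x)"
        using sc by (intro A.hnorm_act_le bmm_closed[OF p]) auto
      also have "\<dots> \<le> hnorm ell2 (p (s i)) * (e * hnorm ell2 x)"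
        using n i x by (intro mult_left_mono) auto
      finally show "hnorm ell2 (act ell2 (p (s i)) (ip ell2 (p (w i)) x))
          \<le> hnorm ell2 (p (s i)) * (e * hnorm ell2 x)" .
    qed
    also have "\<dots> = (\<Sigma> * e) * hnorm ell2 x" by (simp add: \<Sigma>_def sum_distrib_right mult.assoc)
    also have "\<dots> \<le> (1/2) * hnorm ell2 x" using e by (intro mult_right_mono) auto
    finally show ?thesis .
  qed
  note ds = tail_direct_sum(1)[where ?'a = 'a, of n]
  note clt = direct_sum_closed[OF ds]
  let ?E = "restr ell2 (tail n) :: (nat \<Rightarrow> 'a, 'a) hmod"
  interpret E: hilbert_module ?E by (rule A.hilbert_restr[OF clt(1)])
  interpret EE: hilbert_module_pair ?E ?E ..
  \<comment> \<open>\<open>\<kappa>\<close> need not preserve the tail; following it by the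
    contraction \<open>cut n\<close> keeps the inversion of \<open>1 - K\<close> inside
    \<open>?E\<close>.\<close>
  define K where "K x = cut n (\<kappa> x)" for x
  have K: "bounded_module_map ?E ?E K"
    unfolding K_def
    by (intro bmm_restr_codomain bmm_restr_domain bmm_compose[OF bmm_cut \<kappa>])
      (use clt in \<open>auto intro!: cut_tail bmm_closed[OF \<kappa>]\<close>)
  have Ksmall: "hnorm ell2 (K x) \<le> (1/2) * hnorm ell2 x" if x: "x \<in> tail n" for x
    using hnorm_cut_le[of "\<kappa> x" n] small[OF x] x bmm_closed[OF \<kappa>, of x] by (simp add: K_def tail_def)
  have Kc: "K x \<in> tail n" if "x \<in> tail n" for x using bmm_closed[OF K, of x] that by simp
  have W: "bounded_module_map ?E ?E (\<lambda>x. x - K x)" by (rule EE.bmm_subtract[OF bmm_id K])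
  have below: "hnorm ?E x \<le> 2 * hnorm ?E (x - K x)" if x: "x \<in> car ?E" for x
    using E.hnorm_triangle[of "x - K x" "K x"] Ksmall[of x] x Kc[of x] E.diff_closed[of x "K x"] by simp
  have surj: "\<exists>x\<in>car ?E. x - K x = y" if y: "y \<in> car ?E" for y
  proof -
    have "\<exists>x\<in>car ?E. hnorm ?E x \<le> 1 * hnorm ?E y \<and> hnorm ?E (y - (x - K x)) \<le> (1/2) * hnorm ?E y"
      if "y \<in> car ?E" for y
      using that Ksmall[of y] by (intro bexI[of _ y]) auto
    then obtain x where "x \<in> car ?E" "x - K x = y"
      using EE.approximate_surjection[OF W _ _ _ y, where q = "1/2" and C = 1] by auto
    then show ?thesis by blast
  qed
  have "inj_on (\<lambda>x. x - K x) (car ?E)"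
  proof (rule inj_onI)
    fix x y assume xy: "x \<in> car ?E" "y \<in> car ?E" "x - K x = y - K y"
    then have "(x - y) - K (x - y) = 0" by (simp add: EE.bmm_diff[OF K] algebra_simps)
    then have "hnorm ?E (x - y) \<le> 0" using below[OF E.diff_closed[OF xy(1,2)]] by (simp only: E.hnorm_zero)
    then have "hnorm ?E (x - y) = 0" using E.hnorm_nonneg[of "x - y"] by (rule order_antisym)
    then have "x - y = 0" using E.hnorm_eq_0[OF E.diff_closed[OF xy(1,2)]] by blast
    then show "x = y" by simp
  qed
  moreover have "(\<lambda>x. x - K x) ` car ?E = car ?E"
    using surj bmm_closed[OF W] by (auto simp: image_iff)
  ultimately have "bij_betw (\<lambda>x. x - K x) (car ?E) (car ?E)" by (simp add: bij_betw_def)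
  then obtain V where V: "bounded_module_map ?E ?E V" "\<And>x. x \<in> car ?E \<Longrightarrow> V (x - K x) = x"
    "\<And>y. y \<in> car ?E \<Longrightarrow> V y - K (V y) = y"
    using EE.bijection_inverse[OF W _ below] by blast
  \<comment> \<open>On the tail \<open>cut n (G' (F x)) = x - K x\<close>, and \<open>V\<close>
    inverts \<open>1 - K\<close> there.\<close>
  define J' where "J' y = V (cut n (G' y))" for y
  have J'E: "bounded_module_map ell2 ?E J'"
    unfolding J'_def
    by (intro bmm_compose[OF V(1)] bmm_restr_codomain bmm_compose[OF bmm_cut G'] cut_tail bmm_closed[OF G'])
  show ?thesis
  proof (rule A.left_inverse_upper_semi_Fredholm[OF F ds tail_direct_sum(2)])
    show "bounded_module_map ell2 ell2 J'" using bmm_extend_codomain[OF J'E clt(3)] .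
    show "J' y \<in> tail n" if "y \<in> car ell2" for y using bmm_closed[OF J'E that] by simp
    fix x :: "nat \<Rightarrow> 'a" assume x: "x \<in> tail n"
    then have xc: "x \<in> car ell2" by (simp add: tail_def)
    have "cut n (G' (F x)) = x - K x"
      using xc x by (simp add: G'F AA.bmm_diff[OF bmm_cut] bmm_closed[OF \<kappa>] cut_tail_id K_def)
    then show "J' (F x) = x" using V(2)[of x] x by (simp add: J'_def)
  qed
qed

section \<open>Upper triangular operators\<close>

lemma closed_submodule_limit:
  assumes "closed_submodule H M" "\<And>n::nat. X n \<in> M" "l \<in> car H" "(\<lambda>n. hnorm H (X n - l)) \<longlonglongrightarrow> 0"
  shows "l \<in> M"
  using assms unfolding closed_submodule_def by blast

lemma adjointable_bmm: "T \<in> B\<^sup>a H K \<Longrightarrow> bounded_module_map H K T"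
  by (simp add: adjointable_def)

lemma adjointable_adjoint:
  assumes "T \<in> B\<^sup>a H K"
  obtains S where "\<And>y. y \<in> car K \<Longrightarrow> S y \<in> car H"
    "\<And>x y. x \<in> car H \<Longrightarrow> y \<in> car K \<Longrightarrow> ip K (T x) y = ip H x (S y)"
  using assms unfolding adjointable_def by blast

lemma adjointableI:
  assumes "bounded_module_map H K T" "\<And>y. y \<in> car K \<Longrightarrow> S y \<in> car H"
    "\<And>x y. x \<in> car H \<Longrightarrow> y \<in> car K \<Longrightarrow> ip K (T x) y = ip H x (S y)"
  shows "T \<in> B\<^sup>a H K"
  using assms unfolding adjointable_def by blast

lemma center_star:
  assumes "\<alpha> \<in> center"
  shows "star \<alpha> \<in> center"
proof -
  have "star \<alpha> * a = a * star \<alpha>" for a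
  proof -
    have "\<alpha> * star a = star a * \<alpha>" using assms by (simp add: center_def)
    from arg_cong[OF this, of star] show ?thesis by (simp add: star_mult star_star)
  qed
  then show ?thesis by (simp add: center_def)
qed

text \<open>Centrality makes the right action of \<alpha> a module map and lets the action of
  \<open>star \<alpha>\<close> be its adjoint.\<close>

lemma (in hilbert_module) shift_adjointable:
  assumes T: "T \<in> B\<^sup>a H H" and \<alpha>: "\<alpha> \<in> center"
  shows "shift H T \<alpha> \<in> B\<^sup>a H H"
proof -
  interpret HH: hilbert_module_pair H H ..
  note Tb = adjointable_bmm[OF T]
  obtain S where S: "\<And>y. y \<in> car H \<Longrightarrow> S y \<in> car H"
    "\<And>x y. x \<in> car H \<Longrightarrow> y \<in> car H \<Longrightarrow> ip H (T x) y = ip H x (S y)"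
    using adjointable_adjoint[OF T] by blast
  have \<alpha>': "star \<alpha> * a = a * star \<alpha>" for a using center_star[OF \<alpha>] by (simp add: center_def)
  show ?thesis
  proof (rule adjointableI)
    show "bounded_module_map H H (shift H T \<alpha>)"
      using HH.bmm_subtract[OF Tb bmm_act_center[OF \<alpha>]] by (simp add: shift_def[abs_def])
    show "ip H (shift H T \<alpha> x) y = ip H x (S y - act H y (star \<alpha>))"
      if "x \<in> car H" "y \<in> car H" for x y
      using that by (simp add: shift_def ip_diff_left ip_diff_right bmm_closed[OF Tb] S ip_act_left ip_act_right \<alpha>')
  qed (use S in auto)
qed

section \<open>Coordinate maps, products of decompositions and block operators\<close>

context hilbert_module_pair
begin

lemma bmm_fst: "bounded_module_map (H \<oplus>\<^sub>H K) H fst"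
proof (rule bmmI[where B = 1])
  show "hnorm H (fst u) \<le> 1 * hnorm (H \<oplus>\<^sub>H K) u" if "u \<in> car (H \<oplus>\<^sub>H K)" for u
    using hnorm_osum_ge(1)[of u] that by simp
qed auto

lemma bmm_snd: "bounded_module_map (H \<oplus>\<^sub>H K) K snd"
proof (rule bmmI[where B = 1])
  show "hnorm K (snd u) \<le> 1 * hnorm (H \<oplus>\<^sub>H K) u" if "u \<in> car (H \<oplus>\<^sub>H K)" for u
    using hnorm_osum_ge(2)[of u] that by simp
qed auto

lemma bmm_inl: "bounded_module_map H (H \<oplus>\<^sub>H K) (\<lambda>x. (x, 0))"
  by (rule bmmI[where B = 1]) (auto simp: hnorm_def)

lemma bmm_inr: "bounded_module_map K (H \<oplus>\<^sub>H K) (\<lambda>y. (0, y))"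
  by (rule bmmI[where B = 1]) (auto simp: hnorm_def)

lemma bmm_Pair:
  assumes S: "bounded_module_map G H S" and T: "bounded_module_map G K T" and G: "hilbert_module G"
  shows "bounded_module_map G (H \<oplus>\<^sub>H K) (\<lambda>u. (S u, T u))"
proof -
  interpret GO: hilbert_module_pair G "H \<oplus>\<^sub>H K" using G hilbert_osum by (simp add: hilbert_module_pair_def)
  show ?thesis
    using GO.bmm_plus[OF bmm_compose[OF bmm_inl S] bmm_compose[OF bmm_inr T]] by simp
qed

lemma closed_submodule_Times:
  assumes M: "closed_submodule H M" and N: "closed_submodule K N"
  shows "closed_submodule (H \<oplus>\<^sub>H K) (M \<times> N)"
  unfolding closed_submodule_def
proof (intro conjI allI impI ballI)
  fix X l
  assume X: "\<forall>n. X n \<in> M \<times> N" and l: "l \<in> car (H \<oplus>\<^sub>H K)"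
    and lim: "(\<lambda>n. hnorm (H \<oplus>\<^sub>H K) (X n - l)) \<longlonglongrightarrow> 0"
  have c: "X n - l \<in> car H \<times> car K" for n
    using X[rule_format, of n] l closed_submodule_car[OF M] closed_submodule_car[OF N]
    by (auto simp: mem_Times_iff)
  have lims: "(\<lambda>n. hnorm H (fst (X n) - fst l)) \<longlonglongrightarrow> 0" "(\<lambda>n. hnorm K (snd (X n) - snd l)) \<longlonglongrightarrow> 0"
    by (rule tendsto_zero_bound[OF _ _ lim]; use hnorm_osum_ge[OF c] in simp)+
  have "fst l \<in> M"
    by (rule closed_submodule_limit[OF M _ _ lims(1)]) (use X l in \<open>auto simp: mem_Times_iff\<close>)
  moreover have "snd l \<in> N"
    by (rule closed_submodule_limit[OF N _ _ lims(2)]) (use X l in \<open>auto simp: mem_Times_iff\<close>)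
  ultimately show "l \<in> M \<times> N" by (simp add: mem_Times_iff)
qed (use M N in \<open>auto simp: closed_submodule_def zero_prod_def\<close>)

lemma direct_sum_Times:
  assumes M: "direct_sum H M1 N1" and N: "direct_sum K M2 N2"
  shows "direct_sum (H \<oplus>\<^sub>H K) (M1 \<times> M2) (N1 \<times> N2)"
  unfolding direct_sum_def
proof (intro conjI equalityI subsetI)
  note cl = direct_sum_closed[OF M] direct_sum_closed[OF N]
  show "closed_submodule (H \<oplus>\<^sub>H K) (M1 \<times> M2)" "closed_submodule (H \<oplus>\<^sub>H K) (N1 \<times> N2)"
    using cl by (auto intro!: closed_submodule_Times)
  show "u \<in> {0}" if "u \<in> (M1 \<times> M2) \<inter> (N1 \<times> N2)" for u
  proof -
    have "fst u \<in> M1 \<inter> N1" "snd u \<in> M2 \<inter> N2" using that by auto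
    then have "fst u = 0" "snd u = 0" using M N unfolding direct_sum_def by blast+
    then show ?thesis by (simp add: prod_eq_iff)
  qed
  show "u \<in> (M1 \<times> M2) \<inter> (N1 \<times> N2)" if "u \<in> {0}" for u
    using that cl by (auto simp: closed_submodule_def zero_prod_def)
  show "u \<in> car (H \<oplus>\<^sub>H K)" if "u \<in> {x + y |x y. x \<in> M1 \<times> M2 \<and> y \<in> N1 \<times> N2}" for u
    using that cl by (auto simp: subset_iff)
  fix u assume "u \<in> car (H \<oplus>\<^sub>H K)"
  then have u: "fst u \<in> car H" "snd u \<in> car K" by auto
  obtain m n where 1: "m \<in> M1" "n \<in> N1" "fst u = m + n" using direct_sum_decompose[OF M u(1)] by blast
  obtain m' n' where 2: "m' \<in> M2" "n' \<in> N2" "snd u = m' + n'" using direct_sum_decompose[OF N u(2)] by blast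
  have "u = (m, m') + (n, n')" "(m, m') \<in> M1 \<times> M2" "(n, n') \<in> N1 \<times> N2"
    using 1 2 by (auto simp: prod_eq_iff)
  then show "u \<in> {x + y |x y. x \<in> M1 \<times> M2 \<and> y \<in> N1 \<times> N2}" by blast
qed

end

lemma restr_osum: "restr (H \<oplus>\<^sub>H K) (M \<times> N) = restr H M \<oplus>\<^sub>H restr K N"
  by (simp add: restr_def osum_def)

context hilbert_module
begin

lemma trivial_direct_sum: "direct_sum H (car H) {0}" and finitely_generated_zero: "finitely_generated (restr H {0})"
proof -
  interpret HH: hilbert_module_pair H H ..
  have "closed_submodule H {x \<in> car H. x = 0}" by (rule HH.closed_kernel[OF bmm_id])
  moreover have "{x \<in> car H. x = 0} = {0}" by auto
  moreover have "closed_submodule H (car H)" by (simp add: closed_submodule_def)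
  ultimately show "direct_sum H (car H) {0}"
    by (auto simp: direct_sum_def intro!: exI[of _ 0])
  show "finitely_generated (restr H {0})"
    unfolding finitely_generated_def by (intro exI[of _ "{}"]) auto
qed

lemma bmm_upper_triangular:
  assumes "bounded_module_map H H F" "bounded_module_map H H C" "bounded_module_map H H D"
  shows "bounded_module_map (H \<oplus>\<^sub>H H) (H \<oplus>\<^sub>H H) (upper_triangular F C D)"
proof -
  interpret HH: hilbert_module_pair H H ..
  interpret OH: hilbert_module_pair "H \<oplus>\<^sub>H H" H
    using HH.hilbert_osum hilbert_module_axioms by (simp add: hilbert_module_pair_def)
  have "bounded_module_map (H \<oplus>\<^sub>H H) (H \<oplus>\<^sub>H H) (\<lambda>u. (F (fst u) + C (snd u), D (snd u)))"
    by (intro HH.bmm_Pair OH.bmm_plus bmm_compose[OF assms(1)] bmm_compose[OF assms(2)]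
        bmm_compose[OF assms(3)] HH.bmm_fst HH.bmm_snd HH.hilbert_osum)
  then show ?thesis by (simp add: upper_triangular_def case_prod_beta')
qed

lemma upper_triangular_adjointable:
  assumes "F \<in> B\<^sup>a H H" "C \<in> B\<^sup>a H H" "D \<in> B\<^sup>a H H"
  shows "upper_triangular F C D \<in> B\<^sup>a (H \<oplus>\<^sub>H H) (H \<oplus>\<^sub>H H)"
proof -
  interpret HH: hilbert_module_pair H H ..
  note b = assms[THEN adjointable_bmm]
  obtain F' where F': "\<And>y. y \<in> car H \<Longrightarrow> F' y \<in> car H"
    "\<And>x y. x \<in> car H \<Longrightarrow> y \<in> car H \<Longrightarrow> ip H (F x) y = ip H x (F' y)"
    using adjointable_adjoint[OF assms(1)] by blast
  obtain C' where C': "\<And>y. y \<in> car H \<Longrightarrow> C' y \<in> car H"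
    "\<And>x y. x \<in> car H \<Longrightarrow> y \<in> car H \<Longrightarrow> ip H (C x) y = ip H x (C' y)"
    using adjointable_adjoint[OF assms(2)] by blast
  obtain D' where D': "\<And>y. y \<in> car H \<Longrightarrow> D' y \<in> car H"
    "\<And>x y. x \<in> car H \<Longrightarrow> y \<in> car H \<Longrightarrow> ip H (D x) y = ip H x (D' y)"
    using adjointable_adjoint[OF assms(3)] by blast
  show ?thesis
    by (rule adjointableI[OF bmm_upper_triangular[OF b], where S = "\<lambda>(x, y). (F' x, C' x + D' y)"])
      (use F' C' D' b[THEN bmm_closed] in \<open>auto simp: upper_triangular_def ip_add_left ip_add_right add.assoc\<close>)
qed

end

lemma shift_upper_triangular:
  "shift (H \<oplus>\<^sub>H H) (upper_triangular F C D) \<alpha> = upper_triangular (shift H F \<alpha>) C (shift H D \<alpha>)"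
  by (auto simp: shift_def upper_triangular_def fun_eq_iff)

lemma map_prod_eq_upper_triangular:
  "map_prod F D = upper_triangular F (\<lambda>_. 0) D"
  by (auto simp: upper_triangular_def)

abbreviation ell2_double :: "((nat \<Rightarrow> 'a::cstar_algebra) \<times> (nat \<Rightarrow> 'a), 'a) hmod" where
  "ell2_double \<equiv> ell2 \<oplus>\<^sub>H ell2"

text \<open>In the second part \<open>D'\<close> is diagonal on the middle decomposition into
  \<open>P\<close> and \<open>Q\<close>, so a finitely generated \<open>Q\<close> would make
  \<open>D\<close> upper semi-Fredholm by compression. The unipotent factor carries
  \<open>P'\<close> to \<open>P\<close> and \<open>Q'\<close> to \<open>Q\<close>; this provides the
  two isomorphisms and transfers the failure of finite generation to \<open>Q'\<close>.\<close>

theorem upper_triangular_Fredholm_factors: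
  fixes F C D :: "(nat \<Rightarrow> 'a::cstar_algebra) \<Rightarrow> nat \<Rightarrow> 'a"
  assumes F: "F \<in> B\<^sup>a ell2 ell2" and C: "C \<in> B\<^sup>a ell2 ell2" and D: "D \<in> B\<^sup>a ell2 ell2"
    and U: "upper_triangular F C D \<in> M\<Phi>\<^sub>+ ell2_double"
  shows "F \<in> M\<Phi>\<^sub>+ ell2"
    and "D \<notin> M\<Phi>\<^sub>+ ell2 \<Longrightarrow> \<exists>M1 N1 M2 N2 P1 Q1 P2 Q2.
      diagonal_iso ell2_double (map_prod F id) M1 N1 M2 N2 \<and> diagonal_iso ell2_double (map_prod id D) P1 Q1 P2 Q2 \<and>
      isomorphic (restr ell2_double M2) (restr ell2_double P1) \<and> isomorphic (restr ell2_double N2) (restr ell2_double Q1) \<and>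
      finitely_generated (restr ell2_double N1) \<and>
      \<not> finitely_generated (restr ell2_double N2) \<and> \<not> finitely_generated (restr ell2_double Q1)"
proof -
  interpret A: hilbert_module "ell2 :: (nat \<Rightarrow> 'a, 'a) hmod" by (rule hilbert_ell2)
  interpret AA: hilbert_module_pair "ell2 :: (nat \<Rightarrow> 'a, 'a) hmod" ell2 ..
  interpret O: hilbert_module "ell2_double :: ((nat \<Rightarrow> 'a) \<times> (nat \<Rightarrow> 'a), 'a) hmod" by (rule AA.hilbert_osum)
  note b = F[THEN adjointable_bmm] C[THEN adjointable_bmm] D[THEN adjointable_bmm]
  have id: "bounded_module_map ell2 ell2 (id :: (nat \<Rightarrow> 'a) \<Rightarrow> nat \<Rightarrow> 'a)"
    unfolding id_def by (rule bmm_id)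
  note zero = AA.bmm_zero_map
  let ?U = "upper_triangular F C D" and ?F = "map_prod F id" and ?D = "map_prod id D"
    and ?C = "upper_triangular id C id" and ?V = "upper_triangular id (\<lambda>x. - C x) id"
    and ?E = "upper_triangular F C id"
  have Ub: "bounded_module_map ell2_double ell2_double ?U" and Eb: "bounded_module_map ell2_double ell2_double ?E"
    and Cb: "bounded_module_map ell2_double ell2_double ?C" and Fb: "bounded_module_map ell2_double ell2_double ?F"
    and Db: "bounded_module_map ell2_double ell2_double ?D" and Vb: "bounded_module_map ell2_double ell2_double ?V"
    unfolding map_prod_eq_upper_triangular
    by (intro A.bmm_upper_triangular b id zero AA.bmm_uminus)+
  obtain M1 N1 M2 N2 where diag: "diagonal_iso ell2_double ?U M1 N1 M2 N2" and fg: "finitely_generated (restr ell2_double N1)"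
    using U unfolding upper_semi_Fredholm_def by blast
  \<comment> \<open>The factors are split off one at a time, \<open>?U\<close> as \<open>?E\<close>
    followed by \<open>?D\<close> and \<open>?E\<close> as \<open>?F\<close> followed by
    \<open>?C\<close>, so the lemma on two factors is used twice.\<close>
  have UDE: "?U x = ?D (?E x)" for x by (cases x) (simp add: upper_triangular_def)
  have ECF: "?E x = ?C (?F x)" for x by (cases x) (simp add: upper_triangular_def)
  define P Q where "P = ?E ` M1" and "Q = {x \<in> car ell2_double. ?D x \<in> N2}"
  have dE: "diagonal_iso ell2_double ?E M1 N1 P Q" and dD: "diagonal_iso ell2_double ?D P Q M2 N2"
    unfolding P_def Q_def by (rule O.diagonal_iso_factor[OF Eb Db Ub UDE diag])+
  define P' Q' where "P' = ?F ` M1" and "Q' = {x \<in> car ell2_double. ?C x \<in> Q}"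
  have dF: "diagonal_iso ell2_double ?F M1 N1 P' Q'" and dC: "diagonal_iso ell2_double ?C P' Q' P Q"
    unfolding P'_def Q'_def by (rule O.diagonal_iso_factor[OF Fb Cb Eb ECF dE])+
  \<comment> \<open>The embedding of the first coordinate intertwines \<open>F\<close> with
    \<open>?F\<close>; for \<open>D\<close> below, the second coordinate plays this part.\<close>
  show "F \<in> M\<Phi>\<^sub>+ ell2"
    by (rule compression_upper_semi_Fredholm[OF O.hilbert_module_axioms Fb dF fg F AA.bmm_inl AA.bmm_fst]) auto
  assume notD: "D \<notin> M\<Phi>\<^sub>+ ell2"
  have nfg: "\<not> finitely_generated (restr ell2_double Q)"
  proof
    assume fgQ: "finitely_generated (restr ell2_double Q)"
    have "D \<in> M\<Phi>\<^sub>+ ell2"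
      by (rule compression_upper_semi_Fredholm[OF O.hilbert_module_axioms Db dD fgQ D AA.bmm_inr AA.bmm_snd]) auto
    with notD show False by simp
  qed
  have clQ: "closed_submodule ell2_double Q" "closed_submodule ell2_double Q'"
    using dC by (auto simp: diagonal_iso_def direct_sum_def)
  have hQ: "hilbert_module (restr ell2_double Q)" "hilbert_module (restr ell2_double Q')"
    using clQ by (auto intro: O.hilbert_restr)
  interpret QQ: hilbert_module_pair "restr ell2_double Q'" "restr ell2_double Q"
    using hQ by (simp add: hilbert_module_pair_def)
  have Qc: "Q \<subseteq> car ell2_double" "Q' \<subseteq> car ell2_double" using clQ by (auto simp: closed_submodule_def)
  have VC: "?V (?C x) = x" and CV: "?C (?V x) = x" for x by (cases x; simp add: upper_triangular_def)+
  have CQ: "bounded_module_map (restr ell2_double Q') (restr ell2_double Q) ?C"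
    by (intro bmm_restr_codomain bmm_restr_domain Cb Qc) (auto simp: Q'_def)
  \<comment> \<open>\<open>Q'\<close> is the full preimage of \<open>Q\<close> under
    \<open>?C\<close>, so the inverse \<open>?V\<close> maps \<open>Q\<close> back into it.\<close>
  have VQ: "bounded_module_map (restr ell2_double Q) (restr ell2_double Q') ?V"
    by (intro bmm_restr_codomain bmm_restr_domain Vb Qc)
      (use bmm_closed[OF Vb] Qc CV in \<open>auto simp del: osum_simps simp: Q'_def subset_iff\<close>)
  have isoQ: "isomorphism (restr ell2_double Q') (restr ell2_double Q) ?C"
    by (rule QQ.isomorphismI[OF CQ VQ VC CV])
  have isoP: "isomorphism (restr ell2_double P') (restr ell2_double P) ?C" using dC by (simp add: diagonal_iso_def)
  have "finitely_generated (restr ell2_double Q)" if "finitely_generated (restr ell2_double Q')"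
    by (rule finitely_generated_image[OF hQ(1) that _ hQ(2) CQ]) (use isoQ in \<open>auto simp: isomorphism_def bij_betw_def\<close>)
  then show "\<exists>M1 N1 M2 N2 P1 Q1 P2 Q2.
      diagonal_iso ell2_double (map_prod F id) M1 N1 M2 N2 \<and> diagonal_iso ell2_double (map_prod id D) P1 Q1 P2 Q2 \<and>
      isomorphic (restr ell2_double M2) (restr ell2_double P1) \<and> isomorphic (restr ell2_double N2) (restr ell2_double Q1) \<and>
      finitely_generated (restr ell2_double N1) \<and>
      \<not> finitely_generated (restr ell2_double N2) \<and> \<not> finitely_generated (restr ell2_double Q1)"
    using dF dD isoP isoQ fg nfg unfolding isomorphic_def by blast
qed

text \<open>Covers the case of two upper semi-Fredholm diagonal entries with \<open>C = 0\<close>;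
  the second conclusion makes the zero operator an admissible \<open>C\<close>.\<close>

lemma diagonal_Fredholm:
  fixes F D :: "(nat \<Rightarrow> 'a::cstar_algebra) \<Rightarrow> nat \<Rightarrow> 'a"
  assumes F: "F \<in> M\<Phi>\<^sub>+ ell2" and D: "D \<in> M\<Phi>\<^sub>+ ell2"
  shows "upper_triangular F (\<lambda>_. 0) D \<in> M\<Phi>\<^sub>+ ell2_double" "(\<lambda>_. 0) \<in> B\<^sup>a ell2 (ell2 :: (nat \<Rightarrow> 'a, 'a) hmod)"
proof -
  interpret A: hilbert_module "ell2 :: (nat \<Rightarrow> 'a, 'a) hmod" by (rule hilbert_ell2)
  interpret AA: hilbert_module_pair "ell2 :: (nat \<Rightarrow> 'a, 'a) hmod" ell2 ..
  interpret O: hilbert_module "ell2_double :: ((nat \<Rightarrow> 'a) \<times> (nat \<Rightarrow> 'a), 'a) hmod" by (rule AA.hilbert_osum)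
  show zero: "(\<lambda>_. 0) \<in> B\<^sup>a ell2 (ell2 :: (nat \<Rightarrow> 'a, 'a) hmod)"
    by (rule adjointableI[OF AA.bmm_zero_map, where S = "\<lambda>_. 0"]) auto
  obtain M1 N1 M2 N2 where Fa: "F \<in> B\<^sup>a ell2 ell2" and dF: "diagonal_iso ell2 F M1 N1 M2 N2"
    and fgF: "finitely_generated (restr ell2 N1)" using F unfolding upper_semi_Fredholm_def by blast
  obtain P1 Q1 P2 Q2 where Da: "D \<in> B\<^sup>a ell2 ell2" and dD: "diagonal_iso ell2 D P1 Q1 P2 Q2"
    and fgD: "finitely_generated (restr ell2 Q1)" using D unfolding upper_semi_Fredholm_def by blast
  obtain J where J: "bounded_module_map ell2 ell2 J" "\<And>y. y \<in> car ell2 \<Longrightarrow> J y \<in> M1" "\<And>x. x \<in> M1 \<Longrightarrow> J (F x) = x"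
      "\<And>y. y \<in> M2 \<Longrightarrow> F (J y) = y" "N2 = {y \<in> car ell2. J y = 0}" "N1 = {x \<in> car ell2. J (F x) = 0}"
    using A.diagonal_iso_left_inverse[OF adjointable_bmm[OF Fa] dF] by blast
  obtain I where I: "bounded_module_map ell2 ell2 I" "\<And>y. y \<in> car ell2 \<Longrightarrow> I y \<in> P1" "\<And>x. x \<in> P1 \<Longrightarrow> I (D x) = x"
      "\<And>y. y \<in> P2 \<Longrightarrow> D (I y) = y" "Q2 = {y \<in> car ell2. I y = 0}" "Q1 = {x \<in> car ell2. I (D x) = 0}"
    using A.diagonal_iso_left_inverse[OF adjointable_bmm[OF Da] dD] by blast
  have ds: "direct_sum ell2 M1 N1" "direct_sum ell2 P1 Q1" using dF dD by (auto simp: diagonal_iso_def)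
  interpret N: hilbert_module_pair "restr ell2 N1" "restr ell2 Q1"
    using A.hilbert_restr direct_sum_closed(2)[OF ds(1)] direct_sum_closed(2)[OF ds(2)]
    by (simp add: hilbert_module_pair_def)
  show "upper_triangular F (\<lambda>_. 0) D \<in> M\<Phi>\<^sub>+ ell2_double"
  proof (rule O.left_inverse_upper_semi_Fredholm)
    show "upper_triangular F (\<lambda>_. 0) D \<in> B\<^sup>a ell2_double ell2_double"
      by (rule A.upper_triangular_adjointable[OF Fa zero Da])
    show "direct_sum ell2_double (M1 \<times> P1) (N1 \<times> Q1)" by (rule AA.direct_sum_Times[OF ds])
    show "finitely_generated (restr ell2_double (N1 \<times> Q1))"
      unfolding restr_osum by (rule N.finitely_generated_osum[OF fgF fgD])
    show "bounded_module_map ell2_double ell2_double (upper_triangular J (\<lambda>_. 0) I)"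
      by (rule A.bmm_upper_triangular[OF J(1) AA.bmm_zero_map I(1)])
  qed (use J I in \<open>auto simp: upper_triangular_def\<close>)
qed

text \<open>The operator \<open>C\<close> is \<open>\<iota>\<close> after the projection onto \<open>Q1\<close>. It hides the kernel of \<open>D\<close> in the part \<open>N2\<close> of
  the codomain not reached by \<open>F\<close>, and \<open>\<iota>\<close> has a left inverse because its Gram operator is invertible.\<close>

theorem completion_Fredholm:
  fixes F D :: "(nat \<Rightarrow> 'a::cstar_algebra) \<Rightarrow> nat \<Rightarrow> 'a"
  assumes F: "F \<in> B\<^sup>a ell2 ell2" and D: "D \<in> B\<^sup>a ell2 ell2"
    and dF: "diagonal_iso ell2 F M1 N1 (perp ell2 N2) N2"
    and dD: "diagonal_iso ell2 D (perp ell2 Q1) Q1 P2 Q2"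
    and fg: "finitely_generated (restr ell2 N1)"
    and \<iota>: "\<iota> \<in> B\<^sup>a (restr ell2 Q1) (restr ell2 N2)"
    and iso: "isomorphism (restr ell2 Q1) (restr ell2 (\<iota> ` Q1)) \<iota>"
  obtains C where "C \<in> B\<^sup>a ell2 ell2" "upper_triangular F C D \<in> M\<Phi>\<^sub>+ ell2_double"
proof -
  interpret A: hilbert_module "ell2 :: (nat \<Rightarrow> 'a, 'a) hmod" by (rule hilbert_ell2)
  interpret AA: hilbert_module_pair "ell2 :: (nat \<Rightarrow> 'a, 'a) hmod" ell2 ..
  interpret O: hilbert_module "ell2_double :: ((nat \<Rightarrow> 'a) \<times> (nat \<Rightarrow> 'a), 'a) hmod" by (rule AA.hilbert_osum)
  interpret OA: hilbert_module_pair "ell2_double :: ((nat \<Rightarrow> 'a) \<times> (nat \<Rightarrow> 'a), 'a) hmod" ell2 ..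
  note Fb = adjointable_bmm[OF F] and Db = adjointable_bmm[OF D]
  have dsF: "direct_sum ell2 M1 N1" "direct_sum ell2 (perp ell2 N2) N2"
    and dsD: "direct_sum ell2 (perp ell2 Q1) Q1" and FM: "F ` M1 \<subseteq> perp ell2 N2" and DQ: "D ` Q1 \<subseteq> Q2"
    using dF dD by (auto simp: diagonal_iso_def)
  note clN = direct_sum_closed[OF dsF(2)] and clQ = direct_sum_closed[OF dsD] and clM = direct_sum_closed[OF dsF(1)]
  interpret QN: hilbert_module_pair "restr ell2 Q1" "restr ell2 N2"
    using A.hilbert_restr[OF clQ(2)] A.hilbert_restr[OF clN(2)] by (simp add: hilbert_module_pair_def)
  obtain J where J: "bounded_module_map ell2 ell2 J" "\<And>y. y \<in> car ell2 \<Longrightarrow> J y \<in> M1" "\<And>x. x \<in> M1 \<Longrightarrow> J (F x) = x"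
      "\<And>y. y \<in> perp ell2 N2 \<Longrightarrow> F (J y) = y" and JN: "N2 = {y \<in> car ell2. J y = 0}"
      and "N1 = {x \<in> car ell2. J (F x) = 0}"
    using A.diagonal_iso_left_inverse[OF Fb dF] by blast
  obtain I where I: "bounded_module_map ell2 ell2 I" and "\<And>y. y \<in> car ell2 \<Longrightarrow> I y \<in> perp ell2 Q1"
      and ID: "\<And>x. x \<in> perp ell2 Q1 \<Longrightarrow> I (D x) = x" and "\<And>y. y \<in> P2 \<Longrightarrow> D (I y) = y"
      and "Q2 = {y \<in> car ell2. I y = 0}" and IQ: "Q1 = {x \<in> car ell2. I (D x) = 0}"
    using A.diagonal_iso_left_inverse[OF Db dD] by blast
  obtain p where p: "bounded_module_map ell2 ell2 p" "\<And>x. x \<in> car ell2 \<Longrightarrow> p x \<in> perp ell2 Q1"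
    "\<And>x. x \<in> car ell2 \<Longrightarrow> x - p x \<in> Q1" "\<And>x. x \<in> perp ell2 Q1 \<Longrightarrow> p x = x" "\<And>x. x \<in> Q1 \<Longrightarrow> p x = 0"
    using A.direct_sum_projection[OF dsD] by blast
  obtain r where r: "bounded_module_map ell2 ell2 r" "\<And>x. x \<in> car ell2 \<Longrightarrow> r x \<in> perp ell2 N2"
    "\<And>x. x \<in> car ell2 \<Longrightarrow> x - r x \<in> N2" "\<And>x. x \<in> perp ell2 N2 \<Longrightarrow> r x = x" "\<And>x. x \<in> N2 \<Longrightarrow> r x = 0"
    using A.direct_sum_projection[OF dsF(2)] by blast
  have \<iota>b: "bounded_module_map (restr ell2 Q1) (restr ell2 N2) \<iota>" by (rule adjointable_bmm[OF \<iota>])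
  obtain S where S: "\<And>y. y \<in> N2 \<Longrightarrow> S y \<in> Q1" "\<And>x y. x \<in> Q1 \<Longrightarrow> y \<in> N2 \<Longrightarrow> ip ell2 (\<iota> x) y = ip ell2 x (S y)"
    using adjointable_adjoint[OF \<iota>] by auto
  \<comment> \<open>The reciprocal of a bound for the inverse of \<iota> on its image;
    \<open>\<bar>B\<bar> + 1\<close> is used because \<open>B\<close> may be nonpositive.\<close>
  obtain c where c: "c > 0" and below: "\<And>x. x \<in> Q1 \<Longrightarrow> c * hnorm ell2 x \<le> hnorm ell2 (\<iota> x)"
  proof -
    obtain B where B: "\<And>y. y \<in> \<iota> ` Q1 \<Longrightarrow> hnorm ell2 (inv_into Q1 \<iota> y) \<le> B * hnorm ell2 y"
      using iso by (auto simp: isomorphism_def bounded_between_def)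
    have inj: "inj_on \<iota> Q1" using iso by (simp add: isomorphism_def bij_betw_def)
    have "1 / (\<bar>B\<bar> + 1) * hnorm ell2 x \<le> hnorm ell2 (\<iota> x)" if x: "x \<in> Q1" for x
    proof -
      have "hnorm ell2 x \<le> B * hnorm ell2 (\<iota> x)" using B[of "\<iota> x"] x inj by simp
      also have "\<dots> \<le> (\<bar>B\<bar> + 1) * hnorm ell2 (\<iota> x)" by (intro mult_right_mono) auto
      finally show ?thesis by (simp add: divide_simps mult.commute)
    qed
    then show ?thesis by (intro that[of "1 / (\<bar>B\<bar> + 1)"]) auto
  qed
  have Sb: "bounded_module_map (restr ell2 N2) (restr ell2 Q1) S"
    by (rule QN.adjoint_bmm[OF \<iota>b]) (use S in auto)
  have S': "\<And>y. y \<in> car (restr ell2 N2) \<Longrightarrow> S y \<in> car (restr ell2 Q1)"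
    "\<And>x y. x \<in> car (restr ell2 Q1) \<Longrightarrow> y \<in> car (restr ell2 N2) \<Longrightarrow>
      ip (restr ell2 N2) (\<iota> x) y = ip (restr ell2 Q1) x (S y)"
    "\<And>x. x \<in> car (restr ell2 Q1) \<Longrightarrow> c * hnorm (restr ell2 Q1) x \<le> hnorm (restr ell2 N2) (\<iota> x)"
    using S below by auto
  \<comment> \<open>\<open>V \<circ> S\<close> is then a left inverse of \<iota> defined on all of
    \<open>N2\<close>, not only on the image of \<iota>.\<close>
  obtain V where V: "bounded_module_map (restr ell2 Q1) (restr ell2 Q1) V"
      "\<And>x. x \<in> car (restr ell2 Q1) \<Longrightarrow> V (S (\<iota> x)) = x"
      "\<And>x. x \<in> car (restr ell2 Q1) \<Longrightarrow> S (\<iota> (V x)) = x"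
    using QN.gram_inverse[OF \<iota>b S'(1,2) c S'(3)] by blast
  \<comment> \<open>\<open>q\<close> and the later \<open>s\<close> project onto \<open>Q1\<close>
    and \<open>N2\<close> along their orthogonal complements. Orthogonality makes
    \<open>C = \<iota> \<circ> q\<close> adjointable, with adjoint
    \<open>S \<circ> s\<close>.\<close>
  define q where "q x = x - p x" for x
  have q: "bounded_module_map ell2 (restr ell2 Q1) q"
    unfolding q_def by (intro bmm_restr_codomain AA.bmm_subtract[OF bmm_id p(1)] p(3))
  have qQ: "q x \<in> Q1" "q x \<in> car ell2" if "x \<in> car ell2" for x using p(3)[OF that] clQ by (auto simp: q_def)
  define s where "s x = x - r x" for x
  have s: "bounded_module_map ell2 (restr ell2 N2) s"
    unfolding s_def by (intro bmm_restr_codomain AA.bmm_subtract[OF bmm_id r(1)] r(3))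
  have sN: "s x \<in> N2" "s x \<in> car ell2" if "x \<in> car ell2" for x using r(3)[OF that] clN by (auto simp: s_def)
  define C where "C x = \<iota> (q x)" for x
  have C': "bounded_module_map ell2 (restr ell2 N2) C" unfolding C_def by (rule bmm_compose[OF \<iota>b q])
  have Cb: "bounded_module_map ell2 ell2 C" by (rule bmm_extend_codomain[OF C' clN(4)])
  have CN: "C x \<in> N2" if "x \<in> car ell2" for x using bmm_closed[OF C' that] by simp
  have Ca: "C \<in> B\<^sup>a ell2 ell2"
  proof (rule adjointableI[OF Cb])
    fix x y :: "nat \<Rightarrow> 'a" assume x: "x \<in> car ell2" and y: "y \<in> car ell2"
    have Sc: "S (s y) \<in> Q1" "S (s y) \<in> car ell2" using S(1)[OF sN(1)[OF y]] clQ by auto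
    have Cc: "C x \<in> car ell2" by (rule bmm_closed[OF Cb x])
    have "ip ell2 (r y) (C x) = 0" using r(2)[OF y] CN[OF x] by (simp add: perp_def)
    then have "ip ell2 (C x) (r y) = 0" using A.star_ip[OF bmm_closed[OF r(1) y] Cc] by simp
    then have "ip ell2 (C x) y = ip ell2 (C x) (s y)"
      using Cc y by (simp add: s_def A.ip_diff_right bmm_closed[OF r(1)])
    also have "\<dots> = ip ell2 (q x) (S (s y))" unfolding C_def by (rule S(2)[OF qQ(1)[OF x] sN(1)[OF y]])
    also have "\<dots> = ip ell2 x (S (s y))"
      using p(2)[OF x] Sc x by (simp add: q_def A.ip_diff_left bmm_closed[OF p(1)] perp_def)
    finally show "ip ell2 (C x) y = ip ell2 x (S (s y))" .
  qed (use S sN clQ in auto)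
  \<comment> \<open>Applied to \<open>F m + C y\<close> with \<open>m\<close> in \<open>M1\<close>,
    this discards \<open>F m\<close> and returns \<open>q y\<close>.\<close>
  define k where "k y = V (S (s y))" for y
  have k: "bounded_module_map ell2 ell2 k"
    unfolding k_def by (rule bmm_extend_codomain[OF bmm_compose[OF V(1) bmm_compose[OF Sb s]] clQ(4)])
  \<comment> \<open>On \<open>(F m + C y, D y)\<close> the map \<open>J\<close> returns
    \<open>m\<close>, because it kills \<open>N2\<close>; \<open>k\<close> returns
    \<open>q y\<close>, and \<open>I\<close> returns \<open>p y\<close>, because
    \<open>D (q y)\<close> lies in its kernel. The second coordinate is thus
    \<open>q y + p y = y\<close>.\<close>
  define G where "G u = (J (fst u), k (fst u) + I (snd u))" for u
  have G: "bounded_module_map ell2_double ell2_double G"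
    unfolding G_def
    by (intro AA.bmm_Pair OA.bmm_plus bmm_compose[OF J(1)] bmm_compose[OF k] bmm_compose[OF I]
        AA.bmm_fst AA.bmm_snd O.hilbert_module_axioms)
  have GU: "G (upper_triangular F C D (m, y)) = (m, y)" if m: "m \<in> M1" and y: "y \<in> car ell2" for m y
  proof -
    have mc: "m \<in> car ell2" using m clM by blast
    have Fm: "F m \<in> perp ell2 N2" "F m \<in> car ell2" using m FM bmm_closed[OF Fb mc] by auto
    have Cy: "C y \<in> N2" "C y \<in> car ell2" using CN[OF y] bmm_closed[OF Cb y] by auto
    have "J (C y) = 0" using Cy JN by blast
    then have 1: "J (F m + C y) = m" using Fm Cy m by (simp add: bmm_add[OF J(1)] J(3))
    have "s (F m + C y) = C y" using Fm Cy by (simp add: s_def bmm_add[OF r(1)] r(4,5))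
    then have 2: "k (F m + C y) = q y" using qQ[OF y] by (simp add: k_def C_def V(2))
    have pc: "p y \<in> car ell2" by (rule bmm_closed[OF p(1) y])
    have "I (D (q y)) = 0" using qQ(1)[OF y] IQ by blast
    moreover have "D y = D (p y) + D (q y)"
      using pc qQ(2)[OF y] bmm_add[OF Db, of "p y" "q y"] by (simp add: q_def)
    ultimately have "I (D y) = p y"
      using pc qQ(2)[OF y] ID[OF p(2)[OF y]] by (simp add: bmm_add[OF I] bmm_closed[OF Db])
    with 1 2 show ?thesis by (simp add: G_def upper_triangular_def q_def)
  qed
  interpret NZ: hilbert_module_pair "restr ell2 N1" "restr ell2 {0 :: nat \<Rightarrow> 'a}"
    using A.hilbert_restr[OF clM(2)] A.hilbert_restr[OF direct_sum_closed(2)[OF A.trivial_direct_sum]]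
    by (simp add: hilbert_module_pair_def)
  have "upper_triangular F C D \<in> M\<Phi>\<^sub>+ ell2_double"
  proof (rule O.left_inverse_upper_semi_Fredholm)
    show "upper_triangular F C D \<in> B\<^sup>a ell2_double ell2_double" by (rule A.upper_triangular_adjointable[OF F Ca D])
    show "direct_sum ell2_double (M1 \<times> car ell2) (N1 \<times> {0})"
      by (rule AA.direct_sum_Times[OF dsF(1) A.trivial_direct_sum])
    show "finitely_generated (restr ell2_double (N1 \<times> {0}))"
      unfolding restr_osum by (rule NZ.finitely_generated_osum[OF fg A.finitely_generated_zero])
    show "bounded_module_map ell2_double ell2_double G" by (rule G)
    show "G u \<in> M1 \<times> car ell2" if "u \<in> car ell2_double" for u
      using that J(2) bmm_closed[OF G that] by (auto simp: G_def)
  qed (use GU in auto)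
  with Ca that show ?thesis by blast
qed

theorem corollary3p20:
  fixes F D :: "(nat \<Rightarrow> 'a::cstar_algebra) \<Rightarrow> (nat \<Rightarrow> 'a)"
  assumes "F \<in> B\<^sup>a ell2 ell2" and "D \<in> B\<^sup>a ell2 ell2"
  shows "\<sigma>\<^sub>l\<^sub>e ell2 F \<union> (\<sigma>\<^sub>l\<^sub>e ell2 D \<inter> L' F D)
           \<subseteq> (\<Inter>C \<in> B\<^sup>a ell2 ell2. \<sigma>\<^sub>l\<^sub>e (ell2 \<oplus>\<^sub>H ell2) (upper_triangular F C D))
       \<and> (\<Inter>C \<in> B\<^sup>a ell2 ell2. \<sigma>\<^sub>l\<^sub>e (ell2 \<oplus>\<^sub>H ell2) (upper_triangular F C D))
           \<subseteq> \<sigma>\<^sub>l\<^sub>e ell2 F \<union> (\<sigma>\<^sub>l\<^sub>e ell2 D \<inter> L F D)"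
proof (intro conjI subsetI)
  interpret A: hilbert_module "ell2 :: (nat \<Rightarrow> 'a, 'a) hmod" by (rule hilbert_ell2)
  note sF = A.shift_adjointable[OF assms(1)] and sD = A.shift_adjointable[OF assms(2)]
  fix \<alpha> assume \<alpha>: "\<alpha> \<in> \<sigma>\<^sub>l\<^sub>e ell2 F \<union> (\<sigma>\<^sub>l\<^sub>e ell2 D \<inter> L' F D)"
  then have cen: "\<alpha> \<in> center" by (auto simp: spec_le_def)
  show "\<alpha> \<in> (\<Inter>C \<in> B\<^sup>a ell2 ell2. \<sigma>\<^sub>l\<^sub>e ell2_double (upper_triangular F C D))"
  proof (rule INT_I, rule ccontr)
    fix C :: "(nat \<Rightarrow> 'a) \<Rightarrow> nat \<Rightarrow> 'a"
    assume C: "C \<in> B\<^sup>a ell2 ell2" and "\<alpha> \<notin> \<sigma>\<^sub>l\<^sub>e ell2_double (upper_triangular F C D)"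
    then have U: "upper_triangular (shift ell2 F \<alpha>) C (shift ell2 D \<alpha>) \<in> M\<Phi>\<^sub>+ ell2_double"
      using cen by (simp add: spec_le_def shift_upper_triangular)
    note fac = upper_triangular_Fredholm_factors[OF sF[OF cen] C sD[OF cen] U]
    have "\<alpha> \<notin> \<sigma>\<^sub>l\<^sub>e ell2 F" using fac(1) by (simp add: spec_le_def)
    then have "shift ell2 D \<alpha> \<notin> M\<Phi>\<^sub>+ ell2" "\<alpha> \<in> L' F D" using \<alpha> by (auto simp: spec_le_def)
    \<comment> \<open>The decompositions found are exactly those whose absence defines
      \<open>L'\<close>.\<close>
    then show False using fac(2) unfolding L'_def Let_def by blast
  qed
next
  interpret A: hilbert_module "ell2 :: (nat \<Rightarrow> 'a, 'a) hmod" by (rule hilbert_ell2)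
  note sF = A.shift_adjointable[OF assms(1)] and sD = A.shift_adjointable[OF assms(2)]
  fix \<alpha> assume \<alpha>: "\<alpha> \<in> (\<Inter>C \<in> B\<^sup>a ell2 ell2. \<sigma>\<^sub>l\<^sub>e ell2_double (upper_triangular F C D))"
  \<comment> \<open>The intersection is over a nonempty set, as \<open>F\<close> itself is an
    admissible \<open>C\<close>; hence \<alpha> is central.\<close>
  then have cen: "\<alpha> \<in> center" using assms(1) by (auto simp: spec_le_def)
  have notU: "upper_triangular (shift ell2 F \<alpha>) C (shift ell2 D \<alpha>) \<notin> M\<Phi>\<^sub>+ ell2_double" if "C \<in> B\<^sup>a ell2 ell2" for C
    using \<alpha> that by (auto simp: spec_le_def shift_upper_triangular)
  show "\<alpha> \<in> \<sigma>\<^sub>l\<^sub>e ell2 F \<union> (\<sigma>\<^sub>l\<^sub>e ell2 D \<inter> L F D)"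
  proof (rule ccontr)
    assume "\<alpha> \<notin> \<sigma>\<^sub>l\<^sub>e ell2 F \<union> (\<sigma>\<^sub>l\<^sub>e ell2 D \<inter> L F D)"
    then have F: "shift ell2 F \<alpha> \<in> M\<Phi>\<^sub>+ ell2" and "shift ell2 D \<alpha> \<in> M\<Phi>\<^sub>+ ell2 \<or> \<alpha> \<notin> L F D"
      using cen by (auto simp: spec_le_def)
    then consider "shift ell2 D \<alpha> \<in> M\<Phi>\<^sub>+ ell2" | "\<alpha> \<notin> L F D" by blast
    then show False
    proof cases
      case 1
      then show False using diagonal_Fredholm[OF F 1] notU by blast
    next
      case 2
      then obtain M1 N1 N2 Q1 P2 Q2 \<iota> where
        d: "diagonal_iso ell2 (shift ell2 F \<alpha>) M1 N1 (perp ell2 N2) N2"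
        "diagonal_iso ell2 (shift ell2 D \<alpha>) (perp ell2 Q1) Q1 P2 Q2"
        "finitely_generated (restr ell2 N1)" "\<iota> \<in> B\<^sup>a (restr ell2 Q1) (restr ell2 N2)"
        "isomorphism (restr ell2 Q1) (restr ell2 (\<iota> ` Q1)) \<iota>"
        using cen unfolding L_def by blast
      show False using completion_Fredholm[OF sF[OF cen] sD[OF cen] d] notU by blast
    qed
  qed
qed

end
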